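(* Let $\{n_k\}_{k=1}^\infty$ be a subsequence of the natural numbers. The sequence $\{\sqrt{n_k}\,\mu^{-n_k}\mathcal{P}_{n_k}\}_{k=1}^\infty$ converges normally on $D$ if and only if $$\lim_{k\to\infty}e^{2\pi i(\log_{\mu^4}(n_k)-q)}=1$$ for some $q\in[0,1)$, in which case $$\lim_{k\to\infty}\frac{\sqrt{n_k}\,\mathcal{P}_{n_k}(t)}{\mu^{n_k}}=f_q(t):=\frac{(1-\mu t)^2(1-\mu^3/t)^2}{(1-\mu^4)R}\cdot\frac{\chi(\mu^{4q}t)-\chi(\mu^{4q+2}/t)}{t-\mu^2/t},\qquad t\in D.$$ Moreover, $f_q\neq f_p$ for $0\le q<p<1$, and since the sequence $\{\langle \log_{\mu^4} n\rangle\}_{n\in\mathbb{N}}$ is dense in $[0,1)$, it follows that the family $\{f_q(t):0\le q<1\}$ comprises all the limit points that the sequence $\{\sqrt{n}\,\mu^{-n}\mathcal{P}_n\}_{n=0}^\infty$ has on $D$.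
   Context: Fix $R>2$. Let $L_1=\{w-1+(w-1)^{-1}:|w|=R\}$; this is an analytic Jordan curve. Let $G_1$ be the bounded component of $\mathbb{C}\setminus L_1$, and let $\{p_n\}_{n\ge 0}$ be the unique sequence of polynomials such that $p_n$ has degree $n$ and positive leading coefficient and $$\frac1\pi\int_{G_1}p_n(z)\overline{p_m(z)}\,dx\,dy=\begin{cases}0,& n\ne m,\\ 1,& n=m.\end{cases}$$ Set $$\mu=\frac{R-\sqrt{R^2-4}}{2}\in(0,1),\qquad \psi(w)=Rw-1+\frac1{Rw-1},\qquad \lambda(z)=\frac{z-\mu}{\mu z-1},$$ $$\chi(t)=t\sum_{k=-\infty}^{\infty}\mu^{4k}e^{(\mu-\mu^{-1})\mu^{4k}t},\quad \Re(t)>0,$$ $$D=\{t\in\mathbb{C}:|t-1/R|<1/R,\ \Re(t)>R\mu^2/2\},\qquad \mathcal{P}_n(t)=p_n(\psi(\lambda(t))),\quad n\ge 0.$$ Here $\log_{\mu^4}x=\ln x/\ln(\mu^4)$, and $\langle x\rangle$ denotes the fractional part of $x$. Normal convergence on $D$ means uniform convergence on compact subsets of $D$; a limit point of a sequence of functions on $D$ is a function that is the normal limit on $D$ of some subsequence. At $t=\mu$ the quotient defining $f_q$, which has a removable singularity there, is understood as its limit. *)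

theory Defs
  imports "HOL-Analysis.Analysis"
begin

definition L1 :: "real \<Rightarrow> complex set" where
  "L1 R = {w - 1 + 1 / (w - 1) | w. cmod w = R}"

text \<open>Since \<^term>\<open>L1 R\<close> is a Jordan curve for \<open>R > 2\<close>, its \<^const>\<open>inside\<close> (the union of the bounded
  components of the complement) is the single bounded component.\<close>

definition G1 :: "real \<Rightarrow> complex set" where
  "G1 R = inside (L1 R)"

definition orthonormal_polys :: "real \<Rightarrow> (nat \<Rightarrow> complex poly) \<Rightarrow> bool" where
  "orthonormal_polys R p \<longleftrightarrow>
     (\<forall>n. degree (p n) = n \<and> lead_coeff (p n) \<in> \<real> \<and> Re (lead_coeff (p n)) > 0) \<and>
     (\<forall>n m. 1 / of_real pi * (LINT z:G1 R|lborel. poly (p n) z * cnj (poly (p m) z))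
              = (if n = m then 1 else 0))"

definition mu :: "real \<Rightarrow> real" where
  "mu R = (R - sqrt (R\<^sup>2 - 4)) / 2"

definition psi :: "real \<Rightarrow> complex \<Rightarrow> complex" where
  "psi R w = of_real R * w - 1 + 1 / (of_real R * w - 1)"

definition lam :: "real \<Rightarrow> complex \<Rightarrow> complex" where
  "lam R z = (z - of_real (mu R)) / (of_real (mu R) * z - 1)"

text \<open>The series is only meaningful (absolutely convergent) for \<open>Re t > 0\<close>; below, \<open>chi\<close> is only
  evaluated there.\<close>

definition chi :: "real \<Rightarrow> complex \<Rightarrow> complex" where
  "chi R t = t * (\<Sum>\<^sub>\<infinity>k\<in>(UNIV :: int set). of_real (mu R powi (4 * k)) *
                exp (of_real ((mu R - 1 / mu R) * mu R powi (4 * k)) * t))"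

definition Dom :: "real \<Rightarrow> complex set" where
  "Dom R = {t. cmod (t - 1 / of_real R) < 1 / R \<and> Re t > R * (mu R)\<^sup>2 / 2}"

definition PP :: "real \<Rightarrow> (nat \<Rightarrow> complex poly) \<Rightarrow> nat \<Rightarrow> complex \<Rightarrow> complex" where
  "PP R p n t = poly (p n) (psi R (lam R t))"

definition scaled_PP :: "real \<Rightarrow> (nat \<Rightarrow> complex poly) \<Rightarrow> nat \<Rightarrow> complex \<Rightarrow> complex" where
  "scaled_PP R p n t = of_real (sqrt (real n) / mu R ^ n) * PP R p n t"

definition f_quot :: "real \<Rightarrow> real \<Rightarrow> complex \<Rightarrow> complex" where
  "f_quot R q t =
     (1 - of_real (mu R) * t)\<^sup>2 * (1 - of_real (mu R ^ 3) / t)\<^sup>2 / of_real ((1 - mu R ^ 4) * R) *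
     ((chi R (of_real (mu R powr (4 * q)) * t) - chi R (of_real (mu R powr (4 * q + 2)) / t)) /
      (t - of_real ((mu R)\<^sup>2) / t))"

text \<open>On \<^term>\<open>Dom R\<close> the denominator \<open>t - \<mu>\<^sup>2 / t\<close> vanishes only at \<open>t = \<mu>\<close>, a removable singularity.\<close>

definition f_lim :: "real \<Rightarrow> real \<Rightarrow> complex \<Rightarrow> complex" where
  "f_lim R q t = (if t = of_real (mu R) then Lim (at t) (f_quot R q) else f_quot R q t)"

definition normal_limit ::
  "complex set \<Rightarrow> (nat \<Rightarrow> complex \<Rightarrow> complex) \<Rightarrow> (complex \<Rightarrow> complex) \<Rightarrow> bool" where
  "normal_limit U F g \<longleftrightarrow> (\<forall>K. compact K \<and> K \<subseteq> U \<longrightarrow> uniform_limit K F g sequentially)"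

definition converges_normally :: "complex set \<Rightarrow> (nat \<Rightarrow> complex \<Rightarrow> complex) \<Rightarrow> bool" where
  "converges_normally U F \<longleftrightarrow> (\<exists>g. normal_limit U F g)"

text \<open>Only the values of \<open>g\<close> on \<open>U\<close> matter.\<close>

definition normal_limit_point ::
  "complex set \<Rightarrow> (nat \<Rightarrow> complex \<Rightarrow> complex) \<Rightarrow> (complex \<Rightarrow> complex) \<Rightarrow> bool" where
  "normal_limit_point U F g \<longleftrightarrow> (\<exists>n. strict_mono n \<and> normal_limit U (\<lambda>k. F (n k)) g)"

definition log_phase_tendsto :: "real \<Rightarrow> (nat \<Rightarrow> nat) \<Rightarrow> real \<Rightarrow> bool" where
  "log_phase_tendsto R n q \<longleftrightarrow>
     (\<lambda>k. exp (2 * of_real pi * \<i> * of_real (log (mu R ^ 4) (real (n k)) - q))) \<longlonglongrightarrow> 1"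

end

theory Submission
  imports Defs "HOL-Complex_Analysis.Complex_Analysis"
begin

text \<open>
  Put \<open>w = \<lambda>(t)\<close> and \<open>\<Psi> = \<psi> \<circ> \<lambda>\<close>, and write \<open>m\<close> for \<open>\<mu>\<close>. The coordinate \<open>t\<close> linearizes the two symmetries of the problem.
  The map \<open>\<psi>\<close> is a shifted Joukowski map, so it identifies points in pairs, and in the coordinate \<open>t\<close> the
  pairing is \<open>t \<mapsto> m\<^sup>2 / t\<close>; reflection in \<open>\<bar>w\<bar> = 1\<close> becomes reflection in \<open>\<bar>t\<bar> = 1\<close>. Composing the two gives
  dilations by powers of \<open>m\<^sup>2\<close>, and this is where the sum over the powers of \<open>m^4\<close> in \<open>\<chi>\<close> comes from.

  A polynomial \<open>P\<close> pulls back to \<open>P(\<Psi>(t)) \<Psi>'(t) = \<alpha>(t) - (m / t)\<^sup>2 \<alpha>(m\<^sup>2 / t)\<close> with \<open>\<alpha>\<close> analytic in the unit disc: Faber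
  polynomials show that \<open>\<alpha> dt = g(w) dw\<close> for a polynomial \<open>g\<close> of the same degree as \<open>P\<close>. Up to a null set,
  \<open>\<Psi>\<close> maps the annulus \<open>m < \<bar>t\<bar> < 1\<close> bijectively onto \<open>G1\<close>, so a change of variables turns area integrals over
  \<open>G1\<close> into integrals over that annulus. The inner product of \<open>P\<close> and \<open>Q\<close> becomes the Dirichlet product of their
  analytic parts over \<open>m\<^sup>2 < \<bar>t\<bar> < 1\<close>, that is, a diagonal form with weights \<open>1 - m^(4(j+1))\<close>
  (lemma \<open>gram_formula\<close>). Equivalently, it pairs \<open>\<alpha>(t) - m^4 \<alpha>(m^4 t)\<close> with the analytic part of \<open>Q\<close> over the
  whole unit disc. The latter product is conformally invariant, so it may be computed in \<open>w\<close>, and there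
  orthogonality to all polynomials of lower degree says that the differential
  \<open>(\<alpha>(t) - m^4 \<alpha>(m^4 t)) dt\<close> is \<open>(v w^n + O(w^(n+1))) dw\<close>. The error comes only from the dilated copy, which is
  analytic in \<open>\<bar>w\<bar> < R - 1\<close>, and is therefore exponentially smaller than the leading term; the normalization gives
  \<open>v \<sim> sqrt n\<close> (lemma \<open>orthonormal_decomposition\<close>).

  Iterating the dilation sums the equation: \<open>\<alpha>(t)\<close> is \<open>v\<close> times the sum over \<open>k \<ge> 0\<close> of \<open>m^(4k) W(m^(4k) t)^n W'(m^(4k) t)\<close>,
  up to a small error. Since \<open>W(s) / m = exp (- (1 / m - m) s + O(s\<^sup>2))\<close> near the fixed point \<open>0\<close>, only the terms with
  \<open>m^(4k)\<close> comparable to \<open>1 / n\<close> matter. The sum thus becomes the two-sided series \<open>\<chi>(n t)\<close>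
  (lemma \<open>Phi_asymptotics\<close>). Dividing by \<open>\<Psi>'\<close> shows that the scaled \<open>n\<close>-th polynomial is locally uniformly close
  to \<open>f_q\<close> with \<open>q = log n\<close> to the base \<open>m^4\<close> (lemma \<open>scaled_PP_asymptotics\<close>). As \<open>\<chi>(m^4 t) = \<chi>(t)\<close>,
  \<open>f_q\<close> depends only on \<open>q\<close> modulo \<open>1\<close>, and continuously.

  Convergence along phases is then immediate. Its converse and the description of the limit points follow by
  compactness of the circle of phases, once \<open>f_q \<noteq> f_p\<close> is known for \<open>0 \<le> q < p < 1\<close> (lemma \<open>f_lim_distinct\<close>).
  If they agreed, then \<open>E(t) = \<chi>(a t) - \<chi>(b t)\<close> would satisfy \<open>E(t) = E(m\<^sup>2 / t)\<close> for two scales \<open>a\<close>, \<open>b\<close> that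
  are not equivalent modulo \<open>m^4\<close>. Far up a vertical line, \<open>E(t) / t\<close> is an almost periodic function of \<open>Im t\<close>,
  and the symmetry relates it to the same function with its frequencies multiplied by a free parameter. For a
  generic value of the parameter no frequencies coincide, so averaging against one of them gives a contradiction.
\<close>

section \<open>Change of variables for holomorphic maps\<close>

text \<open>Area integrals are carried over to \<open>\<real>\<^sup>2\<close>, where the Jacobian of a real map is a determinant.\<close>
definition vec_of_complex :: "complex \<Rightarrow> real ^ 2" where
  "vec_of_complex z = vector [Re z, Im z]"

definition complex_of_vec :: "real ^ 2 \<Rightarrow> complex" where
  "complex_of_vec x = Complex (x $ 1) (x $ 2)"

lemma vec_of_complex_nth [simp]:
  "vec_of_complex z $ 1 = Re z" "vec_of_complex z $ 2 = Im z"
  by (simp_all add: vec_of_complex_def)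

lemma complex_of_vec_inverse [simp]:
  "vec_of_complex (complex_of_vec x) = x" "complex_of_vec (vec_of_complex z) = z"
  by (simp_all add: complex_of_vec_def vec_eq_iff forall_2)

lemma bounded_linear_vec_of_complex: "bounded_linear vec_of_complex"
  by (auto intro!: linearI simp: linear_conv_bounded_linear[symmetric] vec_eq_iff forall_2)

lemma bounded_linear_complex_of_vec: "bounded_linear complex_of_vec"
  by (auto intro!: linearI simp: linear_conv_bounded_linear[symmetric] complex_of_vec_def complex_eq_iff)

lemmas continuous_vec_of_complex = linear_continuous_on[OF bounded_linear_vec_of_complex]
lemmas continuous_complex_of_vec = linear_continuous_on[OF bounded_linear_complex_of_vec]

lemma measurable_complex_of_vec [measurable]: "complex_of_vec \<in> borel \<rightarrow>\<^sub>M borel"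
  by (intro borel_measurable_continuous_onI continuous_complex_of_vec)

lemma lborel_complex_eq_distr: "(lborel :: complex measure) = distr lborel borel complex_of_vec"
proof (rule lborel_eqI)
  fix l u :: complex
  assume le: "\<And>b. b \<in> Basis \<Longrightarrow> l \<bullet> b \<le> u \<bullet> b"
  have le': "Re l \<le> Re u" "Im l \<le> Im u"
    using le[of 1] le[of \<i>] by (auto simp: Basis_complex_def)
  have "complex_of_vec -` box l u = box (vec_of_complex l) (vec_of_complex u)"
    by (auto simp: complex_of_vec_def mem_box_cart forall_2 in_box_complex_iff)
  moreover have "emeasure lborel (box (vec_of_complex l) (vec_of_complex u))
      = (\<Prod>b\<in>Basis. (vec_of_complex u - vec_of_complex l) \<bullet> b)"
    using le' by (subst emeasure_lborel_box) 
       (auto simp: Basis_vec_def cart_eq_inner_axis[symmetric] inner_diff_left inner_axis forall_2 UNIV_2)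
  moreover have "(\<Prod>b\<in>Basis. (vec_of_complex u - vec_of_complex l) \<bullet> b) = (Re u - Re l) * (Im u - Im l)"
    by (simp add: Basis_vec_def UNIV_2 inner_axis axis_eq_axis)
  moreover have "(\<Prod>b\<in>Basis. (u - l) \<bullet> b) = (Re u - Re l) * (Im u - Im l)"
    by (simp add: Basis_complex_def)
  ultimately show "emeasure (distr lborel borel complex_of_vec) (box l u) = (\<Prod>b\<in>Basis. (u - l) \<bullet> b)"
    by (subst emeasure_distr) auto
qed simp

text \<open>By the Cauchy-Riemann equations the real Jacobian determinant of a holomorphic map is \<open>\<bar>f'\<bar>\<^sup>2\<close>.\<close>
lemma holomorphic_change_of_variables:
  fixes f h :: "complex \<Rightarrow> complex"
  assumes f: "f holomorphic_on S" and S: "open S" and inj: "inj_on f S"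
    and h: "continuous_on (f ` S) h"
  shows "set_integrable lborel (f ` S) h \<longleftrightarrow>
           set_integrable lborel S (\<lambda>w. h (f w) * of_real ((norm (deriv f w))\<^sup>2))" (is ?thesis1)
    and "set_integrable lborel (f ` S) h \<Longrightarrow> (LINT z:f ` S|lborel. h z) =
           (LINT w:S|lborel. h (f w) * of_real ((norm (deriv f w))\<^sup>2))"
proof -
  define J where "J w = complex_of_real ((norm (deriv f w))\<^sup>2)" for w
  define g where "g = vec_of_complex \<circ> f \<circ> complex_of_vec"
  define g' where "g' x v = vec_of_complex (deriv f (complex_of_vec x) * complex_of_vec v)" for x v
  define S' where "S' = vec_of_complex ` S"
  have S'_eq: "S' = complex_of_vec -` S"
    unfolding S'_def by (auto simp: image_iff) (metis complex_of_vec_inverse(1))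
  have gS': "g ` S' = complex_of_vec -` (f ` S)"
    unfolding S'_def g_def by (auto simp: image_iff) (metis complex_of_vec_inverse(1))
  have opS': "open S'"
    unfolding S'_eq by (intro open_vimage S continuous_complex_of_vec)
  have opfS: "open (f ` S)"
    by (rule open_mapping_thm3[OF f S inj])
  have opgS': "open (g ` S')"
    unfolding gS' by (intro open_vimage opfS continuous_complex_of_vec)
  have der: "(g has_derivative g' x) (at x within S')" if "x \<in> S'" for x
  proof -
    have "complex_of_vec x \<in> S" using that S'_eq by auto
    then have "(f has_field_derivative deriv f (complex_of_vec x)) (at (complex_of_vec x))"
      using f S holomorphic_derivI by blast
    then have 1: "(f has_derivative (\<lambda>v. deriv f (complex_of_vec x) * v)) (at (complex_of_vec x))"
      by (simp add: has_field_derivative_def)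
    have "((\<lambda>x. vec_of_complex (f (complex_of_vec x))) has_derivative g' x) (at x)"
      unfolding g'_def
      by (intro bounded_linear.has_derivative[OF bounded_linear_vec_of_complex]
          has_derivative_compose[OF bounded_linear.has_derivative[OF bounded_linear_complex_of_vec has_derivative_ident] 1])
    then show ?thesis by (simp add: g_def o_def has_derivative_at_withinI)
  qed
  have inj': "inj_on g S'"
    using inj unfolding g_def S'_def inj_on_def by (metis comp_apply complex_of_vec_inverse(2) imageE)
  have det: "\<bar>det (matrix (g' x))\<bar> = (norm (deriv f (complex_of_vec x)))\<^sup>2" for x
    unfolding g'_def matrix_def det_2
    by (simp add: complex_of_vec_def axis_def cmod_power2 flip: power2_eq_square)
  have int1: "set_integrable lborel (complex_of_vec -` T) (F \<circ> complex_of_vec) \<longleftrightarrow> set_integrable lborel T F"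
    and int2: "(LINT x:complex_of_vec -` T|lborel. F (complex_of_vec x)) = (LINT z:T|lborel. F z)"
    if "open T" "continuous_on T F" for T and F :: "complex \<Rightarrow> complex"
  proof -
    have m[measurable]: "(\<lambda>z. indicator T z *\<^sub>R F z) \<in> borel_measurable borel"
      using that by (intro borel_measurable_continuous_on_indicator) auto
    have [simp]: "indicator (complex_of_vec -` T) x = (indicator T (complex_of_vec x) :: real)" for x
      by (auto simp: indicator_def)
    show "set_integrable lborel (complex_of_vec -` T) (F \<circ> complex_of_vec) \<longleftrightarrow> set_integrable lborel T F"
      unfolding set_integrable_def
      by (subst lborel_complex_eq_distr, subst integrable_distr_eq) (auto simp: o_def)
    show "(LINT x:complex_of_vec -` T|lborel. F (complex_of_vec x)) = (LINT z:T|lborel. F z)"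
      unfolding set_lebesgue_integral_def
      by (subst lborel_complex_eq_distr, subst integral_distr) (auto simp: o_def)
  qed
  have vec1: "(\<lambda>x. vec_of_complex (F x)) absolutely_integrable_on T \<longleftrightarrow> F absolutely_integrable_on T"
    for F :: "real^2 \<Rightarrow> complex" and T
  proof
    assume "(\<lambda>x. vec_of_complex (F x)) absolutely_integrable_on T"
    from absolutely_integrable_linear[OF this bounded_linear_complex_of_vec]
    show "F absolutely_integrable_on T" by (simp add: o_def)
  next
    assume "F absolutely_integrable_on T"
    from absolutely_integrable_linear[OF this bounded_linear_vec_of_complex]
    show "(\<lambda>x. vec_of_complex (F x)) absolutely_integrable_on T" by (simp add: o_def)
  qed
  have vec2: "integral T (\<lambda>x. vec_of_complex (F x)) = vec_of_complex (integral T F)"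
    if "F absolutely_integrable_on T" for F :: "real^2 \<Rightarrow> complex" and T
    using integral_linear[OF _ bounded_linear_vec_of_complex, of F T] that
    by (simp add: o_def absolutely_integrable_on_def)
  have leb: "set_integrable lborel T F \<longleftrightarrow> F absolutely_integrable_on T"
    "set_integrable lborel T F \<Longrightarrow> (LINT x:T|lborel. F x) = integral T F"
    if "open T" "continuous_on T F" for T and F :: "real^2 \<Rightarrow> complex"
  proof -
    have m[measurable]: "(\<lambda>z. indicator T z *\<^sub>R F z) \<in> borel_measurable borel"
      using that by (intro borel_measurable_continuous_on_indicator) auto
    show *: "set_integrable lborel T F \<longleftrightarrow> F absolutely_integrable_on T"
      unfolding set_integrable_def by (subst integrable_completion) auto
    assume "set_integrable lborel T F"
    then have "F absolutely_integrable_on T" using * by simp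
    from set_lebesgue_integral_eq_integral(2)[OF this]
    have "(LINT x:T|lebesgue. F x) = integral T F" .
    then show "(LINT x:T|lborel. F x) = integral T F"
      unfolding set_lebesgue_integral_def by (subst (asm) integral_completion) auto
  qed
  have contJ: "continuous_on S (\<lambda>w. h (f w) * J w)"
    unfolding J_def
    by (intro continuous_intros continuous_on_compose2[OF h] holomorphic_on_imp_continuous_on f
        holomorphic_deriv S) auto
  have contcv: "continuous_on T (F \<circ> complex_of_vec)" if "continuous_on (complex_of_vec ` T) F" for F :: "complex \<Rightarrow> complex" and T
    using that by (intro continuous_on_compose continuous_complex_of_vec)
  define F1 where "F1 = h \<circ> complex_of_vec"
  define F2 where "F2 = (\<lambda>w. h (f w) * J w) \<circ> complex_of_vec"
  have c1: "continuous_on (g ` S') F1" unfolding F1_def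
    by (rule contcv, rule continuous_on_subset[OF h]) (auto simp: gS')
  have c2: "continuous_on S' F2" unfolding F2_def
    by (rule contcv, rule continuous_on_subset[OF contJ]) (auto simp: S'_def)
  have F2eq: "\<bar>det (matrix (g' x))\<bar> *\<^sub>R vec_of_complex (F1 (g x)) = vec_of_complex (F2 x)" for x
    unfolding F1_def F2_def J_def det g_def
    by (simp add: vec_eq_iff forall_2)
  have cv: "(\<lambda>x. vec_of_complex (F2 x)) absolutely_integrable_on S' \<and> integral S' (\<lambda>x. vec_of_complex (F2 x)) = b \<longleftrightarrow>
        (\<lambda>x. vec_of_complex (F1 x)) absolutely_integrable_on g ` S' \<and> integral (g ` S') (\<lambda>x. vec_of_complex (F1 x)) = b" for b
    using has_absolute_integral_change_of_variables[OF _ der inj', of "\<lambda>x. vec_of_complex (F1 x)" b] opS'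
    by (simp add: F2eq sets_completionI_sets)
  have A: "set_integrable lborel (f ` S) h \<longleftrightarrow> F1 absolutely_integrable_on g ` S'"
    using int1[OF opfS h] leb(1)[OF opgS' c1] unfolding F1_def gS' by simp
  have B: "set_integrable lborel S (\<lambda>w. h (f w) * J w) \<longleftrightarrow> F2 absolutely_integrable_on S'"
    using int1[OF S contJ] leb(1)[OF opS' c2] unfolding F2_def S'_eq by simp
  show t1: ?thesis1
    using A B cv vec1 unfolding J_def by metis
  assume asm: "set_integrable lborel (f ` S) h"
  then have "F1 absolutely_integrable_on g ` S'" "F2 absolutely_integrable_on S'"
    using A B t1 unfolding J_def by metis+
  then have "integral (g ` S') F1 = integral S' F2"
    using cv vec1 vec2 by (metis complex_of_vec_inverse(2))
  moreover have "(LINT z:f ` S|lborel. h z) = integral (g ` S') F1"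
    using int2[OF opfS h] leb(2)[OF opgS' c1] A asm leb(1)[OF opgS' c1] unfolding F1_def gS' by simp
  moreover have "(LINT w:S|lborel. h (f w) * J w) = integral S' F2"
    using int2[OF S contJ] leb(2)[OF opS' c2] leb(1)[OF opS' c2] \<open>F2 absolutely_integrable_on S'\<close> unfolding F2_def S'_eq by simp
  ultimately show "(LINT z:f ` S|lborel. h z) =
           (LINT w:S|lborel. h (f w) * of_real ((norm (deriv f w))\<^sup>2))"
    unfolding J_def by simp
qed

section \<open>Area integrals over annuli\<close>

lemma set_integrable_bounded_continuous:
  fixes F :: "complex \<Rightarrow> complex"
  assumes "S \<in> sets borel" "bounded S" "continuous_on S F" "\<And>t. t \<in> S \<Longrightarrow> norm (F t) \<le> B"
  shows "set_integrable lborel S F"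
proof -
  have [measurable]: "(\<lambda>z. indicator S z *\<^sub>R F z) \<in> borel_measurable borel"
    using assms by (intro borel_measurable_continuous_on_indicator) auto
  have "emeasure lborel S < \<infinity>"
    using emeasure_bounded_finite[OF assms(2)] assms(1) by simp
  then have "set_integrable lborel S (\<lambda>_. B)"
    using assms(1) by (simp add: set_integrable_def)
  then show ?thesis
    unfolding set_integrable_def
    by (rule Bochner_Integration.integrable_bound)
       (measurable, use assms(4) in \<open>auto simp: indicator_def intro: order_trans[OF _ abs_ge_self]\<close>)
qed

definition annulus :: "real \<Rightarrow> real \<Rightarrow> complex set" where
  "annulus a b = {t. a < norm t \<and> norm t < b}"

lemma open_annulus: "open (annulus a b)"
  unfolding annulus_def by (intro open_Collect_conj open_Collect_less continuous_intros)

lemma bounded_annulus: "bounded (annulus a b)"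
  by (rule bounded_subset[of "ball 0 b"]) (auto simp: annulus_def)

text \<open>Rotations preserve area, so an integrand that changes sign under one has an integral equal to its own negative.\<close>
lemma annulus_integral_rotation:
  fixes F :: "complex \<Rightarrow> complex"
  assumes F: "continuous_on (annulus a b) F" "\<And>t. t \<in> annulus a b \<Longrightarrow> norm (F t) \<le> B"
    and c: "norm c = 1" and anti: "\<And>t. t \<in> annulus a b \<Longrightarrow> F (c * t) = - F t"
  shows "(LINT t:annulus a b|lborel. F t) = 0"
proof -
  have [simp]: "c \<noteq> 0" using c by auto
  have im: "(*) c ` annulus a b = annulus a b"
  proof
    show "(*) c ` annulus a b \<subseteq> annulus a b" using c by (auto simp: annulus_def norm_mult)
    show "annulus a b \<subseteq> (*) c ` annulus a b"
    proof
      fix t assume "t \<in> annulus a b"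
      then show "t \<in> (*) c ` annulus a b"
        using c by (intro image_eqI[of _ _ "t / c"]) (auto simp: annulus_def norm_divide)
    qed
  qed
  have d: "deriv ((*) c) t = c" for t
    by (intro DERIV_imp_deriv) (auto intro!: derivative_eq_intros)
  have "(LINT t:(*) c ` annulus a b|lborel. F t) = (LINT t:annulus a b|lborel. F (c * t) * of_real ((norm (deriv ((*) c) t))\<^sup>2))"
    using F by (intro holomorphic_change_of_variables)
      (auto intro!: holomorphic_intros open_annulus inj_onI set_integrable_bounded_continuous bounded_annulus
            simp: im borel_open[OF open_annulus])
  also have "\<dots> = (LINT t:annulus a b|lborel. - F t)"
    by (intro set_lebesgue_integral_cong) (use anti c in \<open>auto simp: d borel_open open_annulus\<close>)
  also have "\<dots> = - (LINT t:annulus a b|lborel. F t)"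
    by (simp add: set_lebesgue_integral_def)
  finally show ?thesis by (simp add: im)
qed

text \<open>The disc of radius \<open>sqrt s\<close> has area \<open>\<pi> s\<close>; hence \<open>\<bar>t\<bar>\<^sup>2\<close> pushes area forward to \<open>\<pi>\<close> times length. Radial
  integrals can be computed from this without polar coordinates.\<close>
lemma distr_norm_square_ball:
  assumes "r > 0"
  shows "distr (density lborel (indicator (ball 0 r :: complex set))) borel (\<lambda>t. (norm t)\<^sup>2)
       = density lborel (\<lambda>s. ennreal pi * indicator {0<..<r\<^sup>2} s)" (is "?M = ?N")
proof (rule measure_eqI_lessThan)
  have [measurable]: "ball (0::complex) r \<in> sets borel" by simp
  have meas: "emeasure lborel (ball (0::complex) q) = ennreal (pi * q\<^sup>2)" if "q \<ge> 0" for q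
    using that by (simp add: emeasure_ball unit_ball_vol_2 flip: ennreal_mult)
  have meas': "emeasure lborel (cball (0::complex) q) = ennreal (pi * q\<^sup>2)" if "q \<ge> 0" for q
    using that by (simp add: emeasure_cball unit_ball_vol_2 flip: ennreal_mult)
  have M: "emeasure ?M {x<..} = ennreal (pi * (r\<^sup>2 - min (r\<^sup>2) (max x 0)))" for x
  proof -
    have "emeasure ?M {x<..} = emeasure (density lborel (indicator (ball 0 r :: complex set))) {t::complex. x < (norm t)\<^sup>2}"
      by (subst emeasure_distr) (auto simp: vimage_def)
    also have "\<dots> = emeasure lborel (ball 0 r \<inter> {t::complex. x < (norm t)\<^sup>2})"
      by (subst emeasure_density) (auto simp: indicator_inter_arith[symmetric])
    also have "\<dots> = ennreal (pi * (r\<^sup>2 - min (r\<^sup>2) (max x 0)))"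
    proof (cases "x < 0")
      case True
      then have "ball 0 r \<inter> {t::complex. x < (norm t)\<^sup>2} = ball 0 r"
        by (auto intro: less_le_trans[OF True])
      then show ?thesis using True assms by (simp add: meas)
    next
      case False
      show ?thesis
      proof (cases "x < r\<^sup>2")
        case True
        have "ball 0 r \<inter> {t::complex. x < (norm t)\<^sup>2} = ball 0 r - cball 0 (sqrt x)"
        proof -
          have "x < (norm t)\<^sup>2 \<longleftrightarrow> sqrt x < norm t" for t :: complex
            by (subst real_sqrt_less_iff[symmetric]) (simp del: real_sqrt_less_iff)
          then show ?thesis unfolding set_eq_iff by (simp add: not_le)
        qed
        moreover have "cball (0::complex) (sqrt x) \<subseteq> ball 0 r"
        proof -
          have "sqrt x < r" using True False assms by (simp add: real_less_lsqrt)
          then show ?thesis by auto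
        qed
        ultimately have "emeasure lborel (ball 0 r \<inter> {t::complex. x < (norm t)\<^sup>2})
            = ennreal (pi * r\<^sup>2) - ennreal (pi * (sqrt x)\<^sup>2)"
          using False assms by (simp add: emeasure_Diff meas meas')
        also have "\<dots> = ennreal (pi * (r\<^sup>2 - min (r\<^sup>2) (max x 0)))"
          using True False by (simp add: ennreal_minus right_diff_distrib)
        finally show ?thesis .
      next
        case F2: False
        have "\<not> (norm t < r \<and> x < (norm t)\<^sup>2)" for t :: complex
          using power_mono[of "norm t" r 2] F2 by auto
        then have "ball 0 r \<inter> {t::complex. x < (norm t)\<^sup>2} = {}"
          unfolding set_eq_iff by simp
        then show ?thesis using F2 False by simp
      qed
    qed
    finally show ?thesis .
  qed
  show "emeasure ?M {x<..} < \<infinity>" for x by (simp add: M)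
  show "emeasure ?M {x<..} = emeasure ?N {x<..}" for x
  proof -
    have "emeasure ?N {x<..} = ennreal pi * emeasure lborel ({0<..<r\<^sup>2} \<inter> {x<..})"
      by (subst emeasure_density) (auto simp: mult.assoc indicator_inter_arith[symmetric] nn_integral_cmult_indicator)
    also have "{0<..<r\<^sup>2} \<inter> {x<..} = {max x 0<..<r\<^sup>2}" by auto
    also have "ennreal pi * emeasure lborel {max x 0<..<r\<^sup>2} = ennreal (pi * (r\<^sup>2 - min (r\<^sup>2) (max x 0)))"
      using zero_le_power2[of r]
      by (cases "max x 0 \<le> r\<^sup>2"; cases "0 \<le> x") (simp_all add: min_def max_def flip: ennreal_mult)
    finally show ?thesis by (simp add: M)
  qed
qed auto

lemma radial_integral_annulus:
  fixes \<phi> :: "real \<Rightarrow> complex"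
  assumes "0 \<le> a" "a < b" and \<phi>: "continuous_on {a\<^sup>2..b\<^sup>2} \<phi>"
    and \<Phi>: "\<And>s. s \<in> {a\<^sup>2..b\<^sup>2} \<Longrightarrow> (\<Phi> has_vector_derivative \<phi> s) (at s within {a\<^sup>2..b\<^sup>2})"
  shows "(LINT t:annulus a b|lborel. \<phi> ((norm t)\<^sup>2)) = of_real pi * (\<Phi> (b\<^sup>2) - \<Phi> (a\<^sup>2))"
proof -
  have ab: "a\<^sup>2 < b\<^sup>2" using assms power_strict_mono[of a b 2] by auto
  have lt: "x\<^sup>2 < y\<^sup>2 \<longleftrightarrow> x < y" if "0 \<le> x" "0 \<le> y" for x y :: real
    using that by (meson power2_less_imp_less power_strict_mono zero_less_numeral)
  define g where "g s = indicator {a\<^sup>2<..<b\<^sup>2} s *\<^sub>R \<phi> s" for s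
  have [measurable]: "g \<in> borel_measurable borel"
    unfolding g_def by (rule borel_measurable_continuous_on_indicator)
      (auto intro: continuous_on_subset[OF \<phi>])
  have "(LINT t:annulus a b|lborel. \<phi> ((norm t)\<^sup>2)) = (LINT t|density lborel (\<lambda>t. ennreal (indicator (ball 0 b :: complex set) t)). g ((norm t)\<^sup>2))"
    unfolding set_lebesgue_integral_def
    apply (subst integral_density)
       apply (measurable, measurable, simp, simp)
    apply (rule Bochner_Integration.integral_cong)
    using assms(1,2) apply (simp_all add: g_def indicator_def annulus_def lt)
    done
  also have "(\<lambda>t. ennreal (indicator (ball 0 b :: complex set) t)) = indicator (ball 0 b)"
    by (auto simp: indicator_def)
  also have "(LINT t|density lborel (indicator (ball 0 b :: complex set)). g ((norm t)\<^sup>2)) =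
     integral\<^sup>L (distr (density lborel (indicator (ball 0 b :: complex set))) borel (\<lambda>t. (norm t)\<^sup>2)) g"
    by (subst integral_distr) auto
  also have "\<dots> = integral\<^sup>L (density lborel (\<lambda>s. ennreal (pi * indicator {0<..<b\<^sup>2} s))) g"
    using assms by (subst distr_norm_square_ball) (auto simp: ennreal_mult ennreal_indicator)
  also have "\<dots> = (LINT s|lborel. (pi * indicator {0<..<b\<^sup>2} s) *\<^sub>R g s)"
    by (subst integral_density) auto
  also have "\<dots> = (LINT s|lborel. pi *\<^sub>R (indicator {a\<^sup>2<..<b\<^sup>2} s *\<^sub>R \<phi> s))"
    by (intro Bochner_Integration.integral_cong)
       (auto simp: g_def indicator_def dest: order.strict_trans1[OF zero_le_power2])
  also have "\<dots> = pi *\<^sub>R (LINT s:{a\<^sup>2<..<b\<^sup>2}|lborel. \<phi> s)"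
    unfolding set_lebesgue_integral_def by (rule integral_scaleR_right)
  also have "(LINT s:{a\<^sup>2<..<b\<^sup>2}|lborel. \<phi> s) = (LINT s:{a\<^sup>2..b\<^sup>2}|lborel. \<phi> s)"
  proof -
    have "AE s in lborel. s \<noteq> a\<^sup>2 \<and> s \<noteq> b\<^sup>2"
      using AE_lborel_singleton[of "a\<^sup>2"] AE_lborel_singleton[of "b\<^sup>2"] by auto
    then have ae: "AE s in lborel. indicator {a\<^sup>2<..<b\<^sup>2} s *\<^sub>R \<phi> s = indicator {a\<^sup>2..b\<^sup>2} s *\<^sub>R \<phi> s"
      by eventually_elim (auto simp: indicator_def)
    have m: "(\<lambda>s. indicator {a\<^sup>2<..<b\<^sup>2} s *\<^sub>R \<phi> s) \<in> borel_measurable lborel"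
      "(\<lambda>s. indicator {a\<^sup>2..b\<^sup>2} s *\<^sub>R \<phi> s) \<in> borel_measurable lborel"
      using \<phi> by (auto intro!: borel_measurable_continuous_on_indicator intro: continuous_on_subset)
    show ?thesis
      unfolding set_lebesgue_integral_def by (rule integral_cong_AE[OF m ae])
  qed
  also have "(LINT s:{a\<^sup>2..b\<^sup>2}|lborel. \<phi> s) = \<Phi> (b\<^sup>2) - \<Phi> (a\<^sup>2)"
    unfolding set_lebesgue_integral_def
    by (rule integral_FTC_Icc) (use ab \<Phi> \<phi> in auto)
  finally show ?thesis by (simp add: scaleR_conv_of_real)
qed

text \<open>Rotation by the angle \<open>\<pi> / (j - k)\<close> multiplies the integrand by \<open>-1\<close>.\<close>
lemma annulus_monomials_orthogonal:
  fixes j k :: int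
  assumes "0 < a \<or> 0 \<le> j \<and> 0 \<le> k" "0 \<le> a" "j \<noteq> k"
  shows "(LINT t:annulus a b|lborel. t powi j * cnj (t powi k)) = 0"
proof -
  define c where "c = cis (pi / (j - k))"
  have c: "norm c = 1" "c \<noteq> 0" by (simp_all add: c_def)
  have pw: "c powi n = cis (n * (pi / (j - k)))" for n
    unfolding c_def by (rule cis_power_int)
  have "c powi j * cnj (c powi k) = cis (of_int (j - k) * (pi / of_int (j - k)))"
    unfolding pw cis_cnj cis_mult by (simp add: left_diff_distrib diff_divide_distrib)
  also have "\<dots> = -1" using assms by simp
  finally have m: "c powi j * cnj (c powi k) = -1" .
  have b: "norm (t powi n) \<le> a powi n + b powi n" if "t \<in> annulus a b" "0 < a \<or> 0 \<le> n" for t n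
  proof (cases "n \<ge> 0")
    case True
    then have "norm (t powi n) \<le> b powi n" using that
      by (auto simp: norm_power_int annulus_def intro!: power_int_mono)
    then show ?thesis using assms(2) by (simp add: add_increasing)
  next
    case False
    then have "norm (t powi n) \<le> a powi n" using that
      by (auto simp: norm_power_int annulus_def intro!: power_int_antimono)
    moreover have "0 \<le> b" using that assms(2) unfolding annulus_def
      by (smt (verit, best) mem_Collect_eq)
    ultimately show ?thesis by (simp add: add_increasing2)
  qed
  have nz: "t \<noteq> 0" if "t \<in> annulus a b" for t
    using that assms(2) by (auto simp: annulus_def)
  show ?thesis
  proof (rule annulus_integral_rotation[OF _ _ c(1)])
    show "continuous_on (annulus a b) (\<lambda>t. t powi j * cnj (t powi k))"
      by (intro continuous_intros) (use nz in auto)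
    show "norm (t powi j * cnj (t powi k)) \<le> (a powi j + b powi j) * (a powi k + b powi k)"
      if "t \<in> annulus a b" for t
      unfolding norm_mult complex_mod_cnj
      by (intro mult_mono b[OF that] order_trans[OF norm_ge_zero b[OF that]]) (use assms in auto)
    show "(c * t) powi j * cnj ((c * t) powi k) = - (t powi j * cnj (t powi k))" for t
      using m by (simp add: power_int_mult_distrib) algebra
  qed
qed

lemma DERIV_power_Suc_divide:
  "((\<lambda>s. s ^ Suc n / real (Suc n)) has_real_derivative s ^ n) (at s within A)"
  using DERIV_cdivide[OF DERIV_power[OF DERIV_ident, of "Suc n"], of "real (Suc n)"] by simp

lemma annulus_square_power_integral:
  assumes "0 \<le> a" "a < b"
  shows "(LINT t:annulus a b|lborel. t ^ n * cnj (t ^ n)) = of_real (pi * ((b\<^sup>2) ^ (n + 1) - (a\<^sup>2) ^ (n + 1)) / (n + 1))"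
proof -
  have "(LINT t:annulus a b|lborel. t ^ n * cnj (t ^ n)) = (LINT t:annulus a b|lborel. of_real (((norm t)\<^sup>2) ^ n))"
    by (intro set_lebesgue_integral_cong)
      (simp_all only: borel_open[OF open_annulus] complex_cnj_power power_mult_distrib[symmetric]
         complex_norm_square[symmetric] of_real_power sets_lborel simp_thms)
  also have "\<dots> = of_real pi * (of_real ((b\<^sup>2) ^ (n + 1) / (n + 1)) - of_real ((a\<^sup>2) ^ (n + 1) / (n + 1)))"
    by (rule radial_integral_annulus[OF assms, where \<phi> = "\<lambda>s. of_real (s ^ n)" and \<Phi> = "\<lambda>s. of_real (s ^ (n + 1) / (n + 1))"])
    (auto intro!: continuous_intros has_vector_derivative_of_real DERIV_power_Suc_divide
         simp flip: has_real_derivative_iff_has_vector_derivative of_real_power simp del: power_Suc of_nat_Suc of_real_divide)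
  finally show ?thesis by (simp add: diff_divide_distrib algebra_simps)
qed

lemma annulus_square_inverse_power_integral:
  assumes "0 < a" "a < b"
  shows "(LINT t:annulus a b|lborel. (1 / t) ^ (n + 2) * cnj ((1 / t) ^ (n + 2)))
     = of_real (pi * ((1 / a\<^sup>2) ^ (n + 1) - (1 / b\<^sup>2) ^ (n + 1)) / (n + 1))"
proof -
  have "(LINT t:annulus a b|lborel. (1 / t) ^ (n + 2) * cnj ((1 / t) ^ (n + 2)))
      = (LINT t:annulus a b|lborel. of_real ((1 / (norm t)\<^sup>2) ^ (n + 2)))"
  proof (intro set_lebesgue_integral_cong allI impI)
    show "(1 / t) ^ (n + 2) * cnj ((1 / t) ^ (n + 2)) = of_real ((1 / (norm t)\<^sup>2) ^ (n + 2))" for t :: complex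
    proof -
      have "(1 / t) ^ (n + 2) * cnj ((1 / t) ^ (n + 2)) = of_real (((norm (1 / t))\<^sup>2) ^ (n + 2))"
        by (simp only: complex_cnj_power power_mult_distrib[symmetric] complex_norm_square[symmetric] of_real_power)
      then show ?thesis by (simp add: norm_divide power_divide)
    qed
  qed (simp add: borel_open[OF open_annulus])
  also have "\<dots> = of_real pi * (of_real (- ((1 / b\<^sup>2) ^ (n + 1)) / (n + 1)) - of_real (- ((1 / a\<^sup>2) ^ (n + 1)) / (n + 1)))"
  proof (rule radial_integral_annulus[where \<phi> = "\<lambda>s. of_real ((1 / s) ^ (n + 2))" and \<Phi> = "\<lambda>s. of_real (- ((1 / s) ^ (n + 1)) / (n + 1))"])
    fix s assume s: "s \<in> {a\<^sup>2..b\<^sup>2}"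
    have "0 < a\<^sup>2" using assms by simp
    then have "s \<noteq> 0" using s by auto
    have d: "((\<lambda>s. 1 / s) has_real_derivative - ((1 / s)\<^sup>2)) (at s within {a\<^sup>2..b\<^sup>2})"
      using \<open>s \<noteq> 0\<close> by (auto intro!: derivative_eq_intros simp: power2_eq_square)
    have e: "- (real (n + 1) * (- (y\<^sup>2) * y ^ n)) / real (n + 1) = y ^ (n + 2)" for y :: real
      by (simp add: power_add mult.commute power2_eq_square)
    have "((\<lambda>s. - ((1 / s) ^ (n + 1)) / real (n + 1)) has_real_derivative
        - (real (n + 1) * (- ((1 / s)\<^sup>2) * (1 / s) ^ n)) / real (n + 1)) (at s within {a\<^sup>2..b\<^sup>2})"
      using DERIV_cdivide[OF DERIV_minus[OF DERIV_power[OF d, of "n + 1"]], of "real (n + 1)"] by simp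
    then have "((\<lambda>s. - ((1 / s) ^ (n + 1)) / (n + 1)) has_real_derivative (1 / s) ^ (n + 2)) (at s within {a\<^sup>2..b\<^sup>2})"
      unfolding e by simp
    then show "((\<lambda>s. complex_of_real (- ((1 / s) ^ (n + 1)) / (n + 1))) has_vector_derivative of_real ((1 / s) ^ (n + 2))) (at s within {a\<^sup>2..b\<^sup>2})"
      by (rule has_vector_derivative_of_real)
  qed (use assms in \<open>auto intro!: continuous_intros\<close>)
  finally show ?thesis by (simp add: diff_divide_distrib algebra_simps)
qed

text \<open>Parseval's identity for uniformly convergent expansions: the partial sums converge uniformly on a set of finite
  area, so their inner products converge. It is applied to monomials on the disc and to their symmetrized versions
  on the annulus.\<close>
lemma expansion_inner_product_sums:
  fixes \<phi> :: "nat \<Rightarrow> complex \<Rightarrow> complex"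
  assumes S: "S \<in> sets borel" "bounded S"
    and \<phi>: "\<And>j. continuous_on S (\<phi> j)" "\<And>j. bounded (\<phi> j ` S)"
    and orth: "\<And>j k. (LINT t:S|lborel. \<phi> j t * cnj (\<phi> k t)) = (if j = k then c j else 0)"
    and f: "uniform_limit S (\<lambda>N t. \<Sum>j<N. a j * \<phi> j t) f sequentially"
    and h: "uniform_limit S (\<lambda>N t. \<Sum>j<N. b j * \<phi> j t) h sequentially"
  shows "(\<lambda>j. a j * cnj (b j) * c j) sums (LINT t:S|lborel. f t * cnj (h t))"
proof -
  define F where "F N t = (\<Sum>j<N. a j * \<phi> j t)" for N t
  define H where "H N t = (\<Sum>j<N. b j * \<phi> j t)" for N t
  have cont: "continuous_on S (F N)" "continuous_on S (H N)" for N
    unfolding F_def H_def by (intro continuous_intros \<phi>)+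
  have bm: "bounded ((\<lambda>t. x * \<phi> j t) ` S)" for x j
    using bounded_linear_image[OF \<phi>(2) bounded_linear_mult_right[of x]] by (simp add: image_image)
  have bF: "bounded (F N ` S)" for N
    unfolding F_def by (induction N) (auto intro!: bounded_plus_comp bm simp: image_constant_conv)
  have bH: "bounded (H N ` S)" for N
    unfolding H_def by (induction N) (auto intro!: bounded_plus_comp bm simp: image_constant_conv)
  have bprod: "\<exists>B. \<forall>t\<in>S. norm (F t * cnj (H t)) \<le> B" if "bounded (F ` S)" "bounded (H ` S)"
    for F H :: "complex \<Rightarrow> complex"
  proof -
    obtain B1 B2 where "\<forall>t\<in>S. norm (F t) \<le> B1" "\<forall>t\<in>S. norm (H t) \<le> B2"
      using \<open>bounded (F ` S)\<close> \<open>bounded (H ` S)\<close> unfolding bounded_iff by auto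
    then show ?thesis
      by (intro exI[of _ "B1 * B2"]) (auto simp: norm_mult intro!: mult_mono order_trans[OF norm_ge_zero])
  qed
  have int: "set_integrable lborel S (\<lambda>t. F t * cnj (H t))"
    if "bounded (F ` S)" "bounded (H ` S)" "continuous_on S F" "continuous_on S H" for F H :: "complex \<Rightarrow> complex"
    using bprod[OF that(1,2)] that(3,4)
    by (auto intro!: set_integrable_bounded_continuous[OF S] continuous_intros)
  have fin: "(LINT t:S|lborel. F N t * cnj (H N t)) = (\<Sum>j<N. a j * cnj (b j) * c j)" for N
  proof -
    have "(LINT t:S|lborel. F N t * cnj (H N t)) =
       (LINT t:S|lborel. \<Sum>j<N. \<Sum>k<N. a j * cnj (b k) * (\<phi> j t * cnj (\<phi> k t)))"
      by (simp add: F_def H_def sum_product cnj_sum algebra_simps)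
    also have "\<dots> = (\<Sum>j<N. \<Sum>k<N. LINT t:S|lborel. a j * cnj (b k) * (\<phi> j t * cnj (\<phi> k t)))"
    proof -
      have i: "integrable lborel (\<lambda>t. indicator S t *\<^sub>R (a j * cnj (b k) * (\<phi> j t * cnj (\<phi> k t))))" for j k
        using set_integrable_mult_right[OF int[OF \<phi>(2) \<phi>(2) \<phi>(1) \<phi>(1)]] unfolding set_integrable_def by blast
      show ?thesis
        unfolding set_lebesgue_integral_def scaleR_sum_right
        by (simp only: Bochner_Integration.integral_sum Bochner_Integration.integrable_sum i)
    qed
    also have "\<dots> = (\<Sum>j<N. \<Sum>k<N. a j * cnj (b k) * (LINT t:S|lborel. (\<phi> j t * cnj (\<phi> k t))))"
      by (intro sum.cong refl set_integral_mult_right)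
    also have "\<dots> = (\<Sum>j<N. a j * cnj (b j) * c j)"
      unfolding orth by (intro sum.cong refl) (simp add: sum.delta if_distrib cong: if_cong)
    finally show ?thesis .
  qed
  have ulF: "uniform_limit S F f sequentially" and ulH: "uniform_limit S H h sequentially"
    using f h unfolding F_def H_def by simp_all
  have bf: "bounded (f ` S)" and bh: "bounded (h ` S)"
    using uniform_limit_bounded[OF ulF] uniform_limit_bounded[OF ulH] bF bH by (auto intro: always_eventually)
  have cf: "continuous_on S f" and chi_quot: "continuous_on S h"
    using uniform_limit_theorem[OF _ ulF] uniform_limit_theorem[OF _ ulH] cont by auto
  have lim: "uniform_limit S (\<lambda>N t. F N t * cnj (H N t)) (\<lambda>t. f t * cnj (h t)) sequentially"
  proof (intro uniform_lim_mult ulF)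
    show "uniform_limit S (\<lambda>N t. cnj (H N t)) (\<lambda>t. cnj (h t)) sequentially"
      using ulH unfolding uniform_limit_iff dist_norm by (simp flip: complex_cnj_diff)
    show "bounded ((\<lambda>t. cnj (h t)) ` S)" using bh unfolding bounded_iff by auto
  qed (use bf in auto)
  have "(\<lambda>N. LINT t:S|lborel. F N t * cnj (H N t)) \<longlonglongrightarrow> (LINT t:S|lborel. f t * cnj (h t))"
  proof (rule LIMSEQ_I)
    fix e :: real assume "e > 0"
    define m where "m = measure lborel S"
    have finm: "emeasure lborel S < \<infinity>" using emeasure_bounded_finite[OF S(2)] S(1) by simp
    have "m \<ge> 0" by (simp add: m_def)
    define d where "d = e / (m + 1)"
    have "d > 0" using \<open>e > 0\<close> \<open>m \<ge> 0\<close> by (simp add: d_def)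
    then obtain N0 where N0: "\<And>N t. N \<ge> N0 \<Longrightarrow> t \<in> S \<Longrightarrow> dist (F N t * cnj (H N t)) (f t * cnj (h t)) < d"
      using lim unfolding uniform_limit_iff eventually_sequentially by metis
    show "\<exists>N0. \<forall>N\<ge>N0. norm ((LINT t:S|lborel. F N t * cnj (H N t)) - (LINT t:S|lborel. f t * cnj (h t))) < e"
    proof (intro exI allI impI)
      fix N assume "N \<ge> N0"
      have i1: "set_integrable lborel S (\<lambda>t. F N t * cnj (H N t))" and i2: "set_integrable lborel S (\<lambda>t. f t * cnj (h t))"
        by (intro int bF bH cont bf bh cf chi_quot)+
      have "norm ((LINT t:S|lborel. F N t * cnj (H N t)) - (LINT t:S|lborel. f t * cnj (h t)))
          = norm (LINT t:S|lborel. F N t * cnj (H N t) - f t * cnj (h t))"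
        by (simp add: set_integral_diff(2)[OF i1 i2])
      also have "\<dots> \<le> (LINT t:S|lborel. norm (F N t * cnj (H N t) - f t * cnj (h t)))"
        by (rule set_integral_norm_bound) (intro set_integral_diff i1 i2)
      also have "\<dots> \<le> (LINT t:S|lborel. d)"
      proof (rule set_integral_mono)
        show "set_integrable lborel S (\<lambda>t. norm (F N t * cnj (H N t) - f t * cnj (h t)))"
          by (intro set_integrable_norm set_integral_diff i1 i2)
        show "set_integrable lborel S (\<lambda>t. d)"
          using finm S(1) by (simp add: set_integrable_def)
        show "norm (F N t * cnj (H N t) - f t * cnj (h t)) \<le> d" if "t \<in> S" for t
          using N0[OF \<open>N \<ge> N0\<close> that] by (simp add: dist_norm)
      qed
      also have "\<dots> = m * d"
        using S(1) finm by (simp add: set_lebesgue_integral_def m_def)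
      also have "\<dots> < e" using \<open>e > 0\<close> \<open>m \<ge> 0\<close> by (simp add: d_def field_simps)
      finally show "norm ((LINT t:S|lborel. F N t * cnj (H N t)) - (LINT t:S|lborel. f t * cnj (h t))) < e" .
    qed
  qed
  then show ?thesis
    unfolding sums_def fin .
qed

section \<open>The domain bounded by the curve\<close>

definition joukowski :: "complex \<Rightarrow> complex" where
  "joukowski u = u + 1 / u"

text \<open>The solutions \<open>u\<close> are the roots of \<open>u\<^sup>2 - z u + 1\<close>.\<close>
lemma joukowski_surj: "\<exists>u. u \<noteq> 0 \<and> joukowski u = z"
proof -
  define u where "u = (z + csqrt (z\<^sup>2 - 4)) / 2"
  have "2 * u - z = csqrt (z\<^sup>2 - 4)" by (simp add: u_def field_simps)
  then have "(2 * u - z)\<^sup>2 = z\<^sup>2 - 4" by simp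
  then have eq: "u * u + 1 = z * u" by algebra
  then have "u \<noteq> 0" by auto
  then show ?thesis using eq by (intro exI[of _ u]) (simp add: joukowski_def field_simps)
qed

lemma joukowski_eq_iff:
  assumes "u \<noteq> 0" "v \<noteq> 0"
  shows "joukowski u = joukowski v \<longleftrightarrow> u = v \<or> u * v = 1"
proof -
  have "joukowski u - joukowski v = (u - v) * (u * v - 1) / (u * v)"
    using assms by (simp add: joukowski_def field_simps)
  then show ?thesis using assms by (metis divide_eq_0_iff mult_eq_0_iff right_minus_eq)
qed

lemma joukowski_inverse: "joukowski (1 / u) = joukowski u"
  by (simp add: joukowski_def)

lemma joukowski_open_image:
  assumes "open U" "0 \<notin> U"
  shows "open (joukowski ` U)"
proof (rule open_mapping_thm[of _ "- {0}"])
  show "joukowski holomorphic_on - {0}"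
    unfolding joukowski_def by (intro holomorphic_intros) auto
  show "connected (- {0::complex})"
    by (rule connected_punctured_universe) simp
  show "\<not> joukowski constant_on - {0}"
  proof
    assume "joukowski constant_on - {0}"
    then have "joukowski 1 = joukowski (-1)" unfolding constant_on_def by auto
    then show False by (simp add: joukowski_def)
  qed
qed (use assms in auto)

locale joukowski_disc =
  fixes R :: real
  assumes R_gt_2: "R > 2"
begin

definition m :: real where "m = mu R"

lemma m_pos: "0 < m" and m_less_1: "m < 1" and R_eq: "R = m + 1 / m"
proof -
  have "sqrt (R\<^sup>2 - 4) < sqrt (R\<^sup>2)" by (subst real_sqrt_less_iff) simp
  then have "sqrt (R\<^sup>2 - 4) < R" using R_gt_2 by simp
  then show p: "0 < m" by (simp add: m_def mu_def)
  have sq: "(sqrt (R\<^sup>2 - 4))\<^sup>2 = R\<^sup>2 - 4" using R_gt_2 power_strict_mono[of 2 R 2] by simp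
  have "m * m + 1 = R * m"
  proof -
    have "2 * m = R - sqrt (R\<^sup>2 - 4)" by (simp add: m_def mu_def)
    moreover have "x * x + 1 = R * x" if "2 * x = R - s" "s\<^sup>2 = R\<^sup>2 - 4" for x s
    proof -
      have s: "s = R - 2 * x" using that(1) by simp
      show ?thesis using that(2) unfolding s by (simp add: power2_eq_square algebra_simps)
    qed
    ultimately show ?thesis using sq by blast
  qed
  then show e: "R = m + 1 / m" using p by (simp add: field_simps)
  have "(R - 2)\<^sup>2 < R\<^sup>2 - 4" using R_gt_2 by (simp add: power2_eq_square algebra_simps)
  then have "R - 2 < sqrt (R\<^sup>2 - 4)" by (rule real_less_rsqrt)
  then show "m < 1" by (simp add: m_def mu_def)
qed

lemma m2_less_1: "m\<^sup>2 < 1" and m2_less_m: "m\<^sup>2 < m" and m3_less_m2: "m ^ 3 < m\<^sup>2" and m4_less_1: "m ^ 4 < 1"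
proof -
  show "m\<^sup>2 < 1" using m_pos m_less_1 by (simp add: abs_square_less_1)
  show "m\<^sup>2 < m" "m ^ 3 < m\<^sup>2" using m_pos m_less_1 by (simp_all add: power2_eq_square power3_eq_cube)
  show "m ^ 4 < 1" using m_pos m_less_1 by (simp add: power_less_one_iff)
qed

abbreviation W :: "complex \<Rightarrow> complex" where "W \<equiv> lam R"

text \<open>The involution that exchanges the two preimages of a point under \<open>\<Psi>\<close>.\<close>
abbreviation flip :: "complex \<Rightarrow> complex" where "flip t \<equiv> (of_real m)\<^sup>2 / t"

lemma W_eq: "W t = (t - of_real m) / (of_real m * t - 1)"
  by (simp add: lam_def m_def)

definition Psi :: "complex \<Rightarrow> complex" where "Psi t = psi R (W t)"

text \<open>In terms of \<open>U\<close> the map \<open>\<Psi>\<close> is the Joukowski map \<open>u + 1 / u\<close>. The disc \<open>\<bar>t\<bar> < 1\<close> corresponds to \<open>\<bar>U + 1\<bar> < R\<close>,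
  and \<open>t \<mapsto> m\<^sup>2 / t\<close> to \<open>U \<mapsto> 1 / U\<close>.\<close>
definition U :: "complex \<Rightarrow> complex" where "U t = of_real R * W t - 1"

lemma Psi_eq_joukowski: "Psi t = joukowski (U t)"
  by (simp add: Psi_def psi_def U_def joukowski_def)

lemma mt_ne_1: "norm (t::complex) < 1 / m \<Longrightarrow> of_real m * t \<noteq> 1"
proof
  assume "norm t < 1 / m" "of_real m * t = 1"
  then have "norm (of_real m * t) = 1" by simp
  then have "m * norm t = 1" using m_pos by (simp add: norm_mult)
  then show False using \<open>norm t < 1 / m\<close> m_pos by (simp add: field_simps)
qed

lemma mt_ne_1': "norm (t::complex) \<le> 1 \<Longrightarrow> of_real m * t \<noteq> 1"
proof (intro mt_ne_1)
  assume "norm t \<le> 1"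
  also have "1 < 1 / m" using m_pos m_less_1 by simp
  finally show "norm t < 1 / m" .
qed

lemma U_eq:
  assumes "of_real m * t \<noteq> 1"
  shows "U t = (t - of_real m ^ 3) / (of_real m * (of_real m * t - 1))"
proof -
  have "complex_of_real m \<noteq> 0" "of_real m * t - 1 \<noteq> 0" using m_pos assms by auto
  moreover have "complex_of_real R = of_real m + 1 / of_real m" by (subst R_eq) simp
  ultimately show ?thesis
    unfolding U_def W_eq by (simp add: divide_simps) (simp add: algebra_simps power3_eq_cube)
qed

lemma W_involution: "of_real m * t \<noteq> 1 \<Longrightarrow> W (W t) = t"
proof -
  assume "of_real m * t \<noteq> 1"
  then have d: "of_real m * t - 1 \<noteq> 0" by auto
  have m2: "1 - (of_real m :: complex)\<^sup>2 \<noteq> 0"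
    using m_pos m_less_1 by (metis of_real_1 of_real_diff of_real_eq_0_iff of_real_power power_one right_minus_eq
        less_irrefl power2_eq_imp_eq less_eq_real_def zero_le_one)
  have n: "W t - of_real m = t * (1 - (of_real m)\<^sup>2) / (of_real m * t - 1)"
    using d by (simp add: W_eq field_simps power2_eq_square)
  have e: "of_real m * W t - 1 = (1 - (of_real m)\<^sup>2) / (of_real m * t - 1)"
    using d by (simp add: W_eq field_simps power2_eq_square)
  show ?thesis
    unfolding W_eq[of "W t"] n e using d m2 by simp
qed

lemma norm_diff_square: "(norm (x - y))\<^sup>2 = (norm x)\<^sup>2 - 2 * Re (x * cnj y) + (norm y)\<^sup>2" for x y :: complex
  by (simp only: cmod_power2) (simp add: power2_eq_square algebra_simps)

lemma norm_W_less_1_iff: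
  assumes "of_real m * t \<noteq> 1"
  shows "norm (W t) < 1 \<longleftrightarrow> norm t < 1"
proof -
  have "0 < norm (of_real m * t - 1)" using assms by simp
  then have "norm (W t) < 1 \<longleftrightarrow> norm (t - of_real m) < norm (of_real m * t - 1)"
    by (simp add: W_eq norm_divide field_simps)
  also have "\<dots> \<longleftrightarrow> (norm (t - of_real m))\<^sup>2 < (norm (of_real m * t - 1))\<^sup>2"
    by (meson norm_ge_zero power2_less_imp_less power_strict_mono zero_less_numeral)
  also have "\<dots> \<longleftrightarrow> 0 < (1 - m\<^sup>2) * (1 - (norm t)\<^sup>2)"
    unfolding norm_diff_square by (simp add: norm_mult power_mult_distrib algebra_simps)
  also have "\<dots> \<longleftrightarrow> norm t < 1"
  proof -
    have "0 < (1 - m\<^sup>2) * b \<longleftrightarrow> 0 < b" for b using m2_less_1 by (simp only: zero_less_mult_iff) linarith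
    then show ?thesis by (simp add: abs_square_less_1)
  qed
  finally show ?thesis .
qed

text \<open>The circle \<open>\<bar>t\<bar> = m\<close> is the fixed circle of the involution; it corresponds to \<open>\<bar>u\<bar> = 1\<close>, which the Joukowski map folds
  onto the segment from \<open>-2\<close> to \<open>2\<close>.\<close>
lemma norm_U_gt_1_iff:
  assumes "of_real m * t \<noteq> 1"
  shows "norm (U t) > 1 \<longleftrightarrow> norm t > m"
proof -
  have "0 < norm (of_real m * t - 1)" using assms by simp
  then have "norm (U t) > 1 \<longleftrightarrow> norm (t - of_real (m ^ 3)) > norm (of_real (m\<^sup>2) * t - of_real m)"
    using m_pos by (simp add: U_eq[OF assms] norm_divide norm_mult field_simps)
      (simp add: power2_eq_square flip: norm_mult)
  also have "\<dots> \<longleftrightarrow> (norm (t - of_real (m ^ 3)))\<^sup>2 > (norm (of_real (m\<^sup>2) * t - of_real m))\<^sup>2"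
    by (meson norm_ge_zero power2_less_imp_less power_strict_mono zero_less_numeral)
  also have "\<dots> \<longleftrightarrow> 0 < (1 - m ^ 4) * ((norm t)\<^sup>2 - m\<^sup>2)"
    unfolding norm_diff_square norm_mult norm_of_real power_mult_distrib
    by (simp add: algebra_simps power2_eq_square power3_eq_cube power4_eq_xxxx)
  also have "\<dots> \<longleftrightarrow> m\<^sup>2 < (norm t)\<^sup>2"
    using m4_less_1 by (simp add: zero_less_mult_iff)
  also have "\<dots> \<longleftrightarrow> norm t > m"
    using m_pos by (meson norm_ge_zero power2_less_imp_less power_strict_mono zero_less_numeral less_imp_le)
  finally show ?thesis .
qed

definition Omega_cover :: "complex set" where
  "Omega_cover = {u. u \<noteq> 0 \<and> norm (u + 1) < R \<and> norm (1 / u + 1) < R}"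

lemma L1_eq: "L1 R = joukowski ` {u. norm (u + 1) = R}"
proof -
  have "L1 R = joukowski ` ((\<lambda>w. w - 1) ` {w. norm w = R})"
    unfolding L1_def joukowski_def by auto
  also have "(\<lambda>w. w - 1) ` {w. norm w = R} = {u::complex. norm (u + 1) = R}"
    by (auto intro!: image_eqI[where x = "x + 1" for x])
  finally show ?thesis .
qed

text \<open>As \<open>R > 2\<close>, at most one of the two preimages \<open>u\<close>, \<open>1 / u\<close> of a point lies on or outside the circle \<open>\<bar>u + 1\<bar> = R\<close>.\<close>
lemma joukowski_partner_small:
  fixes u :: complex
  assumes "norm (u + 1) \<ge> R" shows "norm u > 1" "norm (1 / u + 1) < R"
proof -
  have "norm (u + 1) \<le> norm u + 1" using norm_triangle_ineq[of u 1] by simp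
  then show *: "norm u > 1" using assms R_gt_2 by simp
  have "norm (1 / u + 1) \<le> norm (1 / u) + 1" using norm_triangle_ineq[of "1/u" 1] by simp
  also have "norm (1 / u) < 1" using * by (simp add: norm_divide divide_less_eq)
  finally show "norm (1 / u + 1) < R" using R_gt_2 by simp
qed

lemma bounded_joukowski_cover: "bounded (joukowski ` Omega_cover)"
proof -
  have "norm (joukowski u) \<le> 2 * (R + 1)" if "u \<in> Omega_cover" for u
  proof -
    have "norm u \<le> norm (u + 1) + 1" "norm (1 / u) \<le> norm (1 / u + 1) + 1"
      using norm_triangle_ineq4[of "u + 1" 1] norm_triangle_ineq4[of "1 / u + 1" 1] by simp_all
    moreover have "norm (joukowski u) \<le> norm u + norm (1 / u)"
      unfolding joukowski_def by (rule norm_triangle_ineq)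
    ultimately show ?thesis using that by (simp add: Omega_cover_def)
  qed
  then show ?thesis unfolding bounded_iff by blast
qed

text \<open>A point \<open>u + 1 / u\<close> is classified by the larger of \<open>\<bar>u + 1\<bar>\<close> and \<open>\<bar>1 / u + 1\<bar>\<close>: it lies on the curve if this is \<open>R\<close>.
  The points with a smaller value form a bounded open set. Those with a larger value form an unbounded connected
  open set. As these two open sets cover the complement of the curve, no component meets both.\<close>
lemma G1_eq: "G1 R = joukowski ` Omega_cover"
proof -
  define Om where "Om = joukowski ` Omega_cover"
  define Ex where "Ex = joukowski ` {u. R < norm (u + 1)}"
  have ext_conn: "connected {u::complex. R < norm (u + 1)}"
  proof -
    have "{u::complex. R < norm (u + 1)} = - cball (-1) R"
      by (auto simp: dist_norm norm_minus_commute[of "-1"] add.commute)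
    then show ?thesis by (simp add: connected_complement_bounded_convex)
  qed
  have nz: "u \<noteq> 0" if "R \<le> norm (u + 1)" for u :: complex
    using that R_gt_2 by auto
  have op: "open Omega_cover"
  proof -
    have "Omega_cover = {u. u \<noteq> 0} \<inter> {u \<in> - {0}. norm (1 / u + 1) < R} \<inter> {u. norm (u + 1) < R}"
      by (auto simp: Omega_cover_def)
    moreover have "open {u \<in> - {0::complex}. norm (1 / u + 1) < R}"
      by (rule continuous_open_preimage[of _ "\<lambda>u. norm (1 / u + 1)" "{..<R}", simplified vimage_def Int_def, simplified])
         (auto intro!: continuous_intros)
    ultimately show ?thesis
      by (auto intro!: open_Int open_Collect_less open_Collect_neq continuous_intros)
  qed
  have opOm: "open Om" unfolding Om_def
    by (rule joukowski_open_image[OF op]) (simp add: Omega_cover_def)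
  have opEx: "open Ex" unfolding Ex_def
    by (rule joukowski_open_image) (use R_gt_2 in \<open>auto intro!: open_Collect_less continuous_intros\<close>)
  have cover: "z \<in> Om \<or> z \<in> L1 R \<or> z \<in> Ex" for z
  proof -
    obtain u where u: "u \<noteq> 0" "joukowski u = z" using joukowski_surj by blast
    show ?thesis
    proof (cases "norm (u + 1) < R \<and> norm (1 / u + 1) < R")
      case True
      then show ?thesis using u unfolding Om_def Omega_cover_def by auto
    next
      case False
      then obtain v where "R \<le> norm (v + 1)" "joukowski v = z"
        using u joukowski_inverse[of u] by (metis not_less)
      then show ?thesis unfolding L1_eq Ex_def by (auto simp: le_less)
    qed
  qed
  have disj1: "joukowski u \<notin> Om" if "R \<le> norm (u + 1)" for u
  proof
    assume "joukowski u \<in> Om"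
    then obtain v where "v \<in> Omega_cover" "joukowski u = joukowski v" unfolding Om_def by auto
    then have "u = v \<or> u = 1 / v" using joukowski_eq_iff[of u v] nz[OF that]
      by (auto simp: Omega_cover_def field_simps)
    then show False using that \<open>v \<in> Omega_cover\<close> by (auto simp: Omega_cover_def)
  qed
  have disj2: "Ex \<inter> L1 R = {}"
  proof -
    have False if "R < norm (u + 1)" "norm (v + 1) = R" "joukowski u = joukowski v" for u v
    proof -
      have "u = v \<or> u = 1 / v" using that joukowski_eq_iff[of u v] nz[of u] nz[of v]
        by (auto simp: field_simps)
      then show False using that joukowski_partner_small(2)[of v] by auto
    qed
    then show ?thesis unfolding Ex_def L1_eq by blast
  qed
  have OmL: "Om \<inter> L1 R = {}" "Om \<inter> Ex = {}"
    using disj1 unfolding L1_eq Ex_def by (fastforce simp: less_imp_le)+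
  have bdOm: "bounded Om" unfolding Om_def by (rule bounded_joukowski_cover)
  have connEx: "connected Ex"
    unfolding Ex_def joukowski_def
    by (intro connected_continuous_image ext_conn continuous_intros) (use nz in \<open>auto dest: less_imp_le\<close>)
  have unbEx: "\<not> bounded Ex"
  proof
    assume "bounded Ex"
    then obtain B where B: "\<And>z. z \<in> Ex \<Longrightarrow> norm z \<le> B" unfolding bounded_iff by auto
    define x where "x = max B R + 1"
    have x: "x > B" "x > R" by (auto simp: x_def)
    have "joukowski (of_real x) \<in> Ex" unfolding Ex_def
    proof (intro image_eqI[OF refl] CollectI)
      have "norm (of_real x + 1 :: complex) = \<bar>x + 1\<bar>" by (metis norm_of_real of_real_1 of_real_add)
      then show "R < norm (of_real x + 1 :: complex)" using x R_gt_2 by simp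
    qed
    then have "norm (joukowski (of_real x)) \<le> B" by (rule B)
    moreover have "joukowski (of_real x) = of_real (x + 1 / x)" by (simp add: joukowski_def)
    ultimately have "\<bar>x + 1 / x\<bar> \<le> B" by (simp only: norm_of_real)
    moreover have "1 / x > 0" using x R_gt_2 by simp
    ultimately show False using x by linarith
  qed
  have "inside (L1 R) = Om"
  proof (intro equalityI subsetI)
    fix z assume z: "z \<in> inside (L1 R)"
    then have zL: "z \<notin> L1 R" and b: "bounded (connected_component_set (- L1 R) z)"
      by (auto simp: inside_def)
    show "z \<in> Om"
    proof (rule ccontr)
      assume "z \<notin> Om"
      then have "z \<in> Ex" using cover zL by blast
      then have "Ex \<subseteq> connected_component_set (- L1 R) z"
        using disj2 by (intro connected_component_maximal connEx) auto
      then show False using b unbEx bounded_subset by blast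
    qed
  next
    fix z assume z: "z \<in> Om"
    let ?C = "connected_component_set (- L1 R) z"
    have "z \<in> ?C" using z OmL by (simp add: connected_component_refl_eq) auto
    moreover have "?C \<subseteq> Om \<union> Ex" using cover connected_component_subset by fastforce
    moreover have "connected ?C" by simp
    ultimately have "Ex \<inter> ?C = {}" using opOm opEx OmL(2) z connectedD[of ?C Om Ex]
      by blast
    then have "?C \<subseteq> Om" using \<open>?C \<subseteq> Om \<union> Ex\<close> by blast
    then show "z \<in> inside (L1 R)" using z OmL bdOm bounded_subset by (auto simp: inside_def)
  qed
  then show ?thesis by (simp add: G1_def Om_def)
qed

end

section \<open>The Bergman inner product in the uniformizing coordinate\<close>

lemma bounded_continuous_on_bounded:
  fixes F :: "complex \<Rightarrow> complex"
  assumes "bounded S" "continuous_on UNIV F"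
  obtains B where "\<And>z. z \<in> S \<Longrightarrow> norm (F z) \<le> B"
proof -
  have "compact (F ` closure S)"
    using assms by (intro compact_continuous_image) (auto intro: continuous_on_subset simp: compact_closure)
  then obtain B where "\<And>z. z \<in> F ` closure S \<Longrightarrow> norm z \<le> B"
    using compact_imp_bounded bounded_iff by metis
  then show ?thesis using that closure_subset by blast
qed

lemma power_series_uniform_limit_cball:
  fixes a :: "nat \<Rightarrow> complex"
  assumes "r > 1" and sums: "\<And>t. norm t < r \<Longrightarrow> (\<lambda>j. a j * t ^ j) sums f t"
  shows "uniform_limit (cball 0 1) (\<lambda>N t. \<Sum>j<N. a j * t ^ j) f sequentially"
proof -
  define q where "q = (1 + r) / 2"
  have q: "1 < q" "q < r" using assms by (auto simp: q_def)
  have "summable (\<lambda>j. a j * of_real q ^ j)"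
    using sums[of "of_real q"] q sums_summable by (simp add: norm_of_real)
  then have "conv_radius a \<ge> norm (of_real q :: complex)"
    by (rule conv_radius_geI)
  then have "conv_radius a > ereal 1" using q by (simp add: less_le_trans[of _ "ereal q"])
  from powser_uniform_limit[OF this, of 0]
  have "uniform_limit (cball 0 1) (\<lambda>N t. \<Sum>j<N. a j * t ^ j) (\<lambda>t. \<Sum>j. a j * t ^ j) sequentially"
    by simp
  moreover have "(\<Sum>j. a j * t ^ j) = f t" if "t \<in> cball 0 1" for t
    using sums[of t] that \<open>r > 1\<close> by (intro sums_unique[symmetric]) auto
  ultimately show ?thesis
    by (subst uniform_limit_cong'[where g="\<lambda>N t. \<Sum>j<N. a j * t ^ j" and i="\<lambda>t. \<Sum>j. a j * t ^ j"]) auto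
qed

context joukowski_disc
begin

definition Psi' :: "complex \<Rightarrow> complex" where
  "Psi' t = - ((1 - of_real m ^ 4)\<^sup>2 * (t\<^sup>2 - (of_real m)\<^sup>2)) /
     (of_real m * (of_real m * t - 1)\<^sup>2 * (t - of_real m ^ 3)\<^sup>2)"

lemma has_field_derivative_Psi:
  assumes t: "of_real m * t \<noteq> 1" "t \<noteq> of_real m ^ 3"
  shows "(Psi has_field_derivative Psi' t) (at t)"
proof -
  have nz: "complex_of_real m \<noteq> 0" "of_real m * t - 1 \<noteq> 0" "t - of_real m ^ 3 \<noteq> 0" using m_pos t by auto
  have op: "open {t. of_real m * t \<noteq> 1 \<and> t \<noteq> complex_of_real m ^ 3}"
    by (intro open_Collect_conj open_Collect_neq continuous_intros)
  define A where "A = t - complex_of_real m ^ 3"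
  define B where "B = complex_of_real m * t - 1"
  have AB: "A \<noteq> 0" "B \<noteq> 0" using nz by (auto simp: A_def B_def)
  have dA: "((\<lambda>t. t - of_real m ^ 3) has_field_derivative 1) (at t)"
    and dB: "((\<lambda>t. of_real m * (of_real m * t - 1)) has_field_derivative of_real m * of_real m) (at t)"
    by (auto intro!: derivative_eq_intros)
  have "((\<lambda>t. (t - of_real m ^ 3) / (of_real m * (of_real m * t - 1)) + (of_real m * (of_real m * t - 1)) / (t - of_real m ^ 3))
      has_field_derivative
      (1 * (of_real m * B) - A * (of_real m * of_real m)) / ((of_real m * B) * (of_real m * B))
        + (of_real m * of_real m * A - (of_real m * B) * 1) / (A * A)) (at t)"
    using nz unfolding A_def B_def by (intro DERIV_add DERIV_divide dA dB) auto
  also have "(1 * (of_real m * B) - A * (of_real m * of_real m)) / ((of_real m * B) * (of_real m * B))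
        + (of_real m * of_real m * A - (of_real m * B) * 1) / (A * A)
       = (of_real m * A - B) * ((of_real m * B)\<^sup>2 - A\<^sup>2) / (of_real m * B\<^sup>2 * A\<^sup>2)"
    using AB nz by (simp add: divide_simps) (simp add: algebra_simps power2_eq_square)
  also have "\<dots> = Psi' t"
  proof -
    have "of_real m * A - B = 1 - of_real m ^ 4"
      by (simp add: A_def B_def algebra_simps power4_eq_xxxx power3_eq_cube)
    moreover have "(of_real m * B)\<^sup>2 - A\<^sup>2 = - ((1 - of_real m ^ 4) * (t\<^sup>2 - (of_real m)\<^sup>2))"
      by (simp add: A_def B_def algebra_simps power4_eq_xxxx power3_eq_cube power2_eq_square)
    ultimately show ?thesis
      unfolding Psi'_def A_def[symmetric] B_def[symmetric] by (simp add: power2_eq_square mult.assoc)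
  qed
  finally show ?thesis
  proof (rule has_field_derivative_transform_within_open[OF _ op])
    show "t \<in> {t. of_real m * t \<noteq> 1 \<and> t \<noteq> complex_of_real m ^ 3}" using t by simp
    fix s assume "s \<in> {t. of_real m * t \<noteq> 1 \<and> t \<noteq> complex_of_real m ^ 3}"
    then show "(s - of_real m ^ 3) / (of_real m * (of_real m * s - 1)) + (of_real m * (of_real m * s - 1)) / (s - of_real m ^ 3) = Psi s"
      by (simp add: Psi_eq_joukowski joukowski_def U_eq)
  qed
qed

lemma annulus_regular:
  fixes t :: complex
  assumes "m\<^sup>2 < norm t" "norm t < 1 / m"
  shows "of_real m * t \<noteq> 1" "t \<noteq> of_real m ^ 3" "t \<noteq> 0"
  using mt_ne_1[OF assms(2)] assms(1) m3_less_m2 m_pos by (auto simp: norm_power)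

lemma annulus_m_1:
  assumes "t \<in> annulus m 1"
  shows "m\<^sup>2 < norm t" "norm t < 1 / m" "m < norm t" "norm t < 1"
proof -
  have "1 < 1 / m" using m_pos m_less_1 by simp
  then show "m\<^sup>2 < norm t" "norm t < 1 / m" "m < norm t" "norm t < 1" 
    using assms m2_less_m by (auto simp: annulus_def)
qed

lemma W_inj:
  assumes "of_real m * t \<noteq> 1" "of_real m * s \<noteq> 1" "W t = W s"
  shows "t = s"
  using W_involution assms by metis

lemma Psi_inj_annulus: "inj_on Psi (annulus m 1)"
proof (rule inj_onI)
  fix t s assume ts: "t \<in> annulus m 1" "s \<in> annulus m 1" "Psi t = Psi s"
  note r = annulus_regular[OF annulus_m_1(1,2)[OF ts(1)]] annulus_regular[OF annulus_m_1(1,2)[OF ts(2)]]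
  have gt: "norm (U t) > 1" "norm (U s) > 1"
    using norm_U_gt_1_iff r annulus_m_1[OF ts(1)] annulus_m_1[OF ts(2)] by auto
  then have "U t \<noteq> 0" "U s \<noteq> 0" by auto
  then have "U t = U s \<or> U t * U s = 1"
    using ts(3) by (simp add: Psi_eq_joukowski joukowski_eq_iff)
  moreover have "U t * U s \<noteq> 1"
  proof
    assume "U t * U s = 1"
    then have "norm (U t) * norm (U s) = 1" by (metis norm_mult norm_one)
    moreover have "1 < norm (U t) * norm (U s)" using less_1_mult[OF gt] .
    ultimately show False by simp
  qed
  ultimately have "W t = W s" using R_gt_2 by (simp add: U_def)
  then show "t = s" using W_inj r by blast
qed

lemma Psi_annulus_subset: "Psi ` annulus m 1 \<subseteq> G1 R"
proof
  fix z assume "z \<in> Psi ` annulus m 1"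
  then obtain t where t: "t \<in> annulus m 1" "z = Psi t" by auto
  note r = annulus_regular[OF annulus_m_1(1,2)[OF t(1)]]
  have U1: "norm (U t) > 1" using norm_U_gt_1_iff r annulus_m_1[OF t(1)] by auto
  have "norm (W t) < 1" using norm_W_less_1_iff r annulus_m_1[OF t(1)] by auto
  then have "norm (of_real R * W t) < R" using R_gt_2 by (simp add: norm_mult)
  then have 2: "norm (U t + 1) < R" by (simp add: U_def)
  have "norm (1 / U t + 1) \<le> norm (1 / U t) + 1" using norm_triangle_ineq[of "1 / U t" 1] by simp
  also have "norm (1 / U t) < 1" using U1 by (simp add: norm_divide divide_less_eq)
  finally have "norm (1 / U t + 1) < R" using R_gt_2 by simp
  then have "U t \<in> Omega_cover" using 2 U1 by (auto simp: Omega_cover_def)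
  then show "z \<in> G1 R" using t by (auto simp: G1_eq Psi_eq_joukowski)
qed

text \<open>Only the image of \<open>\<bar>u\<bar> = 1\<close> is left out, and there \<open>u + 1 / u = 2 Re u\<close>.\<close>
lemma G1_diff_Psi_annulus: "G1 R - Psi ` annulus m 1 \<subseteq> {z. Im z = 0}"
proof
  fix z assume z: "z \<in> G1 R - Psi ` annulus m 1"
  then obtain u0 where u0: "u0 \<in> Omega_cover" "z = joukowski u0" by (auto simp: G1_eq)
  have "\<exists>u. u \<in> Omega_cover \<and> z = joukowski u \<and> norm u \<ge> 1"
  proof (cases "norm u0 \<ge> 1")
    case True
    then show ?thesis using u0 by blast
  next
    case False
    then have "norm (1 / u0) \<ge> 1" using u0 by (auto simp: norm_divide Omega_cover_def field_simps)
    moreover have "1 / u0 \<in> Omega_cover" using u0 by (auto simp: Omega_cover_def)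
    ultimately show ?thesis using u0 joukowski_inverse by metis
  qed
  then obtain u where u: "u \<in> Omega_cover" "z = joukowski u" "norm u \<ge> 1" by blast
  show "z \<in> {z. Im z = 0}"
  proof (cases "norm u = 1")
    case True
    then have "u * cnj u = 1" using complex_norm_square[of u] by simp
    then have "1 / u = cnj u" by (metis inverse_eq_divide inverse_unique)
    then show ?thesis using u by (simp add: joukowski_def)
  next
    case False
    define w where "w = (u + 1) / of_real R"
    have w1: "norm w < 1" using u R_gt_2 by (simp add: w_def norm_divide Omega_cover_def)
    then have mw: "of_real m * w \<noteq> 1" by (intro mt_ne_1') simp
    \<comment> \<open>The map \<open>W\<close> is an involution, so the preimage is found by applying it again.\<close>
    define t where "t = W w"
    have t1: "norm t < 1" using norm_W_less_1_iff[OF mw] w1 by (simp add: t_def)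
    then have mt: "of_real m * t \<noteq> 1" by (intro mt_ne_1') simp
    have "U t = u" using W_involution[OF mw] R_gt_2 by (simp add: U_def t_def) (simp add: w_def)
    then have "norm t > m" using norm_U_gt_1_iff[OF mt] False u(3) by simp
    then have "t \<in> annulus m 1" using t1 by (simp add: annulus_def)
    then have "z \<in> Psi ` annulus m 1" using u \<open>U t = u\<close> by (auto simp: Psi_eq_joukowski)
    then show ?thesis using z by simp
  qed
qed

lemma Psi_holomorphic_annulus: "Psi holomorphic_on annulus m 1"
proof (rule holomorphic_onI)
  fix t assume "t \<in> annulus m 1"
  then have "(Psi has_field_derivative Psi' t) (at t)"
    by (intro has_field_derivative_Psi annulus_regular annulus_m_1)
  then show "Psi field_differentiable at t within annulus m 1"
    by (meson field_differentiable_at_within field_differentiable_def)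
qed

lemma deriv_Psi_annulus: "t \<in> annulus m 1 \<Longrightarrow> deriv Psi t = Psi' t"
  by (intro DERIV_imp_deriv has_field_derivative_Psi annulus_regular annulus_m_1)

lemma open_Omega: "open (Psi ` annulus m 1)"
  by (rule open_mapping_thm3[OF Psi_holomorphic_annulus open_annulus Psi_inj_annulus])

lemma open_G1: "open (G1 R)"
proof -
  have "closed (L1 R)"
  proof -
    have "compact {u::complex. norm (u + 1) = R}"
    proof -
      have "{u::complex. norm (u + 1) = R} = sphere (-1) R"
        by (auto simp: dist_norm norm_minus_commute[of "-1"] add.commute)
      then show ?thesis by simp
    qed
    moreover have "continuous_on {u::complex. norm (u + 1) = R} joukowski"
      unfolding joukowski_def by (intro continuous_intros) (use R_gt_2 in auto)
    ultimately show ?thesis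
      unfolding L1_eq using compact_continuous_image compact_imp_closed by blast
  qed
  then show ?thesis unfolding G1_def by (rule open_inside)
qed

lemma bounded_G1: "bounded (G1 R)"
  unfolding G1_eq by (rule bounded_joukowski_cover)

lemma integral_G1_eq_annulus:
  fixes P Q :: "complex poly"
  shows "(LINT z:G1 R|lborel. poly P z * cnj (poly Q z)) =
    (LINT t:annulus m 1|lborel. (poly P (Psi t) * Psi' t) * cnj (poly Q (Psi t) * Psi' t))"
proof -
  let ?h = "\<lambda>z. poly P z * cnj (poly Q z)"
  let ?Om = "Psi ` annulus m 1"
  have cont: "continuous_on X ?h" for X by (intro continuous_intros)
  have m: "set_borel_measurable lborel X ?h" if "open X" for X
    unfolding set_borel_measurable_def using that
    by (auto intro!: borel_measurable_continuous_on_indicator cont)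
  have null: "{z::complex. Im z = 0} \<in> null_sets lborel"
  proof -
    have "negligible {z::complex. \<i> \<bullet> z = 0}" by (rule negligible_hyperplane) auto
    then have "{z::complex. Im z = 0} \<in> null_sets lebesgue" by (simp add: negligible_iff_null_sets)
    moreover have "closed {z::complex. Im z = 0}"
      by (intro closed_Collect_eq continuous_intros)
    ultimately show ?thesis by (simp add: null_sets_def emeasure_completion main_part_sets)
  qed
  have "(LINT z:G1 R|lborel. ?h z) = (LINT z:?Om|lborel. ?h z)"
  proof (rule set_integral_cong_set)
    have "AE z in lborel. z \<notin> {z::complex. Im z = 0}" using null by (rule AE_not_in)
    then show "AE z in lborel. z \<in> ?Om \<longleftrightarrow> z \<in> G1 R"
      by eventually_elim (use Psi_annulus_subset G1_diff_Psi_annulus in blast)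
  qed (intro m open_G1 open_Omega)+
  also have "\<dots> = (LINT t:annulus m 1|lborel. ?h (Psi t) * of_real ((norm (deriv Psi t))\<^sup>2))"
  proof (rule holomorphic_change_of_variables(2)[OF Psi_holomorphic_annulus open_annulus Psi_inj_annulus cont])
    have "bounded ?Om" using bounded_G1 Psi_annulus_subset bounded_subset by blast
    moreover obtain B where "\<And>z. z \<in> ?Om \<Longrightarrow> norm (?h z) \<le> B"
      using bounded_continuous_on_bounded[OF \<open>bounded ?Om\<close> cont[of UNIV]] by blast
    ultimately show "set_integrable lborel ?Om ?h"
      by (intro set_integrable_bounded_continuous cont) (auto simp: open_Omega)
  qed
  also have "\<dots> = (LINT t:annulus m 1|lborel. (poly P (Psi t) * Psi' t) * cnj (poly Q (Psi t) * Psi' t))"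
    by (intro set_lebesgue_integral_cong)
       (auto simp: open_annulus deriv_Psi_annulus complex_norm_square simp del: of_real_power)
  finally show ?thesis .
qed

text \<open>If \<open>\<alpha> = t ^ j\<close>, this is \<open>\<alpha>(t) - (m / t)\<^sup>2 \<alpha>(m\<^sup>2 / t)\<close>, the shape that invariance under the involution forces on the
  pull-back of a differential from \<open>G1\<close>.\<close>
definition symm_monomial :: "nat \<Rightarrow> complex \<Rightarrow> complex" where
  "symm_monomial j t = t ^ j - of_real (m ^ (2 * j + 2)) * (1 / t) ^ (j + 2)"

text \<open>Distinct powers of \<open>t\<close> are orthogonal on an annulus. The involution maps \<open>m < \<bar>t\<bar> < 1\<close> onto \<open>m\<^sup>2 < \<bar>t\<bar> < m\<close>, so the two
  terms together contribute the integral of \<open>\<bar>t\<bar>^(2j)\<close> over \<open>m\<^sup>2 < \<bar>t\<bar> < 1\<close>.\<close>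
lemma symm_monomial_orthogonal:
  "(LINT t:annulus m 1|lborel. symm_monomial j t * cnj (symm_monomial k t)) =
    (if j = k then of_real (pi * (1 - m ^ (4 * (j + 1))) / (j + 1)) else 0)"
proof -
  define M where "M j k = (LINT t:annulus m 1|lborel. t powi j * cnj (t powi k))" for j k
  have int: "set_integrable lborel (annulus m 1) (\<lambda>t. t powi j * cnj (t powi k))" for j k
  proof (rule set_integrable_bounded_continuous)
    have b: "norm (t powi n) \<le> 1 + m powi n" if "t \<in> annulus m 1" for t n
    proof (cases "n \<ge> 0")
      case True
      then have "norm (t powi n) \<le> 1 powi n" using that
        unfolding norm_power_int by (intro power_int_mono) (auto simp: annulus_def)
      then show ?thesis using m_pos by (simp add: add_increasing2)
    next
      case False
      then have "norm (t powi n) \<le> m powi n" using that m_pos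
        by (auto simp: norm_power_int annulus_def intro!: power_int_antimono)
      then show ?thesis by simp
    qed
    show "norm (t powi j * cnj (t powi k)) \<le> (1 + m powi j) * (1 + m powi k)" if "t \<in> annulus m 1" for t
      unfolding norm_mult complex_mod_cnj
      by (intro mult_mono b[OF that] order_trans[OF norm_ge_zero b[OF that]]) auto
    show "continuous_on (annulus m 1) (\<lambda>t. t powi j * cnj (t powi k))"
      using m_pos by (auto intro!: continuous_intros simp: annulus_def)
  qed (auto simp: open_annulus bounded_annulus)
  have powi_minus: "t powi (- int k) = (1 / t) ^ k" for t :: complex and k
    by (simp add: power_int_minus power_divide inverse_eq_divide)
  define c where "c j = complex_of_real (m ^ (2 * j + 2))" for j
  have split: "(LINT t:S|lborel. (A t - x * B t) - (y * C t - z * D t)) =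
      ((LINT t:S|lborel. A t) - x * (LINT t:S|lborel. B t)) - (y * (LINT t:S|lborel. C t) - z * (LINT t:S|lborel. D t))"
    if "set_integrable lborel S A" "set_integrable lborel S B" "set_integrable lborel S C" "set_integrable lborel S D"
    for S and A B C D :: "complex \<Rightarrow> complex" and x y z
  proof -
    have i: "set_integrable lborel S (\<lambda>t. x * B t)" "set_integrable lborel S (\<lambda>t. y * C t)" "set_integrable lborel S (\<lambda>t. z * D t)"
      using set_integrable_mult_right that by blast+
    show ?thesis
      by (simp only: set_integral_diff[OF set_integral_diff(1)[OF that(1) i(1)] set_integral_diff(1)[OF i(2,3)]]
          set_integral_diff[OF that(1) i(1)] set_integral_diff[OF i(2,3)] set_integral_mult_right)
  qed
  have sm: "symm_monomial j t = t powi int j - c j * (t powi (- int (j + 2)))" if "t \<in> annulus m 1" for t j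
    unfolding symm_monomial_def c_def powi_minus power_int_of_nat ..
  have "(LINT t:annulus m 1|lborel. symm_monomial j t * cnj (symm_monomial k t)) =
     (LINT t:annulus m 1|lborel. (t powi int j * cnj (t powi int k) - c k * (t powi int j * cnj (t powi - int (k + 2)))) -
        (c j * (t powi - int (j + 2) * cnj (t powi int k)) - c j * c k * (t powi - int (j + 2) * cnj (t powi - int (k + 2)))))"
    by (intro set_lebesgue_integral_cong allI impI)
       (simp_all add: open_annulus sm c_def algebra_simps del: of_nat_add of_real_power)
  also have "\<dots> = (M (int j) (int k) - c k * M (int j) (- int (k + 2))) -
     (c j * M (- int (j + 2)) (int k) - c j * c k * M (- int (j + 2)) (- int (k + 2)))"
    unfolding M_def by (intro split int)
  also have "\<dots> = M (int j) (int k) + c j * c k * M (- int (j + 2)) (- int (k + 2))"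
  proof -
    have "M (int j) (- int (k + 2)) = 0" "M (- int (j + 2)) (int k) = 0"
      unfolding M_def using m_pos by (intro annulus_monomials_orthogonal; simp)+
    then show ?thesis by simp
  qed
  also have "\<dots> = (if j = k then of_real (pi * (1 - m ^ (4 * (j + 1))) / (j + 1)) else 0)"
  proof (cases "j = k")
    case True
    have 1: "M (int j) (int j) = of_real (pi * (1 - (m\<^sup>2) ^ (j + 1)) / (j + 1))"
      using annulus_square_power_integral[of m 1 j] m_pos m_less_1 by (simp add: M_def)
    have "M (- int (j + 2)) (- int (j + 2)) = (LINT t:annulus m 1|lborel. (1 / t) ^ (j + 2) * cnj ((1 / t) ^ (j + 2)))"
      unfolding M_def powi_minus ..
    also have "\<dots> = of_real (pi * ((1 / m\<^sup>2) ^ (j + 1) - 1) / (j + 1))"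
      using annulus_square_inverse_power_integral[of m 1 j] m_pos m_less_1 by simp
    finally have 2: "M (- int (j + 2)) (- int (j + 2)) = of_real (pi * ((1 / m\<^sup>2) ^ (j + 1) - 1) / (j + 1))" .
    define y where "y = (m\<^sup>2) ^ (j + 1)"
    have y: "y \<noteq> 0" "m ^ (2 * j + 2) = y" "(1 / m\<^sup>2) ^ (j + 1) = 1 / y" "m ^ (4 * (j + 1)) = y * y"
    proof -
      show "y \<noteq> 0" using m_pos by (simp add: y_def)
      show "m ^ (2 * j + 2) = y" unfolding y_def power_mult[symmetric] by (simp add: algebra_simps)
      show "(1 / m\<^sup>2) ^ (j + 1) = 1 / y" unfolding y_def power_divide power_one ..
      show "m ^ (4 * (j + 1)) = y * y"
        unfolding y_def power_mult[symmetric] power_add[symmetric] by (rule arg_cong[of _ _ "\<lambda>k. m ^ k"]) simp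
    qed
    have r: "pi * (1 - y) / (j + 1) + y * y * (pi * (1 / y - 1) / (j + 1)) = pi * (1 - y * y) / (j + 1)"
    proof -
      have "pi * (1 - y) + y * y * (pi * (1 / y - 1)) = pi * (1 - y * y)" using y(1) by (simp add: algebra_simps)
      then show ?thesis by (simp add: add_divide_distrib[symmetric])
    qed
    have "M (int j) (int j) + c j * c j * M (- int (j + 2)) (- int (j + 2)) = of_real (pi * (1 - y * y) / (j + 1))"
      unfolding c_def 1 2 y y_def[symmetric] r[symmetric] of_real_add of_real_mult ..
    then show ?thesis unfolding True[symmetric] y by simp
  next
    case False
    then have "M (int j) (int k) = 0" "M (- int (j + 2)) (- int (k + 2)) = 0"
      unfolding M_def using m_pos by (intro annulus_monomials_orthogonal; simp)+
    then show ?thesis using False by simp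
  qed
  finally show ?thesis .
qed

lemma symm_uniform_limit:
  assumes "r > 1" and sums: "\<And>t. norm t < r \<Longrightarrow> (\<lambda>j. a j * t ^ j) sums \<alpha> t"
  shows "uniform_limit (annulus m 1) (\<lambda>N t. \<Sum>j<N. a j * symm_monomial j t)
     (\<lambda>t. \<alpha> t - (of_real m / t)\<^sup>2 * \<alpha> (flip t)) sequentially"
proof -
  have ul: "uniform_limit (cball 0 1) (\<lambda>N t. \<Sum>j<N. a j * t ^ j) \<alpha> sequentially"
    by (rule power_series_uniform_limit_cball[OF assms])
  have inv: "flip t \<in> cball 0 1" if "t \<in> annulus m 1" for t
    using annulus_m_1[OF that] m_pos by (auto simp: norm_divide norm_power divide_le_eq)
  have 1: "uniform_limit (annulus m 1) (\<lambda>N t. \<Sum>j<N. a j * t ^ j) \<alpha> sequentially"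
    by (rule uniform_limit_on_subset[OF ul]) (auto simp: annulus_def)
  have 2: "uniform_limit (annulus m 1) (\<lambda>N t. \<Sum>j<N. a j * (flip t) ^ j) (\<lambda>t. \<alpha> (flip t)) sequentially"
    using uniform_limit_compose'[OF ul, of "\<lambda>t. flip t" "annulus m 1"] inv by (simp add: Pi_def)
  have 3: "uniform_limit (annulus m 1) (\<lambda>N t. (of_real m / t)\<^sup>2 * (\<Sum>j<N. a j * (flip t) ^ j))
      (\<lambda>t. (of_real m / t)\<^sup>2 * \<alpha> (flip t)) sequentially"
  proof (rule uniform_limitI)
    fix e :: real assume "e > 0"
    from uniform_limitD[OF 2 this]
    show "\<forall>\<^sub>F n in sequentially. \<forall>t\<in>annulus m 1. dist ((of_real m / t)\<^sup>2 * (\<Sum>j<n. a j * (flip t) ^ j))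
       ((of_real m / t)\<^sup>2 * \<alpha> (flip t)) < e"
    proof eventually_elim
      case (elim n)
      show ?case
      proof
        fix t assume t: "t \<in> annulus m 1"
        have "norm ((of_real m / t)\<^sup>2) \<le> 1"
          using annulus_m_1(3)[OF t] m_pos unfolding norm_power norm_divide
          by (intro power_le_one) (auto simp: divide_le_eq)
        then show "dist ((of_real m / t)\<^sup>2 * (\<Sum>j<n. a j * (flip t) ^ j)) ((of_real m / t)\<^sup>2 * \<alpha> (flip t)) < e"
          using elim t unfolding dist_norm right_diff_distrib[symmetric] norm_mult
          by (intro le_less_trans[OF mult_left_le_one_le]) auto
      qed
    qed
  qed
  have eq: "(\<Sum>j<N. a j * symm_monomial j t) = (\<Sum>j<N. a j * t ^ j) - (of_real m / t)\<^sup>2 * (\<Sum>j<N. a j * (flip t) ^ j)" for N t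
  proof -
    have "symm_monomial j t = t ^ j - (of_real m / t)\<^sup>2 * (flip t) ^ j" for j
      unfolding symm_monomial_def of_real_power power_add power_mult power_divide by (simp add: mult.commute)
    then show ?thesis by (simp add: sum_distrib_left right_diff_distrib sum_subtractf mult.left_commute)
  qed
  show ?thesis
    unfolding eq by (intro uniform_limit_intros 1 3)
qed

text \<open>In the coordinate \<open>t\<close> the inner product of \<open>G1\<close> is diagonal in the Taylor coefficients of the analytic parts. The
  weight \<open>(1 - m^(4(j+1))) / (j + 1)\<close> is the one of the unit disc minus the one of the disc of radius \<open>m\<^sup>2\<close>.\<close>
theorem gram_formula:
  assumes r: "r > 1" and a: "\<And>t. norm t < r \<Longrightarrow> (\<lambda>j. a j * t ^ j) sums \<alpha> t"
    and b: "\<And>t. norm t < r \<Longrightarrow> (\<lambda>j. b j * t ^ j) sums \<beta> t"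
    and P: "\<And>t. t \<in> annulus m 1 \<Longrightarrow> poly P (Psi t) * Psi' t = \<alpha> t - (of_real m / t)\<^sup>2 * \<alpha> (flip t)"
    and Q: "\<And>t. t \<in> annulus m 1 \<Longrightarrow> poly Q (Psi t) * Psi' t = \<beta> t - (of_real m / t)\<^sup>2 * \<beta> (flip t)"
  shows "(\<lambda>j. a j * cnj (b j) * of_real ((1 - m ^ (4 * (j + 1))) / (j + 1))) sums
     (1 / of_real pi * (LINT z:G1 R|lborel. poly P z * cnj (poly Q z)))"
proof -
  have bd: "bounded (symm_monomial j ` annulus m 1)" for j
  proof -
    have "norm (symm_monomial j t) \<le> 1 + m ^ (2 * j + 2) * (1 / m) ^ (j + 2)" if "t \<in> annulus m 1" for t
    proof -
      have "norm (1 / t) \<le> 1 / m" using annulus_m_1(3)[OF that] m_pos by (simp add: norm_divide frac_le)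
      then have "norm (1 / t) ^ (j + 2) \<le> (1 / m) ^ (j + 2)" by (intro power_mono) auto
      then have "norm (of_real (m ^ (2 * j + 2)) * (1 / t) ^ (j + 2)) \<le> m ^ (2 * j + 2) * (1 / m) ^ (j + 2)"
        unfolding norm_mult norm_power norm_of_real using m_pos by (intro mult_mono) auto
      moreover have "norm (t ^ j) \<le> 1"
        using annulus_m_1(4)[OF that] unfolding norm_power by (intro power_le_one) auto
      ultimately show ?thesis
        unfolding symm_monomial_def by (intro order_trans[OF norm_triangle_ineq4] add_mono)
    qed
    then show ?thesis unfolding bounded_iff by blast
  qed
  have ct: "continuous_on (annulus m 1) (symm_monomial j)" for j
    unfolding symm_monomial_def using m_pos by (auto intro!: continuous_intros simp: annulus_def)
  have "(\<lambda>j. a j * cnj (b j) * of_real (pi * (1 - m ^ (4 * (j + 1))) / (j + 1))) sums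
    (LINT t:annulus m 1|lborel. (\<alpha> t - (of_real m / t)\<^sup>2 * \<alpha> (flip t)) * cnj (\<beta> t - (of_real m / t)\<^sup>2 * \<beta> (flip t)))"
    by (intro expansion_inner_product_sums[where \<phi> = symm_monomial] symm_uniform_limit[OF r] a b bd ct symm_monomial_orthogonal)
      (auto simp: open_annulus bounded_annulus)
  also have "(LINT t:annulus m 1|lborel. (\<alpha> t - (of_real m / t)\<^sup>2 * \<alpha> (flip t)) * cnj (\<beta> t - (of_real m / t)\<^sup>2 * \<beta> (flip t)))
    = (LINT z:G1 R|lborel. poly P z * cnj (poly Q z))"
    unfolding integral_G1_eq_annulus
    by (intro set_lebesgue_integral_cong allI impI) (simp_all add: P Q open_annulus)
  finally have "(\<lambda>j. 1 / of_real pi * (a j * cnj (b j) * of_real (pi * (1 - m ^ (4 * (j + 1))) / (j + 1)))) sums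
     (1 / of_real pi * (LINT z:G1 R|lborel. poly P z * cnj (poly Q z)))"
    by (rule sums_mult)
  then show ?thesis by (simp add: mult_ac)
qed

end

section \<open>Faber polynomials and the disc\<close>

text \<open>A sequence with one polynomial of each degree is a basis; the top coefficient is found by comparing leading
  coefficients.\<close>
lemma graded_basis_expansion:
  fixes D :: "nat \<Rightarrow> 'a :: field poly"
  assumes D: "\<And>j. degree (D j) = j" "\<And>j. D j \<noteq> 0" and p: "degree p \<le> n"
  obtains c where "p = (\<Sum>j\<le>n. smult (c j) (D j))" "c n = coeff p n / lead_coeff (D n)"
proof -
  have "\<exists>c. p = (\<Sum>j\<le>n. smult (c j) (D j)) \<and> c n = coeff p n / lead_coeff (D n)"
    using p
  proof (induction n arbitrary: p)
    case 0
    obtain x where x: "p = [:x:]" using 0 degree_eq_zeroE by blast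
    obtain y where y: "D 0 = [:y:]" using D(1)[of 0] degree_eq_zeroE by blast
    have "y \<noteq> 0" using D(2)[of 0] y by auto
    then show ?case using x y by (intro exI[of _ "\<lambda>_. x / y"]) simp
  next
    case (Suc n)
    define q where "q = p - smult (coeff p (Suc n) / lead_coeff (D (Suc n))) (D (Suc n))"
    have "lead_coeff (D (Suc n)) \<noteq> 0" using D(2) by simp
    then have "coeff q (Suc n) = 0" using D(1)[of "Suc n"] by (simp add: q_def)
    moreover have "degree q \<le> Suc n"
      unfolding q_def using Suc.prems D(1)[of "Suc n"]
      by (intro degree_diff_le order_trans[OF degree_smult_le]) auto
    ultimately have "degree q \<le> n"
      by (metis eq_zero_or_degree_less le_less_Suc_eq less_Suc_eq_le degree_0 le0 not_less_eq_eq leading_coeff_0_iff le_SucE)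
    then obtain c where c: "q = (\<Sum>j\<le>n. smult (c j) (D j))" using Suc.IH by blast
    have "p = (\<Sum>j\<le>Suc n. smult ((c(Suc n := coeff p (Suc n) / lead_coeff (D (Suc n)))) j) (D j))"
      using c by (simp add: q_def algebra_simps)
    then show ?case by (intro exI[of _ "c(Suc n := coeff p (Suc n) / lead_coeff (D (Suc n)))"]) simp
  qed
  then show ?thesis using that by blast
qed

text \<open>The same Parseval identity on the disc; the puncture at \<open>0\<close> is a null set.\<close>
lemma disc_inner_product_sums:
  fixes a b :: "nat \<Rightarrow> complex"
  assumes "r > 1" and a: "\<And>t. norm t < r \<Longrightarrow> (\<lambda>j. a j * t ^ j) sums \<alpha> t"
    and b: "\<And>t. norm t < r \<Longrightarrow> (\<lambda>j. b j * t ^ j) sums \<beta> t"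
  shows "(\<lambda>j. a j * cnj (b j) / of_nat (j + 1)) sums (1 / of_real pi * (LINT t:ball 0 1|lborel. \<alpha> t * cnj (\<beta> t)))"
proof -
  have bd: "bounded ((\<lambda>t. t ^ j) ` annulus 0 1)" for j
    unfolding bounded_iff by (auto simp: norm_power annulus_def intro!: exI[of _ 1] power_le_one)
  have orth: "(LINT t:annulus 0 1|lborel. t ^ j * cnj (t ^ k)) = (if j = k then of_real (pi / (j + 1)) else 0)" for j k
    using annulus_monomials_orthogonal[of 0 "int j" "int k" 1] annulus_square_power_integral[of 0 1 j]
    by (cases "j = k") simp_all
  have ul: "uniform_limit (annulus 0 1) (\<lambda>N t. \<Sum>j<N. x j * t ^ j) f sequentially"
    if "\<And>t. norm t < r \<Longrightarrow> (\<lambda>j. x j * t ^ j) sums f t" for x :: "nat \<Rightarrow> complex" and f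
    by (rule uniform_limit_on_subset[OF power_series_uniform_limit_cball[OF \<open>r > 1\<close> that]]) (auto simp: annulus_def)
  have cont: "continuous_on (ball 0 1) f" if "\<And>t. norm t < r \<Longrightarrow> (\<lambda>j. x j * t ^ j) sums f t" for x :: "nat \<Rightarrow> complex" and f
  proof -
    have "continuous_on (cball 0 1) f"
      by (rule uniform_limit_theorem[OF _ power_series_uniform_limit_cball[OF \<open>r > 1\<close> that]])
        (auto intro!: always_eventually continuous_intros)
    then show ?thesis by (rule continuous_on_subset) auto
  qed
  have "(\<lambda>j. a j * cnj (b j) * of_real (pi / (j + 1))) sums (LINT t:annulus 0 1|lborel. \<alpha> t * cnj (\<beta> t))"
    by (intro expansion_inner_product_sums[where \<phi> = "\<lambda>j t. t ^ j"] ul a b bd orth)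
      (auto simp: open_annulus bounded_annulus intro!: continuous_intros)
  also have "(LINT t:annulus 0 1|lborel. \<alpha> t * cnj (\<beta> t)) = (LINT t:ball 0 1|lborel. \<alpha> t * cnj (\<beta> t))"
  proof (rule set_integral_cong_set)
    have "AE t in lborel. t \<noteq> (0::complex)" by (rule AE_lborel_singleton)
    then show "AE t in lborel. t \<in> ball 0 1 \<longleftrightarrow> t \<in> annulus 0 (1::real)"
      by eventually_elim (auto simp: annulus_def)
    have c: "continuous_on (ball 0 1) (\<lambda>t. \<alpha> t * cnj (\<beta> t))"
      by (intro continuous_intros cont[OF a] cont[OF b])
    show "set_borel_measurable lborel (ball 0 1) (\<lambda>t. \<alpha> t * cnj (\<beta> t))"
      unfolding set_borel_measurable_def using c
      by (auto intro!: borel_measurable_continuous_on_indicator)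
    have "annulus 0 1 \<subseteq> ball 0 1" by (auto simp: annulus_def)
    then show "set_borel_measurable lborel (annulus 0 1) (\<lambda>t. \<alpha> t * cnj (\<beta> t))"
      unfolding set_borel_measurable_def using continuous_on_subset[OF c] open_annulus
      by (auto intro!: borel_measurable_continuous_on_indicator)
  qed
  finally have "(\<lambda>j. 1 / of_real pi * (a j * cnj (b j) * of_real (pi / (j + 1)))) sums
    (1 / of_real pi * (LINT t:ball 0 1|lborel. \<alpha> t * cnj (\<beta> t)))" by (rule sums_mult)
  then show ?thesis by simp
qed

context joukowski_disc
begin

definition W' :: "complex \<Rightarrow> complex" where
  "W' t = - (1 - (of_real m)\<^sup>2) / (of_real m * t - 1)\<^sup>2"

lemma has_field_derivative_W:
  assumes "of_real m * t \<noteq> 1"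
  shows "(W has_field_derivative W' t) (at t)"
proof -
  have "of_real m * t - 1 \<noteq> 0" using assms by simp
  then have "((\<lambda>t. (t - of_real m) / (of_real m * t - 1)) has_field_derivative
     (1 * (of_real m * t - 1) - (t - of_real m) * of_real m) / ((of_real m * t - 1) * (of_real m * t - 1))) (at t)"
    by (intro DERIV_divide) (auto intro!: derivative_eq_intros)
  then show ?thesis by (simp add: W_eq[abs_def] W'_def power2_eq_square algebra_simps)
qed

lemma one_minus_m2_nz: "1 - (complex_of_real m)\<^sup>2 \<noteq> 0"
proof -
  have "1 - (complex_of_real m)\<^sup>2 = of_real (1 - m\<^sup>2)" by simp
  then show ?thesis using m2_less_1 by (metis less_irrefl of_real_eq_0_iff right_minus_eq)
qed

lemma mW_minus_1:
  assumes "of_real m * t \<noteq> 1"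
  shows "of_real m * W t - 1 = (1 - (of_real m)\<^sup>2) / (of_real m * t - 1)"
proof -
  have "of_real m * t - 1 \<noteq> 0" using assms by simp
  then show ?thesis by (simp add: W_eq field_simps power2_eq_square)
qed

lemma W'_W:
  assumes "of_real m * t \<noteq> 1"
  shows "W' (W t) * W' t = 1"
proof -
  have "of_real m * t - 1 \<noteq> 0" using assms by simp
  moreover have "(- y / (y / b)\<^sup>2) * (- y / b\<^sup>2) = 1" if "y \<noteq> 0" "b \<noteq> 0" for y b :: complex
    using that by (simp add: field_simps power2_eq_square)
  ultimately show ?thesis using one_minus_m2_nz
    unfolding W'_def mW_minus_1[OF assms] by blast
qed

lemma U_inverse:
  assumes "of_real m * t \<noteq> 1" "t \<noteq> 0" "t \<noteq> of_real m ^ 3"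
  shows "U (flip t) = 1 / U t"
proof -
  have nz: "complex_of_real m \<noteq> 0" "of_real m * t - 1 \<noteq> 0" "t - of_real m ^ 3 \<noteq> 0" "of_real m ^ 3 - t \<noteq> 0"
    using m_pos assms by auto
  have reg: "of_real m * (flip t) \<noteq> 1"
    using assms by (simp add: field_simps power2_eq_square power3_eq_cube)
  have "U (flip t) = (flip t - of_real m ^ 3) / (of_real m * (of_real m * (flip t) - 1))"
    by (rule U_eq[OF reg])
  also have "flip t - of_real m ^ 3 = - (of_real m)\<^sup>2 * (of_real m * t - 1) / t"
    using assms(2) by (simp add: field_simps power2_eq_square power3_eq_cube)
  also have "of_real m * (of_real m * (flip t) - 1) = - of_real m * (t - of_real m ^ 3) / t"
    using assms(2) by (simp add: field_simps power2_eq_square power3_eq_cube)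
  also have "- (of_real m)\<^sup>2 * (of_real m * t - 1) / t / (- of_real m * (t - of_real m ^ 3) / t)
     = of_real m * (of_real m * t - 1) / (t - of_real m ^ 3)"
    using nz assms(2) by (simp add: power2_eq_square)
  also have "\<dots> = 1 / U t" by (simp add: U_eq[OF assms(1)])
  finally show ?thesis .
qed

text \<open>The sum of the \<open>n\<close>-th powers of the two preimages \<open>x = W t\<close> and \<open>y = W (m\<^sup>2 / t)\<close> of \<open>z\<close>. The recurrence is
  Newton's, with \<open>x + y = (z + 2) / R\<close> and \<open>x y = (z + 2) / R\<^sup>2\<close>. Up to an additive constant these are the Faber
  polynomials of \<open>G1\<close>.\<close>
fun faber :: "nat \<Rightarrow> complex poly" where
  "faber 0 = [:2:]"
| "faber (Suc 0) = [:2 / of_real R, 1 / of_real R:]"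
| "faber (Suc (Suc n)) = smult (1 / of_real R) ([:2, 1:] * faber (Suc n)) - smult (1 / of_real R ^ 2) ([:2, 1:] * faber n)"

lemma poly_faber:
  assumes "of_real m * t \<noteq> 1" "t \<noteq> 0" "t \<noteq> of_real m ^ 3"
  shows "poly (faber n) (Psi t) = W t ^ n + W (flip t) ^ n"
proof -
  have R0: "complex_of_real R \<noteq> 0" using R_gt_2 by simp
  have U0: "U t \<noteq> 0" using assms m_pos by (simp add: U_eq)
  have 1: "W t = (U t + 1) / of_real R" using R0 by (simp add: U_def)
  have 2: "W (flip t) = (1 / U t + 1) / of_real R"
    using R0 U_inverse[OF assms] by (simp add: U_def field_simps)
  define u where "u = U t"
  have "u \<noteq> 0" using U0 by (simp add: u_def)
  have *: "poly (faber n) (u + 1 / u) = ((u + 1) / of_real R) ^ n + ((1 / u + 1) / of_real R) ^ n"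
  proof (induction n rule: faber.induct)
    case (3 n)
    define x y z where "x = (u + 1) / complex_of_real R" and "y = (1 / u + 1) / complex_of_real R" and "z = u + 1 / u"
    have e: "x ^ Suc (Suc n) + y ^ Suc (Suc n) = (x + y) * (x ^ Suc n + y ^ Suc n) - x * y * (x ^ n + y ^ n)"
      by (simp add: algebra_simps)
    have s: "x + y = (2 + z) / of_real R"
      by (simp add: x_def y_def z_def add_divide_distrib)
    have p: "x * y = (2 + z) / (of_real R)\<^sup>2"
      using \<open>u \<noteq> 0\<close> R0 by (simp add: x_def y_def z_def field_simps power2_eq_square)
    show ?case
      using 3 unfolding x_def[symmetric] y_def[symmetric] z_def[symmetric] e s p
      by (simp only: faber.simps poly_diff poly_smult poly_mult) simp
  qed (use R0 in \<open>auto simp: field_simps\<close>)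
  then show ?thesis
    unfolding 1 2 Psi_eq_joukowski joukowski_def u_def .
qed

lemma degree_faber: "degree (faber (Suc n)) = Suc n \<and> lead_coeff (faber (Suc n)) = 1 / of_real R ^ Suc n"
proof (induction n)
  case 0
  then show ?case using R_gt_2 by simp
next
  case (Suc n)
  have R0: "complex_of_real R \<noteq> 0" using R_gt_2 by simp
  define A where "A = smult (1 / complex_of_real R) ([:2, 1:] * faber (Suc n))"
  define B where "B = smult (1 / complex_of_real R ^ 2) ([:2, 1:] * faber n)"
  have f: "faber (Suc n) \<noteq> 0" using Suc by auto
  have dA: "degree A = Suc (Suc n)"
  proof -
    have "degree A = degree ([:2, 1 :: complex:] * faber (Suc n))"
      unfolding A_def degree_smult_eq using R0 by simp
    also have "\<dots> = degree [:2, 1 :: complex:] + degree (faber (Suc n))"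
      using f by (intro degree_mult_eq) auto
    finally show ?thesis using Suc by simp
  qed
  have lA: "coeff A (Suc (Suc n)) = 1 / of_real R ^ Suc (Suc n)"
  proof -
    have "lead_coeff A = (1 / of_real R) * (1 * (1 / of_real R ^ Suc n))"
    proof -
      have "lead_coeff (faber (Suc n)) = 1 / of_real R ^ Suc n" using Suc by blast
      then show ?thesis unfolding A_def lead_coeff_smult lead_coeff_mult by simp
    qed
    then show ?thesis unfolding dA by simp
  qed
  have "degree B \<le> degree ([:2, 1 :: complex:] * faber n)" unfolding B_def by (rule degree_smult_le)
  also have "\<dots> \<le> 1 + degree (faber n)" by (rule order_trans[OF degree_mult_le]) simp
  also have "degree (faber n) \<le> n" using Suc_le_eq
  proof (cases n)
    case (Suc k)
    have "degree (faber (Suc k)) \<le> Suc k"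
    proof (induction k rule: less_induct)
      case (less k)
      show ?case
      proof (cases k)
        case (Suc j)
        have "degree (faber j) \<le> j" using less[of "j - 1"] Suc by (cases j) auto
        then have "degree (smult (1 / (complex_of_real R)\<^sup>2) ([:2, 1:] * faber j)) \<le> Suc (Suc j)"
          by (intro order_trans[OF degree_smult_le] order_trans[OF degree_mult_le]) simp
        moreover have "degree (smult (1 / complex_of_real R) ([:2, 1:] * faber (Suc j))) \<le> Suc (Suc j)"
          using less[of j] Suc by (intro order_trans[OF degree_smult_le] order_trans[OF degree_mult_le]) simp
        ultimately show ?thesis unfolding Suc faber.simps by (rule degree_diff_le[rotated])
      qed (use R_gt_2 in simp)
    qed
    then show ?thesis using Suc by simp
  qed simp
  finally have dB: "degree B < Suc (Suc n)" by simp
  have AB: "faber (Suc (Suc n)) = A - B" by (simp add: A_def B_def)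
  have "coeff (A - B) (Suc (Suc n)) = 1 / of_real R ^ Suc (Suc n)"
    using lA dB by (simp add: coeff_eq_0)
  moreover have "degree (A - B) = Suc (Suc n)"
    using dA dB by (metis degree_diff_less degree_add_eq_left degree_minus diff_conv_add_uminus)
  ultimately show ?case unfolding AB by simp
qed

text \<open>The shift of the index makes the degree equal to \<open>j\<close>.\<close>
definition faber' :: "nat \<Rightarrow> complex poly" where
  "faber' j = pderiv (faber (Suc j))"

lemma degree_faber': "degree (faber' j) = j" "faber' j \<noteq> 0"
  "lead_coeff (faber' j) = of_nat (j + 1) / of_real R ^ (j + 1)"
proof -
  show d: "degree (faber' j) = j" using degree_faber[of j] by (simp add: faber'_def degree_pderiv)
  show l: "lead_coeff (faber' j) = of_nat (j + 1) / of_real R ^ (j + 1)"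
  proof -
    have "coeff (faber (Suc j)) (Suc j) = 1 / of_real R ^ Suc j" using degree_faber[of j] by metis
    then have "coeff (faber' j) j = of_nat (j + 1) / of_real R ^ (j + 1)"
      unfolding faber'_def coeff_pderiv by simp
    then show ?thesis unfolding d .
  qed
  show "faber' j \<noteq> 0" using l R_gt_2 by (auto simp del: of_nat_Suc of_nat_add)
qed

text \<open>Differentiating the power sum exhibits the analytic part of the pull-back: it is \<open>d(W^(j+1))/dt\<close>.\<close>
lemma poly_faber':
  assumes "of_real m * t \<noteq> 1" "t \<noteq> 0" "t \<noteq> of_real m ^ 3"
  shows "poly (faber' j) (Psi t) * Psi' t =
    of_nat (j + 1) * W t ^ j * W' t - (of_real m / t)\<^sup>2 * (of_nat (j + 1) * W (flip t) ^ j * W' (flip t))"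
proof -
  have op: "open {t. of_real m * t \<noteq> 1 \<and> t \<noteq> 0 \<and> t \<noteq> complex_of_real m ^ 3}"
    by (intro open_Collect_conj open_Collect_neq continuous_intros)
  have reg: "of_real m * (flip t) \<noteq> 1"
    using assms by (simp add: field_simps power2_eq_square power3_eq_cube)
  have inv: "((\<lambda>t. flip t) has_field_derivative - ((of_real m / t)\<^sup>2)) (at t)"
    using assms by (auto intro!: derivative_eq_intros simp: power2_eq_square)
  have "((\<lambda>t. poly (faber (Suc j)) (Psi t)) has_field_derivative poly (faber' j) (Psi t) * Psi' t) (at t)"
    unfolding faber'_def by (rule DERIV_chain2[OF poly_DERIV has_field_derivative_Psi[OF assms(1,3)]])
  then have d1: "((\<lambda>t. W t ^ Suc j + W (flip t) ^ Suc j) has_field_derivative poly (faber' j) (Psi t) * Psi' t) (at t)"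
  proof (rule has_field_derivative_transform_within_open[OF _ op])
    fix s assume "s \<in> {t. of_real m * t \<noteq> 1 \<and> t \<noteq> 0 \<and> t \<noteq> complex_of_real m ^ 3}"
    then show "poly (faber (Suc j)) (Psi s) = W s ^ Suc j + W (flip s) ^ Suc j"
      using poly_faber by blast
  qed (use assms in auto)
  have d2: "((\<lambda>t. W t ^ Suc j + W (flip t) ^ Suc j) has_field_derivative
     of_nat (Suc j) * (W' t * W t ^ (Suc j - Suc 0)) +
     of_nat (Suc j) * ((W' (flip t) * - ((of_real m / t)\<^sup>2)) * W (flip t) ^ (Suc j - Suc 0))) (at t)"
    by (intro DERIV_add DERIV_power has_field_derivative_W assms DERIV_chain2[OF has_field_derivative_W[OF reg] inv])
  show ?thesis
    using DERIV_unique[OF d1 d2] by (simp add: algebra_simps)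
qed

section \<open>Orthonormality as a condition on the analytic part\<close>

lemma R_minus_1: "1 < R - 1" "m * (R - 1) = 1 - m * (1 - m)" "R - 1 < 1 / m"
proof -
  show "1 < R - 1" using R_gt_2 by simp
  have "m * R = m * m + 1" using m_pos by (subst R_eq) (simp add: field_simps)
  then show *: "m * (R - 1) = 1 - m * (1 - m)" by (simp add: algebra_simps)
  have "m * (1 - m) > 0" using m_pos m_less_1 by simp
  then have "m * (R - 1) < 1" using * by simp
  then show "R - 1 < 1 / m" using m_pos by (simp add: field_simps)
qed

text \<open>The inequality \<open>m\<^sup>2 \<bar>w - m\<bar> \<le> \<bar>m w - 1\<bar>\<close> reduces to a quadratic in \<open>m Re w\<close> with roots \<open>1 + m\<^sup>2 \<plusminus> m\<close>. The smaller root
  is \<open>m (R - 1)\<close>; hence the radius \<open>R - 1\<close>.\<close>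
lemma norm_W_le:
  assumes "norm w \<le> R - 1"
  shows "norm (W w) \<le> 1 / m\<^sup>2"
proof -
  have ne: "of_real m * w \<noteq> 1" using assms R_minus_1(3) by (intro mt_ne_1) simp
  then have pos: "0 < norm (of_real m * w - 1)" by simp
  have x: "m * Re w \<le> 1 + m\<^sup>2 - m"
  proof -
    have "m * Re w \<le> m * (R - 1)" using complex_Re_le_cmod[of w] assms m_pos by (intro mult_left_mono) auto
    then show ?thesis using R_minus_1(2) by (simp add: algebra_simps power2_eq_square)
  qed
  have "0 \<le> (1 + m\<^sup>2 - m - m * Re w) * (1 + m\<^sup>2 + m - m * Re w)"
    using x m_pos by (intro mult_nonneg_nonneg) auto
  also have "\<dots> = m\<^sup>2 * (Re w)\<^sup>2 - 2 * m * (1 + m\<^sup>2) * Re w + 1 + m\<^sup>2 + m ^ 4"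
    by (simp add: power2_eq_square power4_eq_xxxx algebra_simps)
  also have "\<dots> \<le> m\<^sup>2 * (norm w)\<^sup>2 - 2 * m * (1 + m\<^sup>2) * Re w + 1 + m\<^sup>2 + m ^ 4"
  proof -
    have "(Re w)\<^sup>2 \<le> (norm w)\<^sup>2" by (simp add: cmod_power2)
    then show ?thesis by (simp add: mult_left_mono)
  qed
  finally have "0 \<le> (1 - m\<^sup>2) * (m\<^sup>2 * (norm w)\<^sup>2 - 2 * m * (1 + m\<^sup>2) * Re w + 1 + m\<^sup>2 + m ^ 4)"
    using m2_less_1 by (intro mult_nonneg_nonneg) auto
  also have "\<dots> = (norm (of_real m * w - 1))\<^sup>2 - (m\<^sup>2 * norm (w - of_real m))\<^sup>2"
    unfolding power_mult_distrib norm_diff_square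
    by (simp add: norm_mult power_mult_distrib algebra_simps power2_eq_square power4_eq_xxxx)
  finally have "(m\<^sup>2 * norm (w - of_real m))\<^sup>2 \<le> (norm (of_real m * w - 1))\<^sup>2" by simp
  then have "m\<^sup>2 * norm (w - of_real m) \<le> norm (of_real m * w - 1)"
    by (rule power2_le_imp_le) simp
  then show ?thesis using pos m_pos by (simp add: W_eq norm_divide field_simps)
qed

lemma norm_W'_le:
  assumes "norm w \<le> R - 1"
  shows "norm (W' w) \<le> 1 / (m * (1 - m))\<^sup>2"
proof -
  have "m * norm w \<le> m * (R - 1)" using assms m_pos by (intro mult_left_mono) auto
  then have 1: "m * (1 - m) \<le> 1 - m * norm w" using R_minus_1(2) by simp
  have "norm (1 :: complex) - norm (of_real m * w) \<le> norm (1 - of_real m * w)" by (rule norm_triangle_ineq2)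
  then have "m * (1 - m) \<le> norm (of_real m * w - 1)" using 1 m_pos by (simp add: norm_mult norm_minus_commute)
  then have p: "(m * (1 - m))\<^sup>2 \<le> (norm (of_real m * w - 1))\<^sup>2" using m_pos m_less_1 by (intro power_mono) auto
  have "1 - (complex_of_real m)\<^sup>2 = of_real (1 - m\<^sup>2)" by simp
  then have "norm (1 - (complex_of_real m)\<^sup>2) = 1 - m\<^sup>2" using m2_less_1 by (simp only: norm_of_real)
  then have "norm (W' w) = (1 - m\<^sup>2) / (norm (of_real m * w - 1))\<^sup>2"
    by (simp add: W'_def norm_divide norm_power norm_minus_commute[of "(complex_of_real m)\<^sup>2"])
  also have "\<dots> \<le> 1 / (m * (1 - m))\<^sup>2" using p m_pos m_less_1 by (intro frac_le) auto
  finally show ?thesis .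
qed

definition bergman_ip :: "complex poly \<Rightarrow> complex poly \<Rightarrow> complex" where
  "bergman_ip P Q = 1 / of_real pi * (LINT z:G1 R|lborel. poly P z * cnj (poly Q z))"

lemma integrable_G1: "set_integrable lborel (G1 R) (\<lambda>z. poly P z * cnj (poly Q z))"
proof -
  have "continuous_on UNIV (\<lambda>z. poly P z * cnj (poly Q z))" by (intro continuous_intros)
  from bounded_continuous_on_bounded[OF bounded_G1 this]
  obtain B where "\<And>z. z \<in> G1 R \<Longrightarrow> norm (poly P z * cnj (poly Q z)) \<le> B" by blast
  then show ?thesis
    by (intro set_integrable_bounded_continuous bounded_G1 continuous_intros) (auto simp: open_G1)
qed

lemma bergman_ip_smult_right: "bergman_ip P (smult c Q) = cnj c * bergman_ip P Q"
proof -
  have "(LINT z:G1 R|lborel. poly P z * cnj (poly (smult c Q) z)) = (LINT z:G1 R|lborel. cnj c * (poly P z * cnj (poly Q z)))"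
    by (simp add: mult_ac)
  also have "\<dots> = cnj c * (LINT z:G1 R|lborel. poly P z * cnj (poly Q z))" by (rule set_integral_mult_right)
  finally show ?thesis unfolding bergman_ip_def by simp
qed

lemma bergman_ip_add_right: "bergman_ip P (Q1 + Q2) = bergman_ip P Q1 + bergman_ip P Q2"
proof -
  have "(LINT z:G1 R|lborel. poly P z * cnj (poly (Q1 + Q2) z)) = (LINT z:G1 R|lborel. poly P z * cnj (poly Q1 z) + poly P z * cnj (poly Q2 z))"
    by (simp add: algebra_simps)
  also have "\<dots> = (LINT z:G1 R|lborel. poly P z * cnj (poly Q1 z)) + (LINT z:G1 R|lborel. poly P z * cnj (poly Q2 z))"
    by (rule set_integral_add(2)[OF integrable_G1 integrable_G1])
  finally show ?thesis unfolding bergman_ip_def by (simp add: add_divide_distrib)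
qed

lemma bergman_ip_sum_right: "bergman_ip P (\<Sum>j\<in>A. smult (c j) (Q j)) = (\<Sum>j\<in>A. cnj (c j) * bergman_ip P (Q j))"
proof (induction A rule: infinite_finite_induct)
  case (insert x A)
  then show ?case by (simp add: bergman_ip_add_right bergman_ip_smult_right)
qed (use bergman_ip_smult_right[of P 0 0] in simp_all)

text \<open>Orthogonality to the lower degrees and the normalization of \<open>p n\<close>, tested on the graded basis of derivatives of Faber
  polynomials, whose analytic parts are explicit.\<close>
lemma orthonormal_faber_expansion:
  assumes "orthonormal_polys R p"
  obtains c x where "p n = (\<Sum>j\<le>n. smult (c j) (faber' j))" "\<And>j. j < n \<Longrightarrow> bergman_ip (p n) (faber' j) = 0"
    "c n = of_real x" "x > 0" "cnj (c n) * bergman_ip (p n) (faber' n) = 1" "bergman_ip (p n) (p n) = 1"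
proof -
  have deg: "\<And>n. degree (p n) = n" and lc: "\<And>n. lead_coeff (p n) \<in> \<real>" "\<And>n. Re (lead_coeff (p n)) > 0"
    and orth: "\<And>n k. bergman_ip (p n) (p k) = (if n = k then 1 else 0)"
  proof -
    show "degree (p n) = n" "lead_coeff (p n) \<in> \<real>" "Re (lead_coeff (p n)) > 0" for n
      using assms unfolding orthonormal_polys_def by blast+
    show "bergman_ip (p n) (p k) = (if n = k then 1 else 0)" for n k
      using assms unfolding orthonormal_polys_def bergman_ip_def by blast
  qed
  have nz: "p n \<noteq> 0" for n using lc(2)[of n] by (cases "p n = 0") simp_all
  obtain c where c: "p n = (\<Sum>j\<le>n. smult (c j) (faber' j))" "c n = coeff (p n) n / lead_coeff (faber' n)"
    using graded_basis_expansion[of faber' "p n" n] degree_faber' deg by auto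
  have low: "bergman_ip (p n) (faber' j) = 0" if "j < n" for j
  proof -
    obtain d where d: "faber' j = (\<Sum>i\<le>j. smult (d i) (p i))"
      using graded_basis_expansion[of p "faber' j" j, OF deg nz] degree_faber'(1)[of j] by (metis order_refl)
    show ?thesis unfolding d bergman_ip_sum_right using that by (intro sum.neutral) (auto simp: orth)
  qed
  have "1 = bergman_ip (p n) (p n)" by (simp add: orth)
  also have "\<dots> = (\<Sum>j\<le>n. cnj (c j) * bergman_ip (p n) (faber' j))"
    by (subst (2) c(1)) (rule bergman_ip_sum_right)
  also have "\<dots> = (\<Sum>j\<in>{n}. cnj (c j) * bergman_ip (p n) (faber' j))"
    by (intro sum.mono_neutral_right) (auto simp: low)
  finally have 1: "cnj (c n) * bergman_ip (p n) (faber' n) = 1" by simp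
  define x where "x = Re (lead_coeff (p n)) / (real (n + 1) / R ^ (n + 1))"
  have "c n = of_real x"
  proof -
    have "coeff (p n) n = of_real (Re (lead_coeff (p n)))" using lc(1)[of n] deg[of n] by (simp add: of_real_Re)
    then show ?thesis unfolding c(2) degree_faber'(3) x_def by simp
  qed
  moreover have "x > 0" unfolding x_def using lc(2)[of n] R_gt_2 by simp
  ultimately show ?thesis using that[OF c(1) low _ _ 1] orth by simp
qed

end

text \<open>Taylor coefficients of size \<open>r^(-k)\<close> make a remainder of order \<open>n + 1\<close> geometrically small on the closed unit disc.\<close>
lemma suminf_geometric_tail_bound:
  fixes a :: "nat \<Rightarrow> complex" 
  assumes a: "\<And>k. norm (a k) \<le> C * (1 / r) ^ k" and r: "r > 1" and w: "norm w \<le> 1"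
    and s: "(\<lambda>k. a k * w ^ k) sums s" and z: "\<And>k. k \<le> n \<Longrightarrow> a k = 0"
  shows "norm s \<le> C * r / (r - 1) * (norm w / r) ^ (n + 1)"
proof -
  define q where "q = norm w / r"
  have q: "0 \<le> q" "q \<le> 1 / r" "q < 1" "1 / r < 1" using r w by (auto simp: q_def divide_simps)
  have C: "0 \<le> C" using a[of 0] by (simp add: order_trans[OF norm_ge_zero])
  have b: "norm (a k * w ^ k) \<le> C * q ^ k" for k
  proof -
    have "norm (a k * w ^ k) \<le> C * (1 / r) ^ k * norm w ^ k"
      unfolding norm_mult norm_power by (intro mult_right_mono a zero_le_power norm_ge_zero)
    then show ?thesis by (simp add: q_def power_divide)
  qed
  have "(\<lambda>k. a (k + (n + 1)) * w ^ (k + (n + 1))) sums (s - (\<Sum>k<n+1. a k * w ^ k))"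
    using s by (rule sums_split_initial_segment)
  moreover have "(\<Sum>k<n+1. a k * w ^ k) = 0" using z by (intro sum.neutral) auto
  ultimately have "(\<lambda>k. a (k + (n + 1)) * w ^ (k + (n + 1))) sums s" by simp
  moreover have "(\<lambda>k. C * q ^ (n + 1) * q ^ k) sums (C * q ^ (n + 1) * (1 / (1 - q)))"
    using q by (intro sums_mult geometric_sums) simp
  moreover have "norm (a (k + (n + 1)) * w ^ (k + (n + 1))) \<le> C * q ^ (n + 1) * q ^ k" for k
    using b[of "k + (n + 1)"] by (simp only: power_add mult_ac)
  ultimately have "norm s \<le> C * q ^ (n + 1) * (1 / (1 - q))"
    by (rule norm_sums_le)
  also have "\<dots> \<le> C * q ^ (n + 1) * (r / (r - 1))"
  proof -
    have "1 / (1 - q) \<le> 1 / (1 - 1 / r)" using q by (intro frac_le) auto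
    also have "\<dots> = r / (r - 1)" using r by (simp add: field_simps)
    finally show ?thesis using C q by (intro mult_left_mono) auto
  qed
  finally show ?thesis by (simp add: q_def mult_ac)
qed

context joukowski_disc
begin

text \<open>The normalization bounds every Taylor coefficient, because the weights of the Gram formula exceed
  \<open>(1 - m^4) / (j + 1)\<close>. The resulting bound on compact subsets of the disc is independent of the degree.\<close>
lemma analytic_part_bound:
  assumes a: "\<And>t. norm t < r \<Longrightarrow> (\<lambda>j. a j * t ^ j) sums \<alpha> t" and "r > 1"
    and s: "(\<lambda>j. a j * cnj (a j) * of_real ((1 - m ^ (4 * (j + 1))) / (j + 1))) sums 1"
    and t: "norm t \<le> m\<^sup>2"
  shows "norm (\<alpha> t) \<le> 1 / ((1 - m ^ 4) * (1 - m\<^sup>2)\<^sup>2)"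
proof -
  define K where "K = 1 / (1 - m ^ 4)"
  have K: "K \<ge> 1" "K > 0" using m4_less_1 m_pos by (simp_all add: K_def)
  have aj: "norm (a j) \<le> K * (j + 1)" for j
  proof -
    define b where "b i = (norm (a i))\<^sup>2 * ((1 - m ^ (4 * (i + 1))) / (i + 1))" for i
    have ge: "1 - m ^ 4 \<le> 1 - m ^ (4 * (i + 1))" for i
      using m_pos m_less_1 by (simp add: power_decreasing)
    then have ge0: "0 \<le> 1 - m ^ (4 * (i + 1))" for i using m4_less_1 by (meson less_eq_real_def order_trans diff_ge_0_iff_ge)
    have "(\<lambda>i. complex_of_real (b i)) sums of_real 1"
      using s by (simp only: b_def of_real_mult complex_norm_square of_real_1)
    then have bs: "b sums 1" by (simp only: sums_of_real_iff)
    have b0: "b i \<ge> 0" for i unfolding b_def using ge0[of i] by simp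
    have "b j \<le> suminf b"
      using sum_le_suminf[of b "{j}"] bs b0 by (simp add: sums_iff)
    then have "b j \<le> 1" using bs by (simp add: sums_iff)
    have "(norm (a j))\<^sup>2 * ((1 - m ^ 4) / (j + 1)) \<le> b j"
      unfolding b_def using ge[of j] by (intro mult_left_mono divide_right_mono) auto
    then have "(norm (a j))\<^sup>2 * ((1 - m ^ 4) / (j + 1)) \<le> 1" using \<open>b j \<le> 1\<close> by linarith
    then have "(norm (a j))\<^sup>2 * (1 - m ^ 4) \<le> real j + 1" by (simp add: pos_divide_le_eq)
    then have "(norm (a j))\<^sup>2 \<le> K * (j + 1)"
      using m4_less_1 by (simp add: K_def pos_le_divide_eq)
    also have "\<dots> \<le> (K * (j + 1))\<^sup>2"
    proof -
      have "1 \<le> K * (real j + 1)" using mult_mono[of 1 K 1 "real j + 1"] K by simp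
      then show ?thesis using self_le_power[of "K * (real j + 1)" 2] by (simp add: algebra_simps)
    qed
    finally show ?thesis by (rule power2_le_imp_le) (use K in simp)
  qed
  have m2: "0 \<le> m\<^sup>2" "norm (m\<^sup>2) < 1" using m2_less_1 by auto
  have g: "(\<lambda>j. K * (of_nat (Suc j) * (m\<^sup>2) ^ j)) sums (K * (1 / (1 - m\<^sup>2)\<^sup>2))"
    by (intro sums_mult geometric_deriv_sums m2)
  have "norm t < r" using t m2_less_1 \<open>r > 1\<close> by linarith
  from a[OF this] g have "norm (\<alpha> t) \<le> K * (1 / (1 - m\<^sup>2)\<^sup>2)"
  proof (rule norm_sums_le)
    fix j
    have "norm (a j * t ^ j) \<le> K * (j + 1) * (m\<^sup>2) ^ j"
      unfolding norm_mult norm_power using aj[of j] t by (intro mult_mono power_mono) (use K in auto)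
    then show "norm (a j * t ^ j) \<le> K * (of_nat (Suc j) * (m\<^sup>2) ^ j)" by (simp add: algebra_simps)
  qed
  then show ?thesis by (simp add: K_def)
qed

text \<open>The second condition says that \<open>\<alpha>\<close> is the analytic part of the pull-back of \<open>P\<close>. In the third and fourth, the
  difference of \<open>\<alpha>\<close> and its dilated copy vanishes to order \<open>n\<close> in the coordinate \<open>w\<close>, with a remainder
  exponentially smaller than the leading term on \<open>\<bar>w\<bar> \<le> m\<close>. The conditions on \<open>c\<close> determine \<open>v\<close> asymptotically:
  \<open>c = 1 / v\<close> and \<open>(n + 1) c \<approx> v\<close>, so \<open>v\<^sup>2 \<approx> n + 1\<close>.\<close>
definition decomposition :: "real \<Rightarrow> nat \<Rightarrow> complex poly \<Rightarrow> (complex \<Rightarrow> complex) \<Rightarrow> (complex \<Rightarrow> complex) \<Rightarrow> complex \<Rightarrow> real \<Rightarrow> bool" where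
  "decomposition C n P \<alpha> E v c \<longleftrightarrow>
     \<alpha> holomorphic_on ball 0 (1 / m) \<and>
     (\<forall>t. of_real m * t \<noteq> 1 \<and> t \<noteq> 0 \<and> t \<noteq> of_real m ^ 3 \<longrightarrow>
        poly P (Psi t) * Psi' t = \<alpha> t - (of_real m / t)\<^sup>2 * \<alpha> (flip t)) \<and>
     (\<forall>t. norm t < 1 \<longrightarrow> \<alpha> t - of_real (m ^ 4) * \<alpha> (of_real (m ^ 4) * t) = (v * W t ^ n + E (W t)) * W' t) \<and>
     (\<forall>w. norm w \<le> 1 \<longrightarrow> norm (E w) \<le> C * (norm w / (R - 1)) ^ (n + 1)) \<and>
     c > 0 \<and> of_real c * v = 1 \<and> norm (v - of_real (real (n + 1) * c)) \<le> C * (1 / (R - 1)) ^ n"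

text \<open>In the coordinate \<open>w\<close> the differential \<open>(\<alpha>(t) - m^4 \<alpha>(m^4 t)) dt\<close> is \<open>(G - H) dw\<close>, with \<open>G\<close> a polynomial of degree
  \<open>n\<close> and \<open>H\<close> coming from the dilated copy. The inner products of \<open>p n\<close> with derivatives of Faber polynomials
  are exactly the Taylor coefficients of \<open>G - H\<close>. Those of index below \<open>n\<close> vanish; those above \<open>n\<close> belong to
  \<open>H\<close> alone, which is bounded on \<open>\<bar>w\<bar> \<le> R - 1\<close> independently of \<open>n\<close>.\<close>
theorem orthonormal_decomposition:
  assumes orth: "orthonormal_polys R p"
  shows "\<exists>C. \<forall>n. \<exists>\<alpha> E v c. decomposition C n (p n) \<alpha> E v c"
proof -
  define A1 where "A1 = 1 / ((1 - m ^ 4) * (1 - m\<^sup>2)\<^sup>2)"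
  define B where "B = A1 * (1 / (m * (1 - m))\<^sup>2)"
  define r where "r = R - 1"
  have r1: "r > 1" using R_minus_1 by (simp add: r_def)
  have rm: "r < 1 / m" using R_minus_1 by (simp add: r_def)
  have m1: "1 / m > 1" using m_pos m_less_1 by simp
  have A1: "A1 > 0" unfolding A1_def using m4_less_1 m2_less_1 by simp
  have B: "B > 0" unfolding B_def using A1 m_pos m_less_1 by simp
  define C where "C = max B (B * r / (r - 1))"
  have "\<exists>\<alpha> E v c. decomposition C n (p n) \<alpha> E v c" for n
  proof -
    obtain c x where c: "p n = (\<Sum>j\<le>n. smult (c j) (faber' j))" "\<And>j. j < n \<Longrightarrow> bergman_ip (p n) (faber' j) = 0"
      "c n = of_real x" "x > 0" "cnj (c n) * bergman_ip (p n) (faber' n) = 1" "bergman_ip (p n) (p n) = 1"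
      using orthonormal_faber_expansion[OF orth, of n] by metis
    define G where "G w = (\<Sum>j\<le>n. c j * of_nat (j + 1) * w ^ j)" for w
    define \<alpha> where "\<alpha> t = G (W t) * W' t" for t
    define \<beta> where "\<beta> j t = of_nat (j + 1) * W t ^ j * W' t" for j t
    have mt: "of_real m * t \<noteq> 1" if "norm t < 1 / m" for t :: complex using mt_ne_1 that by blast
    have holW: "W holomorphic_on ball 0 (1 / m)" "W' holomorphic_on ball 0 (1 / m)"
      unfolding W_eq[abs_def] W'_def using mt by (intro holomorphic_intros; force)+
    have hol\<alpha>: "\<alpha> holomorphic_on ball 0 (1 / m)" unfolding \<alpha>_def G_def by (intro holomorphic_intros holW)
    have hol\<beta>: "\<beta> j holomorphic_on ball 0 (1 / m)" for j unfolding \<beta>_def by (intro holomorphic_intros holW)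
    define a where "a j = (deriv ^^ j) \<alpha> 0 / fact j" for j
    define b where "b k j = (deriv ^^ j) (\<beta> k) 0 / fact j" for k j
    have as: "(\<lambda>j. a j * t ^ j) sums \<alpha> t" if "norm t < 1 / m" for t
      using holomorphic_power_series[OF hol\<alpha>, of t] that by (simp add: a_def)
    have bs: "(\<lambda>j. b k j * t ^ j) sums \<beta> k t" if "norm t < 1 / m" for k t
      using holomorphic_power_series[OF hol\<beta>, of t] that by (simp add: b_def)
    have symm: "poly (p n) (Psi t) * Psi' t = \<alpha> t - (of_real m / t)\<^sup>2 * \<alpha> (flip t)"
      if t: "of_real m * t \<noteq> 1" "t \<noteq> 0" "t \<noteq> of_real m ^ 3" for t
    proof -
      have "poly (p n) (Psi t) * Psi' t = (\<Sum>j\<le>n. c j * (poly (faber' j) (Psi t) * Psi' t))"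
        unfolding c(1) poly_sum by (simp add: sum_distrib_right sum_distrib_left mult_ac)
      also have "\<dots> = (\<Sum>j\<le>n. c j * (\<beta> j t - (of_real m / t)\<^sup>2 * \<beta> j (flip t)))"
        unfolding poly_faber'[OF t] \<beta>_def ..
      also have "\<dots> = \<alpha> t - (of_real m / t)\<^sup>2 * \<alpha> (flip t)"
        unfolding \<alpha>_def G_def \<beta>_def
        by (simp only: right_diff_distrib sum_subtractf sum_distrib_right sum_distrib_left mult_ac)
      finally show ?thesis .
    qed
    have symm\<beta>: "poly (faber' j) (Psi t) * Psi' t = \<beta> j t - (of_real m / t)\<^sup>2 * \<beta> j (flip t)"
      if t: "of_real m * t \<noteq> 1" "t \<noteq> 0" "t \<noteq> of_real m ^ 3" for t j
      unfolding poly_faber'[OF t] \<beta>_def ..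
    have reg: "of_real m * t \<noteq> 1 \<and> t \<noteq> 0 \<and> t \<noteq> of_real m ^ 3" if "t \<in> annulus m 1" for t
      using annulus_regular annulus_m_1 that by blast
    \<comment> \<open>The two expansions in \<open>t\<close> give the size of \<open>\<alpha>\<close> and its products with the test functions.\<close>
    have gram1: "(\<lambda>i. a i * cnj (a i) * of_real ((1 - m ^ (4 * (i + 1))) / (i + 1))) sums 1"
      using gram_formula[OF m1 as as, of "p n" "p n"] symm reg c(6) unfolding bergman_ip_def by simp
    have gram2: "(\<lambda>i. a i * cnj (b j i) * of_real ((1 - m ^ (4 * (i + 1))) / (i + 1))) sums bergman_ip (p n) (faber' j)" for j
      unfolding bergman_ip_def by (rule gram_formula[OF m1 as bs]) (use symm symm\<beta> reg in auto)
    define F where "F t = \<alpha> t - of_real (m ^ 4) * \<alpha> (of_real (m ^ 4) * t)" for t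
    have Fs: "(\<lambda>i. (a i * of_real (1 - m ^ (4 * (i + 1)))) * t ^ i) sums F t" if "norm t < 1 / m" for t
    proof -
      have "norm (of_real (m ^ 4) * t) \<le> norm t"
        using m4_less_1 m_pos by (simp add: norm_mult norm_power mult_left_le_one_le)
      then have "norm (of_real (m ^ 4) * t) < 1 / m" using that by linarith
      from sums_diff[OF as[OF that] sums_mult[OF as[OF this]]]
      have "(\<lambda>i. a i * t ^ i - of_real (m ^ 4) * (a i * (of_real (m ^ 4) * t) ^ i)) sums F t"
        unfolding F_def by blast
      moreover have "a i * t ^ i - of_real (m ^ 4) * (a i * (of_real (m ^ 4) * t) ^ i)
         = (a i * of_real (1 - m ^ (4 * (i + 1)))) * t ^ i" for i
      proof -
        have "m ^ (4 * (i + 1)) = m ^ 4 * (m ^ 4) ^ i" by (simp add: power_add power_mult)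
        then show ?thesis by (simp add: power_mult_distrib algebra_simps)
      qed
      ultimately show ?thesis by simp
    qed
    have holF: "F holomorphic_on ball 0 (1 / m)"
    proof -
      have le: "m ^ 4 * norm t \<le> norm t" for t :: complex
        using m4_less_1 m_pos by (intro mult_left_le_one_le) auto
      have "(\<lambda>t. of_real (m ^ 4) * t) ` ball 0 (1 / m) \<subseteq> ball (0::complex) (1 / m)"
        using m_pos by (auto simp: norm_mult norm_power intro!: le_less_trans[OF le])
      then show ?thesis
        unfolding F_def
        by (intro holomorphic_intros hol\<alpha> holomorphic_on_compose_gen[OF _ hol\<alpha>, unfolded o_def])
    qed
    define V where "V w = F (W w) * W' w" for w
    define H where "H w = of_real (m ^ 4) * \<alpha> (of_real (m ^ 4) * W w) * W' w" for w
    have VG: "V w = G w - H w" if "norm w < 1 / m" for w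
    proof -
      have "\<alpha> (W w) * W' w = G w * (W' (W w) * W' w)" unfolding \<alpha>_def W_involution[OF mt[OF that]] by simp
      also have "\<dots> = G w" unfolding W'_W[OF mt[OF that]] by simp
      finally show ?thesis by (simp add: V_def F_def H_def algebra_simps)
    qed
    have small: "norm (of_real (m ^ 4) * W w) \<le> m\<^sup>2" if "norm w \<le> r" for w
    proof -
      have "norm (of_real (m ^ 4) * W w) \<le> m ^ 4 * (1 / m\<^sup>2)"
        using norm_W_le[of w] that m_pos unfolding norm_mult r_def by (intro mult_mono) (auto simp: norm_power)
      also have "m ^ 4 * (1 / m\<^sup>2) = m\<^sup>2" using m_pos by (simp add: power4_eq_xxxx power2_eq_square)
      finally show ?thesis .
    qed
    have holH: "H holomorphic_on cball 0 r"
    proof -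
      have sub: "cball 0 r \<subseteq> ball 0 (1 / m)" using rm by auto
      have "(\<lambda>w. \<alpha> (of_real (m ^ 4) * W w)) holomorphic_on cball 0 r"
      proof (rule holomorphic_on_compose_gen[OF _ hol\<alpha>, unfolded o_def])
        show "(\<lambda>w. of_real (m ^ 4) * W w) holomorphic_on cball 0 r"
          by (intro holomorphic_intros holomorphic_on_subset[OF holW(1) sub])
        show "(\<lambda>w. of_real (m ^ 4) * W w) ` cball 0 r \<subseteq> ball 0 (1 / m)"
        proof
          fix y assume "y \<in> (\<lambda>w. of_real (m ^ 4) * W w) ` cball 0 r"
          then have "norm y \<le> m\<^sup>2" using small by auto
          then show "y \<in> ball 0 (1 / m)" using m2_less_1 m1 by simp
        qed
      qed
      then show ?thesis unfolding H_def
        by (intro holomorphic_intros holomorphic_on_subset[OF holW(2) sub])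
    qed
    have Hb: "norm (H w) \<le> B" if "norm w \<le> r" for w
    proof -
      have "norm (\<alpha> (of_real (m ^ 4) * W w)) \<le> A1"
        unfolding A1_def by (rule analytic_part_bound[OF as m1 gram1 small[OF that]])
      moreover have "norm (W' w) \<le> 1 / (m * (1 - m))\<^sup>2" using norm_W'_le that by (simp add: r_def)
      ultimately have "norm (\<alpha> (of_real (m ^ 4) * W w)) * norm (W' w) \<le> B"
        unfolding B_def using A1 by (intro mult_mono) auto
      moreover have "norm (H w) = m ^ 4 * (norm (\<alpha> (of_real (m ^ 4) * W w)) * norm (W' w))"
        using m_pos by (simp add: H_def norm_mult norm_power)
      ultimately show ?thesis
        using m4_less_1 m_pos by (intro order_trans[OF _ \<open>_ \<le> B\<close>]) (auto simp: mult_left_le_one_le)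
    qed
    define h where "h k = (deriv ^^ k) H 0 / fact k" for k
    have holHb: "H holomorphic_on ball 0 r" by (rule holomorphic_on_subset[OF holH]) auto
    have hs: "(\<lambda>k. h k * w ^ k) sums H w" if "norm w < r" for w
      using holomorphic_power_series[OF holHb, of w] that by (simp add: h_def)
    have hk: "norm (h k) \<le> B * (1 / r) ^ k" for k
    proof -
      have "norm ((deriv ^^ k) H 0) \<le> fact k * B / r ^ k"
        by (rule Cauchy_inequality[OF holHb holomorphic_on_imp_continuous_on[OF holH]]) (use Hb r1 in auto)
      then have "norm (h k) \<le> fact k * B / r ^ k / fact k"
        unfolding h_def norm_divide norm_fact by (intro divide_right_mono) auto
      then show ?thesis by (simp add: power_divide)
    qed
    define g where "g k = (if k \<le> n then c k * of_nat (k + 1) else 0)" for k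
    have gs: "(\<lambda>k. g k * w ^ k) sums G w" for w
    proof -
      have "(\<lambda>k. g k * w ^ k) sums (\<Sum>k\<le>n. g k * w ^ k)"
        by (intro sums_finite) (auto simp: g_def)
      then show ?thesis by (simp add: G_def g_def)
    qed
    have Vs: "(\<lambda>k. (g k - h k) * w ^ k) sums V w" if "norm w < r" for w
      using sums_diff[OF gs hs[OF that], of w] VG[of w] that rm by (simp add: left_diff_distrib)
    \<comment> \<open>Conformal invariance of the Dirichlet product under \<open>W\<close>: in the coordinate \<open>w\<close> the test function is a monomial.\<close>
    have key: "bergman_ip (p n) (faber' j) = g j - h j" for j
    proof -
      define d where "d k = (if k = j then of_nat (j + 1) else 0 :: complex)" for k
      have ds: "(\<lambda>k. d k * w ^ k) sums (of_nat (j + 1) * w ^ j)" for w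
        using sums_finite[of "{j}" "\<lambda>k. d k * w ^ k"] by (simp add: d_def)
      have "(\<lambda>k. (g k - h k) * cnj (d k) / of_nat (k + 1)) sums
          (1 / of_real pi * (LINT w:ball 0 1|lborel. V w * cnj (of_nat (j + 1) * w ^ j)))"
        by (rule disc_inner_product_sums[OF r1 Vs ds])
      moreover have "(\<lambda>k. (g k - h k) * cnj (d k) / of_nat (k + 1)) sums (g j - h j)"
      proof -
        have "(g k - h k) * cnj (d k) / of_nat (k + 1) = (if k = j then g j - h j else 0)" for k
          by (simp add: d_def del: of_nat_Suc of_nat_add)
        then show ?thesis using sums_If_finite_set[of "{j}" "\<lambda>_. g j - h j"] by simp
      qed
      ultimately have 1: "g j - h j = 1 / of_real pi * (LINT w:ball 0 1|lborel. V w * cnj (of_nat (j + 1) * w ^ j))"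
        by (rule sums_unique2[symmetric])
      have "(\<lambda>i. (a i * of_real (1 - m ^ (4 * (i + 1)))) * cnj (b j i) / of_nat (i + 1)) sums
         (1 / of_real pi * (LINT t:ball 0 1|lborel. F t * cnj (\<beta> j t)))"
        by (rule disc_inner_product_sums[OF m1 Fs bs])
      then have "(\<lambda>i. a i * cnj (b j i) * of_real ((1 - m ^ (4 * (i + 1))) / (i + 1))) sums
         (1 / of_real pi * (LINT t:ball 0 1|lborel. F t * cnj (\<beta> j t)))"
        by (simp add: mult_ac)
      then have 2: "bergman_ip (p n) (faber' j) = 1 / of_real pi * (LINT t:ball 0 1|lborel. F t * cnj (\<beta> j t))"
        using gram2 sums_unique2 by blast
      have sub1: "ball 0 1 \<subseteq> ball (0::complex) (1 / m)" using m1 by auto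
      have im: "W ` ball 0 1 = ball 0 1"
      proof
        show "W ` ball 0 1 \<subseteq> ball 0 1" using norm_W_less_1_iff mt_ne_1' by (auto simp: less_imp_le)
        show "ball 0 1 \<subseteq> W ` ball 0 1"
        proof
          fix t :: complex assume "t \<in> ball 0 1"
          then show "t \<in> W ` ball 0 1"
            using norm_W_less_1_iff[of t] mt_ne_1'[of t] W_involution[of t]
            by (intro image_eqI[of _ _ "W t"]) auto
        qed
      qed
      have inj: "inj_on W (ball 0 1)"
        using W_inj mt_ne_1' by (intro inj_onI) (auto simp: less_imp_le)
      have contFb: "continuous_on (cball 0 1) (\<lambda>t. F t * cnj (\<beta> j t))"
        using m1 by (intro continuous_intros; intro continuous_on_subset[OF holomorphic_on_imp_continuous_on[OF holF]]
            continuous_on_subset[OF holomorphic_on_imp_continuous_on[OF hol\<beta>]]) auto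
      have "compact ((\<lambda>t. F t * cnj (\<beta> j t)) ` cball 0 1)" by (intro compact_continuous_image contFb) auto
      then have "bounded ((\<lambda>t. F t * cnj (\<beta> j t)) ` cball 0 1)" by (rule compact_imp_bounded)
      then obtain Bd where "\<forall>y\<in>(\<lambda>t. F t * cnj (\<beta> j t)) ` cball 0 1. norm y \<le> Bd"
        unfolding bounded_iff by blast
      then have Bd: "norm (F t * cnj (\<beta> j t)) \<le> Bd" if "t \<in> ball 0 1" for t
        using that by (auto simp del: norm_mult)
      have contFb': "continuous_on (ball 0 1) (\<lambda>t. F t * cnj (\<beta> j t))" using contFb by (rule continuous_on_subset) auto
      have si: "set_integrable lborel (ball 0 1) (\<lambda>t. F t * cnj (\<beta> j t))"
        by (rule set_integrable_bounded_continuous[OF _ _ contFb' Bd]) auto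
      have "(LINT t:W ` ball 0 1|lborel. F t * cnj (\<beta> j t)) =
         (LINT w:ball 0 1|lborel. (F (W w) * cnj (\<beta> j (W w))) * of_real ((norm (deriv W w))\<^sup>2))"
        by (rule holomorphic_change_of_variables(2)[OF holomorphic_on_subset[OF holW(1) sub1] open_ball inj])
          (use contFb' si im in simp_all)
      also have "\<dots> = (LINT w:ball 0 1|lborel. V w * cnj (of_nat (j + 1) * w ^ j))"
      proof (intro set_lebesgue_integral_cong allI impI)
        fix w :: complex assume "w \<in> ball 0 1"
        then have w: "of_real m * w \<noteq> 1" by (intro mt_ne_1') simp
        have "deriv W w = W' w" by (rule DERIV_imp_deriv[OF has_field_derivative_W[OF w]])
        then have "of_real ((norm (deriv W w))\<^sup>2) = W' w * cnj (W' w)" by (simp only: complex_norm_square)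
        moreover have "\<beta> j (W w) * W' w = of_nat (j + 1) * w ^ j * (W' (W w) * W' w)"
          unfolding \<beta>_def W_involution[OF w] by (simp only: mult_ac)
        then have "\<beta> j (W w) * W' w = of_nat (j + 1) * w ^ j" unfolding W'_W[OF w] by simp
        then have "cnj (\<beta> j (W w)) * cnj (W' w) = cnj (of_nat (j + 1) * w ^ j)" by (metis complex_cnj_mult)
        ultimately show "F (W w) * cnj (\<beta> j (W w)) * of_real ((norm (deriv W w))\<^sup>2) = V w * cnj (of_nat (j + 1) * w ^ j)"
          unfolding V_def by (simp only: mult_ac)
      qed simp
      finally show ?thesis unfolding 1 2 im by simp
    qed
    define v where "v = g n - h n"
    define E where "E w = V w - v * w ^ n" for w
    have Vlow: "g j - h j = 0" if "j < n" for j using key[of j] c(2)[OF that] by simp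
    have Ebound: "norm (E w) \<le> C * (norm w / (R - 1)) ^ (n + 1)" if "norm w \<le> 1" for w
    proof -
      \<comment> \<open>Above \<open>n\<close> only \<open>h\<close> contributes.\<close>
      define e where "e k = (if k \<le> n then 0 else g k - h k)" for k
      have "(\<lambda>k. e k * w ^ k) sums E w"
      proof -
        have "(\<lambda>k. (if k = n then v * w ^ n else 0)) sums (v * w ^ n)"
          using sums_If_finite_set[of "{n}" "\<lambda>_. v * w ^ n"] by simp
        from sums_diff[OF Vs this]
        have "(\<lambda>k. (g k - h k) * w ^ k - (if k = n then v * w ^ n else 0)) sums E w"
          using that r1 unfolding E_def by auto
        moreover have "(g k - h k) * w ^ k - (if k = n then v * w ^ n else 0) = e k * w ^ k" for k
          using Vlow[of k] by (auto simp: e_def v_def)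
        ultimately show ?thesis by simp
      qed
      moreover have "norm (e k) \<le> B * (1 / r) ^ k" for k
        using hk[of k] B r1 by (auto simp: e_def g_def)
      ultimately have "norm (E w) \<le> B * r / (r - 1) * (norm w / r) ^ (n + 1)"
        using r1 that by (intro suminf_geometric_tail_bound[of e B r w]) (auto simp: e_def)
      also have "\<dots> \<le> C * (norm w / r) ^ (n + 1)"
        using r1 by (intro mult_right_mono) (auto simp: C_def)
      finally show ?thesis by (simp add: r_def)
    qed
    have "decomposition C n (p n) \<alpha> E v x"
      unfolding decomposition_def
    proof (intro conjI allI impI hol\<alpha> c(4) Ebound)
      fix t :: complex assume t: "norm t < 1"
      then have mt1: "of_real m * t \<noteq> 1" by (intro mt_ne_1') simp
      have "V (W t) * W' t = F t * (W' (W t) * W' t)" unfolding V_def W_involution[OF mt1] by simp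
      then have "V (W t) * W' t = F t" unfolding W'_W[OF mt1] by simp
      then show "\<alpha> t - of_real (m ^ 4) * \<alpha> (of_real (m ^ 4) * t) = (v * W t ^ n + E (W t)) * W' t"
        by (simp add: E_def F_def)
    next
      show "of_real x * v = 1" using c(3,5) key[of n] by (simp add: v_def)
      have "v - of_real (real (n + 1) * x) = - h n" using c(3) by (simp add: v_def g_def algebra_simps)
      then have "norm (v - of_real (real (n + 1) * x)) = norm (h n)" by (simp only: norm_minus_cancel)
      also have "\<dots> \<le> B * (1 / r) ^ n" by (rule hk)
      also have "\<dots> \<le> C * (1 / r) ^ n" using r1 by (intro mult_right_mono) (auto simp: C_def)
      finally show "norm (v - of_real (real (n + 1) * x)) \<le> C * (1 / (R - 1)) ^ n" by (simp add: r_def)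
    qed (use symm in blast)
    then show ?thesis by blast
  qed
  then show ?thesis by blast
qed

end

section \<open>The function \<open>\<chi>\<close>\<close>

text \<open>Compare \<open>exp (\<delta> y)\<close> with a single term of its series.\<close>
lemma power_exp_bound:
  fixes y \<delta> :: real
  assumes "y \<ge> 0" "\<delta> > 0"
  shows "y ^ k * exp (- \<delta> * y) \<le> fact k / \<delta> ^ k"
proof -
  have "(\<delta> * y) ^ k / fact k \<le> exp (\<delta> * y)"
  proof -
    have s: "(\<lambda>j. (\<delta> * y) ^ j / fact j) sums exp (\<delta> * y)"
      using exp_converges[of "\<delta> * y"] by (simp add: scaleR_conv_of_real divide_inverse mult.commute)
    have "sum (\<lambda>j. (\<delta> * y) ^ j / fact j) {k} \<le> suminf (\<lambda>j. (\<delta> * y) ^ j / fact j)"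
      using s assms by (intro sum_le_suminf) (auto simp: sums_iff)
    then show ?thesis using s by (simp add: sums_iff)
  qed
  then have "y ^ k * \<delta> ^ k \<le> fact k * exp (\<delta> * y)"
    by (simp add: power_mult_distrib divide_le_eq mult.commute)
  then show ?thesis using assms by (simp add: exp_minus field_simps)
qed

context joukowski_disc
begin

definition \<kappa> :: real where "\<kappa> = 1 / m - m"

lemma \<kappa>_pos: "\<kappa> > 0"
proof -
  have "1 / m > 1" using m_pos m_less_1 by simp
  then show ?thesis using m_less_1 by (simp add: \<kappa>_def)
qed

text \<open>With \<open>y = m^(4k)\<close> this is the \<open>k\<close>-th summand of \<open>\<chi>(t) / t\<close>.\<close>
definition chi_term :: "real \<Rightarrow> complex \<Rightarrow> complex" where
  "chi_term y t = of_real y * exp (- of_real (\<kappa> * y) * t)"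

lemma norm_chi_term: "y \<ge> 0 \<Longrightarrow> norm (chi_term y t) = y * exp (- (\<kappa> * Re t) * y)"
  by (simp add: chi_term_def norm_mult norm_exp_eq_Re mult_ac)

text \<open>The dilation factors of the orbit of \<open>t\<close> under \<open>t \<mapsto> m^4 t\<close>.\<close>
definition dil :: "nat \<Rightarrow> real" where "dil k = (m ^ 4) ^ k"

lemma dil_pos: "0 < dil k" and dil_le_1: "dil k \<le> 1"
  using m_pos m4_less_1 by (auto simp: dil_def intro: power_le_one)

lemma dil_Suc: "dil (Suc k) = m ^ 4 * dil k"
  by (simp add: dil_def)

lemma summable_dil: "summable dil"
  unfolding dil_def[abs_def] using m_pos m4_less_1 by (intro summable_geometric) auto

lemma norm_chi_term_pos: 
  assumes "Re t \<ge> 0" shows "norm (chi_term (dil k) t) \<le> dil k"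
proof -
  have "0 \<le> \<kappa> * Re t * dil k" using assms \<kappa>_pos dil_pos[of k] by (intro mult_nonneg_nonneg) auto
  then show ?thesis using dil_pos[of k] by (simp add: norm_chi_term less_imp_le mult_left_le)
qed

text \<open>The large frequencies are damped faster than any power; the second power suffices to beat the growing coefficient.\<close>
lemma norm_chi_term_neg:
  assumes "\<delta> > 0" "Re t \<ge> \<delta>" 
  shows "norm (chi_term (1 / dil (Suc k)) t) \<le> 2 / (\<kappa> * \<delta>)\<^sup>2 * dil (Suc k)"
proof -
  define z where "z = 1 / dil (Suc k)"
  have z: "z > 0" using dil_pos by (simp add: z_def)
  have "\<kappa> * \<delta> * z \<le> \<kappa> * Re t * z" using assms \<kappa>_pos z by (intro mult_right_mono mult_left_mono) auto
  then have "z\<^sup>2 * exp (- (\<kappa> * Re t) * z) \<le> z\<^sup>2 * exp (- (\<kappa> * \<delta>) * z)" by (intro mult_left_mono) auto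
  also have "\<dots> \<le> 2 / (\<kappa> * \<delta>)\<^sup>2"
    using power_exp_bound[of z "\<kappa> * \<delta>" 2] z assms \<kappa>_pos by simp
  finally have "z * (z * exp (- (\<kappa> * Re t) * z)) \<le> 2 / (\<kappa> * \<delta>)\<^sup>2" by (simp add: power2_eq_square mult_ac)
  then have "z * exp (- (\<kappa> * Re t) * z) \<le> 2 / (\<kappa> * \<delta>)\<^sup>2 / z"
    by (subst pos_le_divide_eq[OF z]) (simp only: mult_ac)
  moreover have "norm (chi_term z t) = z * exp (- (\<kappa> * Re t) * z)" using z by (simp add: norm_chi_term)
  ultimately show ?thesis by (simp add: z_def)
qed

definition chi_pos :: "complex \<Rightarrow> complex" where "chi_pos t = (\<Sum>k. chi_term (dil k) t)"
definition chi_neg :: "complex \<Rightarrow> complex" where "chi_neg t = (\<Sum>k. chi_term (1 / dil (Suc k)) t)"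

lemma summable_chi_pos: "Re t \<ge> 0 \<Longrightarrow> summable (\<lambda>k. norm (chi_term (dil k) t))"
  by (rule summable_comparison_test'[OF summable_dil, of 0]) (simp add: norm_chi_term_pos)

lemma summable_chi_neg: "Re t > 0 \<Longrightarrow> summable (\<lambda>k. norm (chi_term (1 / dil (Suc k)) t))"
proof (rule summable_comparison_test'[of "\<lambda>k. 2 / (\<kappa> * Re t)\<^sup>2 * dil (Suc k)" 0])
  show "summable (\<lambda>k. 2 / (\<kappa> * Re t)\<^sup>2 * dil (Suc k))"
    by (intro summable_mult summable_Suc_iff[THEN iffD2] summable_dil)
  show "norm (norm (chi_term (1 / dil (Suc k)) t)) \<le> 2 / (\<kappa> * Re t)\<^sup>2 * dil (Suc k)" if "Re t > 0" for k
    unfolding real_norm_def abs_norm_cancel by (rule norm_chi_term_neg[OF that order_refl])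
qed

lemma chi_summand: "of_real (mu R powi (4 * k)) * exp (of_real ((mu R - 1 / mu R) * mu R powi (4 * k)) * t)
    = chi_term (m powi (4 * k)) t"
  by (simp add: chi_term_def \<kappa>_def m_def left_diff_distrib)

lemma powi_dil: "m powi (4 * int k) = dil k" "m powi (4 * (- 1 - int k)) = 1 / dil (Suc k)"
proof -
  show "m powi (4 * int k) = dil k"
    unfolding dil_def power_mult[symmetric] by (metis of_nat_mult of_nat_numeral power_int_of_nat)
  have "4 * (- 1 - int k) = - (int (4 * Suc k))" by simp
  then have "m powi (4 * (- 1 - int k)) = inverse (m ^ (4 * Suc k))"
    by (simp only: power_int_minus power_int_of_nat)
  then show "m powi (4 * (- 1 - int k)) = 1 / dil (Suc k)"
    unfolding dil_def power_mult[symmetric] by (simp add: inverse_eq_divide)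
qed

lemma chi_has_sum:
  assumes "Re t > 0"
  shows "((\<lambda>k::int. chi_term (m powi (4 * k)) t) has_sum (chi_pos t + chi_neg t)) UNIV"
proof -
  have i1: "inj_on (\<lambda>k::nat. int k) UNIV" "inj_on (\<lambda>k::nat. - 1 - int k) UNIV" by (auto intro: inj_onI)
  have "((\<lambda>k. chi_term (dil k) t) has_sum chi_pos t) UNIV"
    unfolding chi_pos_def using summable_chi_pos[of t] assms
    by (intro norm_summable_imp_has_sum summable_sums) (auto dest: summable_norm_cancel)
  then have 1: "((\<lambda>k::int. chi_term (m powi (4 * k)) t) has_sum chi_pos t) (range int)"
    using has_sum_reindex[OF i1(1), of "\<lambda>k::int. chi_term (m powi (4 * k)) t"] unfolding o_def powi_dil by simp
  have "((\<lambda>k. chi_term (1 / dil (Suc k)) t) has_sum chi_neg t) UNIV"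
    unfolding chi_neg_def using summable_chi_neg[of t] assms
    by (intro norm_summable_imp_has_sum summable_sums) (auto dest: summable_norm_cancel)
  then have 2: "((\<lambda>k::int. chi_term (m powi (4 * k)) t) has_sum chi_neg t) (range (\<lambda>k. - 1 - int k))"
    using has_sum_reindex[OF i1(2), of "\<lambda>k::int. chi_term (m powi (4 * k)) t"] unfolding o_def powi_dil by simp
  have u: "range int \<union> range (\<lambda>k. - 1 - int k) = UNIV"
  proof -
    have "j \<in> range int \<union> range (\<lambda>k. - 1 - int k)" for j
    proof (cases "j \<ge> 0")
      case True
      then have "j = int (nat j)" by simp
      then show ?thesis by blast
    next
      case False
      then have "j = - 1 - int (nat (- 1 - j))" by simp
      then show ?thesis by blast
    qed
    then show ?thesis by blast
  qed
  have "int a \<noteq> - 1 - int b" for a b by linarith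
  then have "range int \<inter> range (\<lambda>k. - 1 - int k) = {}" by blast
  from has_sum_Un_disjoint[OF 1 2 this] show ?thesis unfolding u .
qed

lemma chi_eq: "Re t > 0 \<Longrightarrow> chi R t = t * (chi_pos t + chi_neg t)"
  unfolding chi_def chi_summand by (simp add: infsumI[OF chi_has_sum])

lemma holomorphic_suminf_Weierstrass:
  fixes f :: "nat \<Rightarrow> complex \<Rightarrow> complex"
  assumes "open S" and f: "\<And>k. f k holomorphic_on S"
    and bd: "\<And>t. t \<in> S \<Longrightarrow> \<exists>d M. d > 0 \<and> cball t d \<subseteq> S \<and> summable M \<and> (\<forall>k. \<forall>s\<in>cball t d. norm (f k s) \<le> M k)"
  shows "(\<lambda>t. \<Sum>k. f k t) holomorphic_on S"
proof (rule holomorphic_uniform_sequence[OF \<open>open S\<close>])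
  show "(\<lambda>t. \<Sum>k<n. f k t) holomorphic_on S" for n by (intro holomorphic_intros f)
  show "\<exists>d>0. cball t d \<subseteq> S \<and> uniform_limit (cball t d) (\<lambda>n t. \<Sum>k<n. f k t) (\<lambda>t. \<Sum>k. f k t) sequentially"
    if "t \<in> S" for t
    using bd[OF that] Weierstrass_m_test by metis
qed

lemma half_plane_cball:
  assumes "s \<in> cball t (Re t / 2)" "Re t > 0"
  shows "Re s \<ge> Re t / 2"
  using assms abs_Re_le_cmod[of "t - s"] by (auto simp: dist_norm)

lemma chi_holomorphic: "chi R holomorphic_on {t. Re t > 0}"
proof -
  have op: "open {t. Re t > 0}" by (intro open_Collect_less continuous_intros)
  have h: "chi_term y holomorphic_on S" for y S
    unfolding chi_term_def by (intro holomorphic_intros)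
  have "chi_pos holomorphic_on {t. Re t > 0}"
    unfolding chi_pos_def[abs_def]
  proof (rule holomorphic_suminf_Weierstrass[OF op h])
    fix t assume "t \<in> {t. Re t > 0}"
    then show "\<exists>d M. d > 0 \<and> cball t d \<subseteq> {t. Re t > 0} \<and> summable M \<and> (\<forall>k. \<forall>s\<in>cball t d. norm (chi_term (dil k) s) \<le> M k)"
      using half_plane_cball[of _ t] summable_dil
      by (intro exI[of _ "Re t / 2"] exI[of _ dil]) (force intro!: norm_chi_term_pos)
  qed
  moreover have "chi_neg holomorphic_on {t. Re t > 0}"
    unfolding chi_neg_def[abs_def]
  proof (rule holomorphic_suminf_Weierstrass[OF op h])
    fix t assume "t \<in> {t. Re t > 0}"
    then have t: "Re t / 2 > 0" by simp
    show "\<exists>d M. d > 0 \<and> cball t d \<subseteq> {t. Re t > 0} \<and> summable M \<and> (\<forall>k. \<forall>s\<in>cball t d. norm (chi_term (1 / dil (Suc k)) s) \<le> M k)"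
    proof (intro exI conjI allI ballI)
      show "summable (\<lambda>k. 2 / (\<kappa> * (Re t / 2))\<^sup>2 * dil (Suc k))"
        by (intro summable_mult summable_Suc_iff[THEN iffD2] summable_dil)
      show "cball t (Re t / 2) \<subseteq> {t. Re t > 0}" using half_plane_cball[of _ t] t by force
      show "norm (chi_term (1 / dil (Suc k)) s) \<le> 2 / (\<kappa> * (Re t / 2))\<^sup>2 * dil (Suc k)" if "s \<in> cball t (Re t / 2)" for k s
        using half_plane_cball[OF that] t by (intro norm_chi_term_neg) auto
    qed (rule t)
  qed
  ultimately have "(\<lambda>t. t * (chi_pos t + chi_neg t)) holomorphic_on {t. Re t > 0}"
    by (intro holomorphic_intros)
  then show ?thesis by (rule holomorphic_transform) (simp add: chi_eq)
qed

text \<open>The factor \<open>m^(4j)\<close> in the argument shifts the index of summation.\<close>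
lemma chi_periodic: "chi R (of_real (m powi (4 * j)) * t) = chi R t"
proof -
  have mp: "m powi (4 * k) * m powi (4 * j) = m powi (4 * (k + j))" for k
    using m_pos by (simp add: power_int_add[symmetric] distrib_left)
  have "chi_term (m powi (4 * k)) (of_real (m powi (4 * j)) * t) * of_real (m powi (4 * j)) = chi_term (m powi (4 * (k + j))) t" for k
    unfolding chi_term_def mp[symmetric] by (simp add: mult_ac)
  then have "(\<Sum>\<^sub>\<infinity>k\<in>UNIV. chi_term (m powi (4 * k)) (of_real (m powi (4 * j)) * t) * of_real (m powi (4 * j)))
     = (\<Sum>\<^sub>\<infinity>k\<in>UNIV. chi_term (m powi (4 * (k + j))) t)" by simp
  also have "\<dots> = (\<Sum>\<^sub>\<infinity>k\<in>UNIV. chi_term (m powi (4 * k)) t)"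
    by (rule infsum_reindex_bij_betw[where f = "\<lambda>k. chi_term (m powi (4 * k)) t"])
      (rule bij_betwI[of _ _ _ "\<lambda>k. k - j"]; simp)
  finally have "(\<Sum>\<^sub>\<infinity>k\<in>UNIV. chi_term (m powi (4 * k)) (of_real (m powi (4 * j)) * t)) * of_real (m powi (4 * j))
     = (\<Sum>\<^sub>\<infinity>k\<in>UNIV. chi_term (m powi (4 * k)) t)"
    by (simp add: infsum_cmult_left')
  then have S: "(\<Sum>\<^sub>\<infinity>k\<in>UNIV. chi_term (m powi (4 * k)) t) =
     (\<Sum>\<^sub>\<infinity>k\<in>UNIV. chi_term (m powi (4 * k)) (of_real (m powi (4 * j)) * t)) * of_real (m powi (4 * j))"
    by (rule sym)
  show ?thesis
    unfolding chi_def chi_summand S by (simp only: mult_ac)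
qed

text \<open>Reduce \<open>ln s / ln (m^4)\<close> modulo \<open>1\<close>.\<close>
lemma log_period_decomposition:
  assumes "s > 0"
  obtains j :: int and s' where "s = m powi (4 * j) * s'" "m ^ 4 \<le> s'" "s' \<le> 1"
proof -
  define L where "L = ln s / ln (m ^ 4)"
  have ln4: "ln (m ^ 4) < 0" using m4_less_1 m_pos by simp
  have "s = exp (L * ln (m ^ 4))" using assms ln4 by (simp add: L_def)
  also have "L * ln (m ^ 4) = of_int \<lfloor>L\<rfloor> * ln (m ^ 4) + (L - of_int \<lfloor>L\<rfloor>) * ln (m ^ 4)" by (simp add: algebra_simps)
  finally have s: "s = exp (of_int \<lfloor>L\<rfloor> * ln (m ^ 4)) * exp ((L - of_int \<lfloor>L\<rfloor>) * ln (m ^ 4))" by (simp add: exp_add)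
  have "exp (of_int \<lfloor>L\<rfloor> * ln (m ^ 4)) = exp (ln (m ^ 4)) powi \<lfloor>L\<rfloor>"
    by (rule exp_power_int[symmetric])
  also have "\<dots> = m powi (4 * \<lfloor>L\<rfloor>)" using m_pos by (simp add: power_int_mult)
  finally have 1: "s = m powi (4 * \<lfloor>L\<rfloor>) * exp ((L - of_int \<lfloor>L\<rfloor>) * ln (m ^ 4))" using s by simp
  have f: "0 \<le> L - of_int \<lfloor>L\<rfloor>" "L - of_int \<lfloor>L\<rfloor> \<le> 1" by linarith+
  have "exp ((L - of_int \<lfloor>L\<rfloor>) * ln (m ^ 4)) \<le> 1" using f ln4 by (simp add: mult_nonneg_nonpos)
  moreover have "exp (1 * ln (m ^ 4)) \<le> exp ((L - of_int \<lfloor>L\<rfloor>) * ln (m ^ 4))"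
    using f ln4 by (subst exp_le_cancel_iff) (intro mult_right_mono_neg; simp)
  ultimately show ?thesis using that[OF 1] m_pos by simp
qed

text \<open>By periodicity only the scales \<open>s\<close> in \<open>[m^4, 1]\<close> matter, which leaves a compact set of arguments.\<close>
lemma chi_bounded_on_rays:
  assumes K: "compact K" "K \<subseteq> {t. Re t > 0}"
  shows "\<exists>B. \<forall>t\<in>K. \<forall>s>0. norm (chi R (of_real s * t)) \<le> B"
proof -
  define T where "T = (\<lambda>(s, t). of_real s * t) ` ({m ^ 4..1} \<times> K)"
  have "compact T" unfolding T_def
    by (intro compact_continuous_image compact_Times K) (auto intro!: continuous_intros simp: case_prod_unfold)
  have m4: "0 < m ^ 4" using m_pos by simp
  have "T \<subseteq> {t. Re t > 0}"
  proof
    fix z assume "z \<in> T"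
    then obtain s t where "z = of_real s * t" "m ^ 4 \<le> s" "t \<in> K" unfolding T_def by auto
    then show "z \<in> {t. Re t > 0}" using K(2) less_le_trans[OF m4, of s] by auto
  qed
  then have "compact (chi R ` T)"
    using \<open>compact T\<close> holomorphic_on_imp_continuous_on[OF chi_holomorphic]
    by (intro compact_continuous_image) (auto intro: continuous_on_subset)
  then have "bounded (chi R ` T)" by (rule compact_imp_bounded)
  then obtain B where B: "\<forall>z\<in>chi R ` T. norm z \<le> B" unfolding bounded_iff by blast
  have "norm (chi R (of_real s * t)) \<le> B" if "t \<in> K" "s > 0" for s t
  proof -
    obtain j s' where s: "s = m powi (4 * j) * s'" "m ^ 4 \<le> s'" "s' \<le> 1"
      using log_period_decomposition[OF \<open>s > 0\<close>] by metis
    have "chi R (of_real s * t) = chi R (of_real s' * t)"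
      unfolding s(1) of_real_mult mult.assoc by (rule chi_periodic)
    moreover have "of_real s' * t \<in> T" unfolding T_def using s that by force
    ultimately show ?thesis using B by auto
  qed
  then show ?thesis by blast
qed

end

section \<open>Orbit sums and \<open>\<chi>\<close>\<close>

text \<open>The factor \<open>sqrt y\<close>, at \<open>y = n m^(4k)\<close>, makes the bounds summable over \<open>k\<close>. Divided by \<open>n\<close>, it still leaves a gain of
  \<open>n powr (-1/2)\<close>.\<close>
lemma cubic_exp_bound:
  fixes \<delta> :: real
  assumes "\<delta> > 0"
  shows "\<exists>C\<ge>0. \<forall>y\<ge>0. (y ^ 3 + y\<^sup>2) * exp (- \<delta> * y) \<le> C * sqrt y"
proof (intro exI conjI allI impI)
  define C where "C = 1 / \<delta> + 2 * (2 / \<delta>\<^sup>2) + 6 / \<delta> ^ 3"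
  show "0 \<le> C" using assms by (simp add: C_def)
  fix y :: real assume y: "y \<ge> 0"
  define s where "s = sqrt y"
  have s: "s * s = y" "s \<ge> 0" using y by (simp_all add: s_def)
  have "s \<le> 1 + y"
  proof -
    have "0 \<le> (s - 1)\<^sup>2" by simp
    then show ?thesis using s by (simp add: power2_eq_square algebra_simps)
  qed
  then have "s * (s * (y\<^sup>2 + y)) \<le> s * ((1 + y) * (y\<^sup>2 + y))"
    using s y by (intro mult_left_mono mult_right_mono) auto
  moreover have "y ^ 3 + y\<^sup>2 = (s * s) * (y\<^sup>2 + y)" using s by (simp add: power2_eq_square power3_eq_cube algebra_simps)
  ultimately have "y ^ 3 + y\<^sup>2 \<le> s * (y + 2 * y\<^sup>2 + y ^ 3)"
    by (simp add: power2_eq_square power3_eq_cube algebra_simps)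
  then have "(y ^ 3 + y\<^sup>2) * exp (- \<delta> * y) \<le> s * (y + 2 * y\<^sup>2 + y ^ 3) * exp (- \<delta> * y)"
    by (intro mult_right_mono) auto
  also have "\<dots> = s * (y ^ 1 * exp (- \<delta> * y) + 2 * (y ^ 2 * exp (- \<delta> * y)) + y ^ 3 * exp (- \<delta> * y))"
    by (simp add: algebra_simps)
  also have "\<dots> \<le> s * (fact 1 / \<delta> ^ 1 + 2 * (fact 2 / \<delta> ^ 2) + fact 3 / \<delta> ^ 3)"
    using s(2) by (intro mult_left_mono add_mono power_exp_bound[OF y assms]) auto
  also have "\<dots> = C * sqrt y" by (simp add: C_def s_def fact_numeral mult.commute)
  finally show "(y ^ 3 + y\<^sup>2) * exp (- \<delta> * y) \<le> C * sqrt y" .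
qed

lemma norm_power_diff_le:
  fixes a b :: complex
  assumes "norm a \<le> M" "norm b \<le> M" "M > 0"
  shows "norm (a ^ n - b ^ n) \<le> real n * M ^ n / M * norm (a - b)"
proof -
  have 1: "norm (a / of_real M) \<le> 1" "norm (b / of_real M) \<le> 1" using assms by (auto simp: norm_divide)
  have "a ^ n - b ^ n = of_real M ^ n * ((a / of_real M) ^ n - (b / of_real M) ^ n)"
    using assms by (simp add: power_divide right_diff_distrib)
  then have "norm (a ^ n - b ^ n) = M ^ n * norm ((a / of_real M) ^ n - (b / of_real M) ^ n)"
    using assms by (simp add: norm_mult norm_power)
  also have "\<dots> \<le> M ^ n * (real n * norm (a / of_real M - b / of_real M))"
    using assms by (intro mult_left_mono norm_power_diff 1) auto
  also have "norm (a / of_real M - b / of_real M) = norm (a - b) / M"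
    using assms by (simp add: diff_divide_distrib[symmetric] norm_divide)
  finally show ?thesis by (simp add: mult_ac)
qed

lemma norm_exp_minus_linear:
  fixes z :: complex
  shows "norm (exp z - (1 + z)) \<le> exp (norm z) * (norm z)\<^sup>2"
proof -
  have "norm (exp z - (\<Sum>k\<le>1. z ^ k / fact k)) \<le> exp \<bar>Re z\<bar> * norm z ^ Suc 1 / fact 1"
    by (rule Taylor_exp)
  also have "\<dots> \<le> exp (norm z) * (norm z)\<^sup>2"
    by (simp add: power2_eq_square mult_right_mono abs_Re_le_cmod)
  finally show ?thesis by simp
qed

context joukowski_disc
begin

text \<open>The disc tangent to the imaginary axis at the fixed point \<open>0\<close> of the dilations, which map it into itself. The map \<open>W\<close>
  sends it to \<open>\<bar>w\<bar> < m\<close>.\<close>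
definition horodisc :: "complex set" where
  "horodisc = {t. norm (t - 1 / of_real R) < 1 / R}"

lemma horodisc_iff: "t \<in> horodisc \<longleftrightarrow> R * (norm t)\<^sup>2 < 2 * Re t"
proof -
  have R0: "R > 0" using R_gt_2 by simp
  have "t \<in> horodisc \<longleftrightarrow> (norm (t - of_real (1 / R)))\<^sup>2 < (1 / R)\<^sup>2"
    unfolding horodisc_def using R0 by (simp add: abs_le_square_iff[symmetric] flip: not_le)
  also have "\<dots> \<longleftrightarrow> (norm t)\<^sup>2 < 2 * Re t / R"
    unfolding norm_diff_square by (simp add: norm_divide power_divide)
  also have "\<dots> \<longleftrightarrow> R * (norm t)\<^sup>2 < 2 * Re t" using R0 by (simp add: field_simps)
  finally show ?thesis .
qed

lemma horodisc_Re: "t \<in> horodisc \<Longrightarrow> Re t > 0"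
proof -
  assume "t \<in> horodisc"
  moreover have "0 \<le> R * (norm t)\<^sup>2" using R_gt_2 by simp
  ultimately show "Re t > 0" by (simp add: horodisc_iff)
qed

lemma horodisc_norm: assumes "t \<in> horodisc" shows "norm t < 2 / R" "norm t < 1"
proof -
  have R0: "R > 0" using R_gt_2 by simp
  have "t \<noteq> 0" using horodisc_Re[OF assms] by auto
  have "R * norm t * norm t < 2 * norm t"
    using assms complex_Re_le_cmod[of t] by (simp add: horodisc_iff power2_eq_square mult.assoc)
  then have "R * norm t < 2" using \<open>t \<noteq> 0\<close> by simp
  then show *: "norm t < 2 / R" using R0 by (simp add: field_simps)
  have "2 / R < 1" using R_gt_2 by simp
  then show "norm t < 1" using * by linarith
qed

text \<open>The normalization makes \<open>\<rho>(0) = 1\<close> and \<open>\<rho>'(0) = -\<kappa>\<close>.\<close>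
definition rho :: "complex \<Rightarrow> complex" where "rho s = W s / of_real m"

abbreviation orbit_kernel :: "nat \<Rightarrow> complex \<Rightarrow> complex" where
  "orbit_kernel n s \<equiv> rho s ^ n / (1 - of_real m * s)\<^sup>2"

lemma rho_eq: "of_real m * s \<noteq> 1 \<Longrightarrow> rho s = (1 - s / of_real m) / (1 - of_real m * s)"
proof -
  assume "of_real m * s \<noteq> 1"
  then have "of_real m * s - 1 \<noteq> 0" "1 - of_real m * s \<noteq> 0" "complex_of_real m \<noteq> 0" using m_pos by auto
  then show ?thesis unfolding rho_def W_eq by (simp add: divide_simps) (simp add: algebra_simps)
qed

lemma norm_one_minus_ge:
  fixes s :: complex
  assumes "norm s \<le> 1"
  shows "norm (1 - of_real m * s) \<ge> 1 - m" 
proof -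
  have "norm (1 :: complex) - norm (of_real m * s) \<le> norm (1 - of_real m * s)" by (rule norm_triangle_ineq2)
  moreover have "m * norm s \<le> m" using assms m_pos by (simp add: mult_left_le)
  moreover have "norm (of_real m * s) = m * norm s" using m_pos by (simp add: norm_mult)
  ultimately show ?thesis unfolding norm_one by linarith
qed

text \<open>The difference \<open>\<bar>1 - m s\<bar>\<^sup>2 - \<bar>1 - s / m\<bar>\<^sup>2\<close> at \<open>s = x t\<close> is \<open>\<kappa> x (2 Re t - R x \<bar>t\<bar>\<^sup>2)\<close>, and \<open>R \<bar>t\<bar>\<^sup>2 < 2 Re t\<close> is the
  equation of the disc.\<close>
lemma norm_rho_le:
  assumes K: "compact K" "K \<subseteq> horodisc"
  shows "\<exists>\<delta>>0. \<forall>t\<in>K. \<forall>x\<in>{0..1}. norm (rho (of_real x * t)) \<le> exp (- \<delta> * x) \<and> \<delta> \<le> \<kappa> * Re t"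
proof (cases "K = {}")
  case False
  have cont: "continuous_on K (\<lambda>t. 2 * Re t - R * (norm t)\<^sup>2)" by (intro continuous_intros)
  obtain t0 where t0: "t0 \<in> K" "\<And>t. t \<in> K \<Longrightarrow> 2 * Re t0 - R * (norm t0)\<^sup>2 \<le> 2 * Re t - R * (norm t)\<^sup>2"
    using continuous_attains_inf[OF K(1) False cont] by blast
  define d where "d = 2 * Re t0 - R * (norm t0)\<^sup>2"
  have d: "d > 0" using t0(1) K(2) horodisc_iff unfolding d_def by auto
  define \<delta> where "\<delta> = \<kappa> * d / 8"
  have "\<delta> > 0" using d \<kappa>_pos by (simp add: \<delta>_def)
  moreover have "norm (rho (of_real x * t)) \<le> exp (- \<delta> * x) \<and> \<delta> \<le> \<kappa> * Re t" if t: "t \<in> K" and x: "x \<in> {0..1}" for t x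
  proof
    define s where "s = of_real x * t"
    have tHD: "t \<in> horodisc" using K t by auto
    have dt: "d \<le> 2 * Re t - R * (norm t)\<^sup>2" using t0(2)[OF t] by (simp add: d_def)
    have s1: "norm s \<le> 1" using horodisc_norm(2)[OF tHD] x unfolding s_def norm_mult
      by (intro mult_le_one) auto
    then have ms: "of_real m * s \<noteq> 1" by (rule mt_ne_1')
    have up: "norm (1 - of_real m * s) \<le> 2"
    proof -
      have "norm (1 - of_real m * s) \<le> norm (1 :: complex) + norm (of_real m * s)" by (rule norm_triangle_ineq4)
      moreover have "m * norm s \<le> 1" using s1 m_pos m_less_1 by (intro mult_le_one) auto
      ultimately show ?thesis using m_pos by (simp add: norm_mult)
    qed
    have pos: "norm (1 - of_real m * s) > 0" using ms by simp
    define N where "N = (norm (1 - of_real m * s))\<^sup>2"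
    have N: "0 < N" "N \<le> 4" using pos up power_mono[OF up, of 2] by (simp_all add: N_def)
    have "N - (norm (1 - s / of_real m))\<^sup>2 = 2 * Re s * \<kappa> - (norm s)\<^sup>2 * (\<kappa> * R)"
    proof -
      have RR: "\<kappa> * R = 1 / m\<^sup>2 - m\<^sup>2"
        unfolding \<kappa>_def using m_pos by (subst R_eq) (simp add: field_simps power2_eq_square)
      have "(norm (1 - s / of_real m))\<^sup>2 = 1 - 2 * Re s / m + (norm s)\<^sup>2 / m\<^sup>2"
        unfolding norm_diff_square using m_pos by (simp add: norm_divide power_divide)
      moreover have "N = 1 - 2 * m * Re s + m\<^sup>2 * (norm s)\<^sup>2"
        unfolding N_def norm_diff_square by (simp add: norm_mult power_mult_distrib)
      ultimately show ?thesis unfolding RR by (simp add: \<kappa>_def algebra_simps)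
    qed
    also have "\<dots> = \<kappa> * x * (2 * Re t - R * x * (norm t)\<^sup>2)"
      using x by (simp add: s_def norm_mult power_mult_distrib algebra_simps power2_eq_square)
    also have "\<dots> \<ge> \<kappa> * x * d"
    proof -
      have "R * x * (norm t)\<^sup>2 \<le> R * 1 * (norm t)\<^sup>2" using x R_gt_2 by (intro mult_right_mono mult_left_mono) auto
      then have "d \<le> 2 * Re t - R * x * (norm t)\<^sup>2" using dt by simp
      then show ?thesis using x \<kappa>_pos by (intro mult_left_mono) auto
    qed
    finally have "(norm (1 - s / of_real m))\<^sup>2 \<le> N - \<kappa> * x * d" by simp
    then have "(norm (rho s))\<^sup>2 \<le> (N - \<kappa> * x * d) / N"
      unfolding rho_eq[OF ms] norm_divide power_divide N_def[symmetric] using N by (intro divide_right_mono) auto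
    also have "\<dots> = 1 - \<kappa> * x * d / N" using N by (simp add: diff_divide_distrib)
    also have "\<dots> \<le> 1 - \<kappa> * x * d / 4"
      using N x d \<kappa>_pos by (intro diff_left_mono divide_left_mono) auto
    also have "\<dots> \<le> exp (- (\<kappa> * x * d / 4))" using exp_ge_add_one_self[of "- (\<kappa> * x * d / 4)"] by simp
    also have "\<dots> = (exp (- \<delta> * x))\<^sup>2" unfolding \<delta>_def by (simp add: power2_eq_square flip: exp_add)
    finally show "norm (rho (of_real x * t)) \<le> exp (- \<delta> * x)" unfolding s_def by (rule power2_le_imp_le) simp
    have "d \<le> 2 * Re t" using dt R_gt_2 by (smt (verit) mult_nonneg_nonneg zero_le_power2)
    then have "d / 8 \<le> Re t" using d by simp
    then show "\<delta> \<le> \<kappa> * Re t" unfolding \<delta>_def using \<kappa>_pos by (simp add: mult_left_mono flip: times_divide_eq_right)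
  qed
  ultimately show ?thesis by blast
qed (auto intro: exI[of _ 1])

text \<open>Both functions are \<open>1 - \<kappa> s + O(s\<^sup>2)\<close>.\<close>
lemma rho_minus_exp:
  assumes "norm s \<le> 1"
  shows "norm (rho s - exp (- of_real \<kappa> * s)) \<le> (\<kappa> * m / (1 - m) + exp \<kappa> * \<kappa>\<^sup>2) * (norm s)\<^sup>2"
proof -
  have ms: "of_real m * s \<noteq> 1" using assms by (rule mt_ne_1')
  then have nz: "1 - of_real m * s \<noteq> 0" "complex_of_real m \<noteq> 0" using m_pos by auto
  have 1: "rho s - (1 + - of_real \<kappa> * s) = - of_real (\<kappa> * m) * s\<^sup>2 / (1 - of_real m * s)"
    unfolding rho_eq[OF ms] \<kappa>_def using nz by (simp add: field_simps power2_eq_square)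
  have "norm (rho s - (1 + - of_real \<kappa> * s)) = \<kappa> * m * (norm s)\<^sup>2 / norm (1 - of_real m * s)"
    unfolding 1 using \<kappa>_pos m_pos by (simp add: norm_mult norm_divide norm_power)
  also have "\<dots> \<le> \<kappa> * m * (norm s)\<^sup>2 / (1 - m)"
    using norm_one_minus_ge[OF assms] m_less_1 m_pos \<kappa>_pos by (intro divide_left_mono mult_pos_pos) auto
  finally have A: "norm (rho s - (1 + - of_real \<kappa> * s)) \<le> \<kappa> * m / (1 - m) * (norm s)\<^sup>2" by simp
  have n: "norm (- of_real \<kappa> * s) = \<kappa> * norm s" using \<kappa>_pos by (simp add: norm_mult)
  have "norm (exp (- of_real \<kappa> * s) - (1 + - of_real \<kappa> * s)) \<le> exp (\<kappa> * norm s) * (\<kappa> * norm s)\<^sup>2"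
    using norm_exp_minus_linear[of "- of_real \<kappa> * s"] unfolding n .
  also have "\<dots> \<le> exp \<kappa> * (\<kappa> * norm s)\<^sup>2"
    using assms \<kappa>_pos by (intro mult_right_mono) (auto simp: mult_left_le)
  finally have B: "norm (exp (- of_real \<kappa> * s) - (1 + - of_real \<kappa> * s)) \<le> exp \<kappa> * \<kappa>\<^sup>2 * (norm s)\<^sup>2"
    by (simp add: power_mult_distrib mult.assoc)
  have "norm (rho s - exp (- of_real \<kappa> * s)) \<le> norm (rho s - (1 + - of_real \<kappa> * s)) + norm (exp (- of_real \<kappa> * s) - (1 + - of_real \<kappa> * s))"
    using norm_triangle_ineq4[of "rho s - (1 + - of_real \<kappa> * s)" "exp (- of_real \<kappa> * s) - (1 + - of_real \<kappa> * s)"] by simp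
  then show ?thesis using A B by (simp add: distrib_right)
qed

text \<open>With \<open>y = n x\<close>: the \<open>n\<close>-th powers of two numbers below \<open>exp (- \<delta> x)\<close> that differ by \<open>O(x\<^sup>2)\<close> differ by
  \<open>O(n x\<^sup>2 exp (- \<delta> y))\<close>, and replacing the denominator by \<open>1\<close> costs \<open>O(x exp (- \<delta> y))\<close>. After multiplication by
  \<open>n x\<close> the total is \<open>(y\<^sup>3 + y\<^sup>2) exp (- \<delta> y) / n\<close>.\<close>
lemma term_estimate:
  assumes K: "compact K" "K \<subseteq> horodisc"
  shows "\<exists>C\<ge>0. \<forall>t\<in>K. \<forall>x\<in>{0<..1}. \<forall>n\<ge>1.
     norm (of_real (real n * x) * (orbit_kernel n (of_real x * t))
        - chi_term (real n * x) t) \<le> C / sqrt (real n) * sqrt x"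
proof -
  obtain \<delta> where \<delta>: "\<delta> > 0" "\<And>t x. t \<in> K \<Longrightarrow> x \<in> {0..1} \<Longrightarrow> norm (rho (of_real x * t)) \<le> exp (- \<delta> * x)"
    "\<And>t. t \<in> K \<Longrightarrow> \<delta> \<le> \<kappa> * Re t"
    using norm_rho_le[OF K] by (metis atLeastAtMost_iff order_refl zero_le_one)
  obtain C0 where C0: "C0 \<ge> 0" "\<And>y. y \<ge> 0 \<Longrightarrow> (y ^ 3 + y\<^sup>2) * exp (- \<delta> * y) \<le> C0 * sqrt y"
    using cubic_exp_bound[OF \<delta>(1)] by blast
  define C1 where "C1 = exp \<delta> * (\<kappa> * m / (1 - m) + exp \<kappa> * \<kappa>\<^sup>2) / (1 - m)\<^sup>2"
  define C2 where "C2 = 3 / (1 - m)\<^sup>2"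
  define C where "C = max C1 C2"
  have C: "C1 \<le> C" "C2 \<le> C" "C \<ge> 0"
    using m_less_1 by (auto simp: C_def C2_def le_max_iff_disj)
  have main: "norm (of_real (real n * x) * (orbit_kernel n (of_real x * t))
        - chi_term (real n * x) t) \<le> (C * C0) / sqrt (real n) * sqrt x"
    if t: "t \<in> K" and x: "x \<in> {0<..1}" and n: "n \<ge> 1" for t x n
  proof -
    define s where "s = of_real x * t"
    define a where "a = rho s"
    define b where "b = exp (- of_real \<kappa> * s)"
    define M where "M = exp (- \<delta> * x)"
    define D where "D = (1 - of_real m * s)\<^sup>2"
    have tHD: "t \<in> horodisc" using K t by auto
    have sx: "norm s \<le> x" using horodisc_norm(2)[OF tHD] x by (simp add: s_def norm_mult mult_left_le)
    then have s1: "norm s \<le> 1" using x by simp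
    have aM: "norm a \<le> M" unfolding a_def s_def M_def using \<delta>(2)[OF t, of x] x by simp
    have bM: "norm b \<le> M"
      unfolding b_def s_def M_def using \<delta>(3)[OF t] x by (simp add: norm_exp_eq_Re mult_right_mono mult_ac)
    have D: "norm D \<ge> (1 - m)\<^sup>2" "D \<noteq> 0"
    proof -
      show "norm D \<ge> (1 - m)\<^sup>2" unfolding D_def norm_power
        using norm_one_minus_ge[OF s1] m_less_1 by (intro power_mono) auto
      then show "D \<noteq> 0" using m_less_1 by auto
    qed
    have ab: "norm (a ^ n - b ^ n) \<le> real n * (exp \<delta> * (\<kappa> * m / (1 - m) + exp \<kappa> * \<kappa>\<^sup>2)) * x\<^sup>2 * M ^ n"
    proof -
      have "norm (a ^ n - b ^ n) \<le> real n * M ^ n / M * norm (a - b)"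
        by (rule norm_power_diff_le[OF aM bM]) (simp add: M_def)
      also have "\<dots> \<le> real n * M ^ n * exp \<delta> * ((\<kappa> * m / (1 - m) + exp \<kappa> * \<kappa>\<^sup>2) * x\<^sup>2)"
      proof (intro mult_mono)
        have "1 / M \<le> exp \<delta>" unfolding M_def using \<delta>(1) x by (simp add: exp_minus field_simps)
        then have "(real n * M ^ n) * (1 / M) \<le> (real n * M ^ n) * exp \<delta>" by (intro mult_left_mono) (auto simp: M_def)
        then show "real n * M ^ n / M \<le> real n * M ^ n * exp \<delta>" by simp
        have "norm (a - b) \<le> (\<kappa> * m / (1 - m) + exp \<kappa> * \<kappa>\<^sup>2) * (norm s)\<^sup>2"
          unfolding a_def b_def by (rule rho_minus_exp[OF s1])
        also have "\<dots> \<le> (\<kappa> * m / (1 - m) + exp \<kappa> * \<kappa>\<^sup>2) * x\<^sup>2"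
          using sx m_less_1 m_pos \<kappa>_pos by (intro mult_left_mono power_mono) auto
        finally show "norm (a - b) \<le> (\<kappa> * m / (1 - m) + exp \<kappa> * \<kappa>\<^sup>2) * x\<^sup>2" .
      qed (auto simp: M_def)
      finally show ?thesis by (simp only: mult_ac)
    qed
    have D1: "norm (1 / D - 1) \<le> C2 * x"
    proof -
      have e: "1 / D - 1 = of_real m * s * (2 - of_real m * s) / D"
        using D(2) by (simp add: field_simps) (simp add: D_def power2_eq_square algebra_simps)
      have "norm (of_real m * s) \<le> norm s" using m_pos m_less_1 by (simp add: norm_mult mult_left_le_one_le)
      moreover have "norm (2 - of_real m * s) \<le> 2 + norm (of_real m * s)"
        using norm_triangle_ineq4[of 2 "of_real m * s"] by simp
      ultimately have "norm (of_real m * s) * norm (2 - of_real m * s) \<le> x * 3"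
        using sx s1 x by (intro mult_mono) auto
      then have "norm (1 / D - 1) \<le> x * 3 / (1 - m)\<^sup>2"
        unfolding e norm_divide norm_mult[of "of_real m * s"] using D(1) m_less_1 x by (intro frac_le) auto
      then show ?thesis by (simp add: C2_def mult.commute)
    qed
    have bn: "norm (b ^ n) \<le> M ^ n" unfolding norm_power using bM by (intro power_mono) auto
    have "a ^ n / D - b ^ n = (a ^ n - b ^ n) / D + b ^ n * (1 / D - 1)"
      using D(2) by (simp add: field_simps)
    then have "norm (a ^ n / D - b ^ n) \<le> norm ((a ^ n - b ^ n) / D) + norm (b ^ n * (1 / D - 1))"
      by (metis norm_triangle_ineq)
    also have "\<dots> \<le> real n * C1 * x\<^sup>2 * M ^ n + M ^ n * (C2 * x)"
    proof (intro add_mono)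
      have "norm ((a ^ n - b ^ n) / D) \<le> real n * (exp \<delta> * (\<kappa> * m / (1 - m) + exp \<kappa> * \<kappa>\<^sup>2)) * x\<^sup>2 * M ^ n / (1 - m)\<^sup>2"
        unfolding norm_divide using ab D(1) m_less_1 by (intro frac_le order_trans[OF norm_ge_zero ab] ab) auto
      then show "norm ((a ^ n - b ^ n) / D) \<le> real n * C1 * x\<^sup>2 * M ^ n" by (simp add: C1_def mult_ac)
      show "norm (b ^ n * (1 / D - 1)) \<le> M ^ n * (C2 * x)"
        unfolding norm_mult using bn D1 by (intro mult_mono) (auto simp: M_def)
    qed
    also have "\<dots> \<le> real n * C * x\<^sup>2 * M ^ n + M ^ n * (C * x)"
      using C x by (intro add_mono mult_right_mono mult_left_mono) (auto simp: M_def)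
    finally have est: "norm (a ^ n / D - b ^ n) \<le> real n * C * x\<^sup>2 * M ^ n + M ^ n * (C * x)" .
    define y where "y = real n * x"
    have y: "y \<ge> 0" using x by (simp add: y_def)
    have Mn: "M ^ n = exp (- \<delta> * y)" by (simp add: M_def y_def mult_ac flip: exp_of_nat_mult)
    have ct: "chi_term (real n * x) t = of_real (real n * x) * b ^ n"
      unfolding chi_term_def b_def s_def by (simp add: mult_ac flip: exp_of_nat_mult)
    have "norm (of_real (real n * x) * (a ^ n / D) - of_real (real n * x) * b ^ n) = y * norm (a ^ n / D - b ^ n)"
      unfolding right_diff_distrib[symmetric] norm_mult norm_of_real using y by (simp add: y_def)
    also have "\<dots> \<le> y * (real n * C * x\<^sup>2 * M ^ n + M ^ n * (C * x))" using est y by (rule mult_left_mono)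
    also have "\<dots> = C / real n * ((y ^ 3 + y\<^sup>2) * M ^ n)"
      unfolding y_def using n by (simp add: field_simps power2_eq_square power3_eq_cube)
    also have "\<dots> = C / real n * ((y ^ 3 + y\<^sup>2) * exp (- \<delta> * y))" unfolding Mn ..
    also have "\<dots> \<le> C / real n * (C0 * sqrt y)" using C0(2)[OF y] C by (intro mult_left_mono) auto
    also have "\<dots> = (C * C0) / sqrt (real n) * sqrt x"
    proof -
      have "sqrt (real n) / real n = 1 / sqrt (real n)" using n by (simp add: field_simps)
      then have "C / real n * (C0 * (sqrt (real n) * sqrt x)) = C * C0 * (1 / sqrt (real n)) * sqrt x"
        by (metis (no_types, opaque_lifting) mult.assoc mult.commute times_divide_eq_left)
      then show ?thesis unfolding y_def real_sqrt_mult by simp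
    qed
    finally show ?thesis unfolding ct a_def[symmetric] s_def[symmetric] D_def[symmetric] .
  qed
  show ?thesis using main C C0 by (intro exI[of _ "C * C0"]) auto
qed

text \<open>The main part of the analytic part at \<open>t\<close>, up to the factor \<open>-(1 - m\<^sup>2) v m^n\<close>.\<close>
definition orbit_sum :: "nat \<Rightarrow> complex \<Rightarrow> complex" where
  "orbit_sum n t = (\<Sum>k. of_real (dil k) * (orbit_kernel n (of_real (dil k) * t)))"

lemma sqrt_dil: "sqrt (dil k) = (m\<^sup>2) ^ k"
proof -
  have "dil k = ((m\<^sup>2) ^ k)\<^sup>2"
    unfolding dil_def by (simp add: power2_eq_square power4_eq_xxxx power_mult_distrib)
  then show ?thesis using m_pos by simp
qed

lemma summable_orbit_sum:
  assumes "t \<in> horodisc"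
  shows "summable (\<lambda>k. norm (of_real (dil k) * (orbit_kernel n (of_real (dil k) * t))))"
proof (rule summable_comparison_test'[OF summable_mult[OF summable_dil, of "1 / (1 - m)\<^sup>2"], of 0])
  fix k
  obtain \<delta> where \<delta>: "\<delta> > 0" "\<And>x. x \<in> {0..1} \<Longrightarrow> norm (rho (of_real x * t)) \<le> exp (- \<delta> * x)"
    using norm_rho_le[of "{t}"] assms by auto
  have x: "0 < dil k" "dil k \<le> 1" using dil_pos dil_le_1 by auto
  have "norm (rho (of_real (dil k) * t)) \<le> exp (- \<delta> * dil k)" using \<delta>(2)[of "dil k"] x by simp
  also have "\<dots> \<le> 1" using \<delta>(1) x by simp
  finally have r: "norm (rho (of_real (dil k) * t) ^ n) \<le> 1" unfolding norm_power by (rule power_le_one[OF norm_ge_zero])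
  have "norm (of_real (dil k) * t) \<le> 1" using horodisc_norm(2)[OF assms] x unfolding norm_mult by (intro mult_le_one) auto
  then have D: "(1 - m)\<^sup>2 \<le> norm ((1 - of_real m * (of_real (dil k) * t))\<^sup>2)"
    unfolding norm_power using norm_one_minus_ge m_less_1 by (intro power_mono) auto
  have "norm (orbit_kernel n (of_real (dil k) * t)) \<le> 1 / (1 - m)\<^sup>2"
    unfolding norm_divide using r D m_less_1 by (intro frac_le) auto
  then have "norm (of_real (dil k) * (orbit_kernel n (of_real (dil k) * t))) \<le> dil k * (1 / (1 - m)\<^sup>2)"
    unfolding norm_mult norm_of_real using x by (intro mult_mono) auto
  then show "norm (norm (of_real (dil k) * (orbit_kernel n (of_real (dil k) * t)))) \<le> 1 / (1 - m)\<^sup>2 * dil k"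
    unfolding real_norm_def abs_norm_cancel by (simp only: mult.commute)
qed

lemma chi_term_scale: "of_real n * chi_term x (of_real n * t) = chi_term (n * x) t"
  by (simp add: chi_term_def mult_ac)

text \<open>The terms of nonnegative index are compared one by one; those of negative index of \<open>\<chi>(n t)\<close> add up to \<open>O(1 / n)\<close>.\<close>
lemma orbit_sum_estimate:
  assumes K: "compact K" "K \<subseteq> horodisc"
  shows "\<exists>C\<ge>0. \<forall>t\<in>K. \<forall>n\<ge>1. norm (of_real (real n) * t * orbit_sum n t - chi R (of_real (real n) * t)) \<le> C / sqrt (real n)"
proof (cases "K = {}")
  case False
  obtain C1 where C1: "C1 \<ge> 0" "\<And>t x n. t \<in> K \<Longrightarrow> x \<in> {0<..1} \<Longrightarrow> n \<ge> 1 \<Longrightarrow>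
     norm (of_real (real n * x) * (orbit_kernel n (of_real x * t))
        - chi_term (real n * x) t) \<le> C1 / sqrt (real n) * sqrt x"
    using term_estimate[OF K] by blast
  obtain t0 where t0: "t0 \<in> K" "\<And>t. t \<in> K \<Longrightarrow> Re t0 \<le> Re t"
    using continuous_attains_inf[OF K(1) False continuous_on_Re[OF continuous_on_id]] by blast
  define \<delta> where "\<delta> = Re t0"
  have \<delta>: "\<delta> > 0" "\<And>t. t \<in> K \<Longrightarrow> \<delta> \<le> Re t" using t0 K(2) horodisc_Re by (auto simp: \<delta>_def)
  have m2s: "summable (\<lambda>k. (m\<^sup>2) ^ k)" using m2_less_1 m_pos by (intro summable_geometric) auto
  define X where "X = suminf dil"
  have X0: "X \<ge> 0" unfolding X_def using dil_pos by (intro suminf_nonneg summable_dil) (auto intro: less_imp_le)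
  define C where "C = C1 * (\<Sum>k. (m\<^sup>2) ^ k) + 2 / (\<kappa> * \<delta>)\<^sup>2 * X"
  have "C1 * (\<Sum>k. (m\<^sup>2) ^ k) \<ge> 0" using C1 m2s by (intro mult_nonneg_nonneg suminf_nonneg) auto
  then have C0: "C \<ge> 0" unfolding C_def using X0 by simp
  have "norm (of_real (real n) * t * orbit_sum n t - chi R (of_real (real n) * t)) \<le> C / sqrt (real n)" if t: "t \<in> K" and n: "n \<ge> 1" for t n
  proof -
    have tHD: "t \<in> horodisc" using K t by auto
    have nt: "Re (of_real (real n) * t) \<ge> real n * \<delta>" "Re (of_real (real n) * t) > 0"
      using \<delta>(2)[OF t] horodisc_Re[OF tHD] n by (auto simp: mult_left_mono)
    define f where "f k = of_real (dil k) * (orbit_kernel n (of_real (dil k) * t))" for k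
    have fs: "f sums orbit_sum n t"
      unfolding orbit_sum_def f_def by (intro summable_sums summable_norm_cancel[OF summable_orbit_sum[OF tHD]])
    have cs: "(\<lambda>k. chi_term (dil k) (of_real (real n) * t)) sums chi_pos (of_real (real n) * t)"
      unfolding chi_pos_def using nt(2) by (intro summable_sums summable_norm_cancel[OF summable_chi_pos]) simp
    have "(\<lambda>k. of_real (real n) * f k - of_real (real n) * chi_term (dil k) (of_real (real n) * t)) sums
       (of_real (real n) * orbit_sum n t - of_real (real n) * chi_pos (of_real (real n) * t))"
      by (intro sums_diff sums_mult fs cs)
    moreover have "(\<lambda>k. C1 / sqrt (real n) * (m\<^sup>2) ^ k) sums (C1 / sqrt (real n) * (\<Sum>k. (m\<^sup>2) ^ k))"
      by (intro sums_mult summable_sums m2s)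
    moreover have "norm (of_real (real n) * f k - of_real (real n) * chi_term (dil k) (of_real (real n) * t)) \<le> C1 / sqrt (real n) * (m\<^sup>2) ^ k" for k
      using C1(2)[OF t, of "dil k" n] dil_pos[of k] dil_le_1[of k] n
      unfolding chi_term_scale f_def sqrt_dil by (simp add: mult.assoc)
    ultimately have 1: "norm (of_real (real n) * orbit_sum n t - of_real (real n) * chi_pos (of_real (real n) * t)) \<le> C1 / sqrt (real n) * (\<Sum>k. (m\<^sup>2) ^ k)"
      by (rule norm_sums_le)
    have ns: "(\<lambda>k. chi_term (1 / dil (Suc k)) (of_real (real n) * t)) sums chi_neg (of_real (real n) * t)"
      unfolding chi_neg_def using nt(2) by (intro summable_sums summable_norm_cancel[OF summable_chi_neg])
    have xs: "(\<lambda>k. 2 / (\<kappa> * (real n * \<delta>))\<^sup>2 * dil (Suc k)) sums (2 / (\<kappa> * (real n * \<delta>))\<^sup>2 * (X - dil 0))"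
      unfolding X_def by (intro sums_mult) (subst sums_Suc_iff, simp add: summable_sums summable_dil)
    have "norm (chi_neg (of_real (real n) * t)) \<le> 2 / (\<kappa> * (real n * \<delta>))\<^sup>2 * (X - dil 0)"
      by (rule norm_sums_le[OF ns xs norm_chi_term_neg]) (use nt(1) n \<delta>(1) in auto)
    also have "\<dots> \<le> 2 / (\<kappa> * (real n * \<delta>))\<^sup>2 * X" using dil_pos[of 0] by (intro mult_left_mono) auto
    finally have "real n * norm (chi_neg (of_real (real n) * t)) \<le> real n * (2 / (\<kappa> * (real n * \<delta>))\<^sup>2 * X)"
      by (intro mult_left_mono) auto
    also have "\<dots> = 2 / (\<kappa> * \<delta>)\<^sup>2 * X / real n"
      using n by (simp add: power_mult_distrib field_simps power2_eq_square)
    also have "\<dots> \<le> 2 / (\<kappa> * \<delta>)\<^sup>2 * X / sqrt (real n)"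
    proof (intro divide_left_mono)
      have "sqrt (real n) * 1 \<le> sqrt (real n) * sqrt (real n)" using n by (intro mult_left_mono) auto
      then show "sqrt (real n) \<le> real n" by simp
    qed (use X0 n in auto)
    finally have 2: "norm (of_real (real n) * chi_neg (of_real (real n) * t)) \<le> 2 / (\<kappa> * \<delta>)\<^sup>2 * X / sqrt (real n)"
      by (simp add: norm_mult)
    have "of_real (real n) * t * orbit_sum n t - chi R (of_real (real n) * t)
       = t * ((of_real (real n) * orbit_sum n t - of_real (real n) * chi_pos (of_real (real n) * t)) - of_real (real n) * chi_neg (of_real (real n) * t))"
      unfolding chi_eq[OF nt(2)] by (simp add: algebra_simps)
    then have "norm (of_real (real n) * t * orbit_sum n t - chi R (of_real (real n) * t))
      = norm t * norm ((of_real (real n) * orbit_sum n t - of_real (real n) * chi_pos (of_real (real n) * t)) - of_real (real n) * chi_neg (of_real (real n) * t))"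
      by (simp only: norm_mult)
    also have "\<dots> \<le> 1 * (C1 / sqrt (real n) * (\<Sum>k. (m\<^sup>2) ^ k) + 2 / (\<kappa> * \<delta>)\<^sup>2 * X / sqrt (real n))"
      using horodisc_norm(2)[OF tHD] by (intro mult_mono order_trans[OF norm_triangle_ineq4] add_mono 1 2) auto
    also have "\<dots> = C / sqrt (real n)" by (simp add: C_def add_divide_distrib)
    finally show ?thesis .
  qed
  then show ?thesis using C0 by blast
qed auto

text \<open>Telescoping along the orbit: \<open>m^(4N) \<alpha>(m^(4N) t)\<close> tends to \<open>0\<close> because \<open>\<alpha>\<close> is continuous at the fixed point.\<close>
lemma decomposition_sums:
  assumes dec: "decomposition C n P \<alpha> E v c" and t: "t \<in> horodisc"
  shows "(\<lambda>k. of_real (dil k) * ((v * W (of_real (dil k) * t) ^ n + E (W (of_real (dil k) * t))) * W' (of_real (dil k) * t))) sums \<alpha> t"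
proof -
  have hol: "\<alpha> holomorphic_on ball 0 (1 / m)" and rec: "\<And>t. norm t < 1 \<Longrightarrow>
     \<alpha> t - of_real (m ^ 4) * \<alpha> (of_real (m ^ 4) * t) = (v * W t ^ n + E (W t)) * W' t"
    using dec unfolding decomposition_def by blast+
  have small: "norm (of_real (dil k) * t) < 1" for k
  proof -
    have "dil k * norm t \<le> norm t" using dil_pos[of k] dil_le_1[of k] by (intro mult_left_le_one_le) auto
    then show ?thesis using horodisc_norm(2)[OF t] dil_pos[of k] by (simp add: norm_mult)
  qed
  have part: "(\<Sum>k<N. of_real (dil k) * ((v * W (of_real (dil k) * t) ^ n + E (W (of_real (dil k) * t))) * W' (of_real (dil k) * t)))
      = \<alpha> t - of_real (dil N) * \<alpha> (of_real (dil N) * t)" for N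
  proof (induction N)
    case 0
    then show ?case by (simp add: dil_def)
  next
    case (Suc N)
    have "of_real (dil N) * ((v * W (of_real (dil N) * t) ^ n + E (W (of_real (dil N) * t))) * W' (of_real (dil N) * t))
       = of_real (dil N) * \<alpha> (of_real (dil N) * t) - of_real (dil (Suc N)) * \<alpha> (of_real (dil (Suc N)) * t)"
      unfolding rec[OF small, symmetric] dil_Suc by (simp add: algebra_simps)
    then show ?case using Suc by simp
  qed
  have x0: "dil \<longlonglongrightarrow> 0" using summable_LIMSEQ_zero[OF summable_dil] .
  have c0: "isCont \<alpha> 0"
    using holomorphic_on_imp_continuous_on[OF hol] m_pos by (simp add: continuous_on_eq_continuous_at)
  have "(\<lambda>N. of_real (dil N) * t) \<longlonglongrightarrow> of_real 0 * t" by (intro tendsto_intros x0)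
  then have "(\<lambda>N. \<alpha> (of_real (dil N) * t)) \<longlonglongrightarrow> \<alpha> 0" using isCont_tendsto_compose[OF c0] by simp
  then have "(\<lambda>N. \<alpha> t - of_real (dil N) * \<alpha> (of_real (dil N) * t)) \<longlonglongrightarrow> \<alpha> t - of_real 0 * \<alpha> 0"
    by (intro tendsto_intros x0)
  then show ?thesis unfolding sums_def part by simp
qed

end

section \<open>Asymptotics of the analytic part\<close>

text \<open>Used to pass from \<open>x \<approx> 1 / x\<close> to \<open>x \<approx> 1\<close>.\<close>
lemma abs_minus_one_le:
  fixes x :: real
  assumes "x > 0" shows "\<bar>x - 1\<bar> \<le> \<bar>x - 1 / x\<bar>"
proof -
  have "x - 1 / x = (x - 1) * ((x + 1) / x)" using assms by (simp add: field_simps)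
  then have "\<bar>x - 1 / x\<bar> = \<bar>x - 1\<bar> * ((x + 1) / x)" using assms by (simp add: abs_mult)
  moreover have "1 \<le> (x + 1) / x" using assms by (simp add: field_simps)
  ultimately show ?thesis by (metis abs_ge_zero mult_left_mono mult.right_neutral)
qed

context joukowski_disc
begin

lemma leading_coefficient_limit:
  assumes dec: "\<And>n::nat. decomposition C n (P n) (\<alpha> n) (E n) (v n) (c n)"
  shows "(\<lambda>n. v n / of_real (sqrt (real n))) \<longlonglongrightarrow> 1"
proof -
  define r where "r = R - 1"
  have r: "r > 1" using R_minus_1 by (simp add: r_def)
  have c: "c n > 0" "of_real (c n) * v n = 1" "norm (v n - of_real (real (n + 1) * c n)) \<le> C * (1 / r) ^ n" for n
    using dec[of n] unfolding decomposition_def r_def by blast+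
  have v: "v n = of_real (1 / c n)" for n using c(1,2)[of n] by (simp add: field_simps)
  define x where "x n = 1 / (c n * sqrt (real (n + 1)))" for n
  have x0: "x n > 0" for n using c(1)[of n] by (simp add: x_def)
  have b: "\<bar>x n - 1\<bar> \<le> C * (1 / r) ^ n" for n
  proof -
    have "\<bar>1 / c n - real (n + 1) * c n\<bar> \<le> C * (1 / r) ^ n"
      using c(3)[of n] unfolding v by (metis norm_of_real of_real_diff)
    moreover have "\<bar>x n - 1 / x n\<bar> = \<bar>1 / c n - real (n + 1) * c n\<bar> / sqrt (real (n + 1))"
    proof -
      define w where "w = sqrt (real (n + 1))"
      have w: "w > 0" "real (n + 1) = w * w" by (simp_all add: w_def)
      have "x n - 1 / x n = (1 / c n - real (n + 1) * c n) / w"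
        unfolding x_def w(2) w_def[symmetric] using w(1) c(1)[of n] by (simp add: field_simps)
      then show ?thesis using w(1) by (simp add: w_def)
    qed
    moreover have "\<bar>1 / c n - real (n + 1) * c n\<bar> / sqrt (real (n + 1)) \<le> \<bar>1 / c n - real (n + 1) * c n\<bar>"
      by (rule divide_le_eq[THEN iffD2]) (simp add: mult_le_cancel_left1)
    ultimately show ?thesis using abs_minus_one_le[OF x0[of n]] by (metis order_trans)
  qed
  have "(\<lambda>n. C * (1 / r) ^ n) \<longlonglongrightarrow> C * 0" using r by (intro tendsto_mult tendsto_const LIMSEQ_power_zero) auto
  then have "(\<lambda>n. x n - 1) \<longlonglongrightarrow> 0" using b by (intro Lim_null_comparison[of "\<lambda>n. x n - 1" "\<lambda>n. C * (1 / r) ^ n"]) auto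
  then have x1: "x \<longlonglongrightarrow> 1" by (simp add: LIM_zero_iff)
  have "(\<lambda>n. sqrt (1 + 1 / real n)) \<longlonglongrightarrow> sqrt (1 + 0)"
    by (intro tendsto_intros lim_1_over_n)
  from tendsto_mult[OF x1 this] have "(\<lambda>n. x n * sqrt (1 + 1 / real n)) \<longlonglongrightarrow> 1" by simp
  then have "(\<lambda>n. complex_of_real (x n * sqrt (1 + 1 / real n))) \<longlonglongrightarrow> 1"
    using tendsto_of_real by (metis of_real_1)
  moreover have "\<forall>\<^sub>F n in sequentially. complex_of_real (x n * sqrt (1 + 1 / real n)) = v n / of_real (sqrt (real n))"
    using eventually_gt_at_top[of 0]
  proof eventually_elim
    case (elim n)
    have "sqrt (1 + 1 / real n) = sqrt (real (n + 1)) / sqrt (real n)"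
      using elim by (simp add: add_divide_distrib flip: real_sqrt_divide)
    then have "x n * sqrt (1 + 1 / real n) = 1 / c n / sqrt (real n)"
      using c(1)[of n] by (simp add: x_def)
    then show ?case unfolding v by simp
  qed
  ultimately show ?thesis by (rule Lim_transform_eventually)
qed

text \<open>Scaled so that the limit is \<open>\<chi>\<close> itself: \<open>-(1 - m\<^sup>2)\<close> is the derivative of \<open>W\<close> at the fixed point.\<close>
definition Phi :: "(complex \<Rightarrow> complex) \<Rightarrow> nat \<Rightarrow> complex \<Rightarrow> complex" where
  "Phi \<alpha> n t = - (t * of_real (sqrt (real n) / m ^ n / (1 - m\<^sup>2)) * \<alpha> t)"

lemma Phi_estimate:
  assumes dec: "decomposition C n P \<alpha> E v c" and t: "t \<in> horodisc" and n: "n \<ge> 1"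
  shows "norm (Phi \<alpha> n t - v / of_real (sqrt (real n)) * (of_real (real n) * t * orbit_sum n t))
     \<le> \<bar>C\<bar> * suminf dil / (1 - m)\<^sup>2 * (sqrt (real n) * (1 / (R - 1)) ^ n)"
proof -
  define r where "r = R - 1"
  have r: "r > 1" using R_minus_1 by (simp add: r_def)
  have Eb: "norm (E w) \<le> C * (norm w / r) ^ (n + 1)" if "norm w \<le> 1" for w
    using dec that unfolding decomposition_def r_def by blast
  obtain \<delta> where \<delta>: "\<delta> > 0" "\<And>x. x \<in> {0..1} \<Longrightarrow> norm (rho (of_real x * t)) \<le> exp (- \<delta> * x)"
    using norm_rho_le[of "{t}"] t by auto
  define s where "s k = of_real (dil k) * t" for k
  define e where "e k = of_real (dil k) * (E (W (s k)) / (1 - of_real m * s k)\<^sup>2)" for k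
  have s1: "norm (s k) \<le> 1" for k
    using horodisc_norm(2)[OF t] dil_pos[of k] dil_le_1[of k] unfolding s_def norm_mult by (intro mult_le_one) auto
  have Ws: "W z = of_real m * rho z" for z using m_pos by (simp add: rho_def)
  have Wm: "norm (W (s k)) \<le> m" for k
  proof -
    have "norm (rho (s k)) \<le> exp (- \<delta> * dil k)" unfolding s_def using dil_pos[of k] dil_le_1[of k] by (intro \<delta>(2)) auto
    also have "\<dots> \<le> 1" using \<delta>(1) dil_pos[of k] by simp
    finally show ?thesis unfolding Ws using m_pos by (simp add: norm_mult mult_left_le)
  qed
  have m2: "1 - (complex_of_real m)\<^sup>2 \<noteq> 0" by (rule one_minus_m2_nz)
  have W'e: "W' z = - (1 - (of_real m)\<^sup>2) / (1 - of_real m * z)\<^sup>2" for z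
    unfolding W'_def by (simp add: power2_commute)
  have A: "(\<lambda>k. of_real (dil k) * ((v * W (s k) ^ n + E (W (s k))) * W' (s k))) sums \<alpha> t"
    unfolding s_def by (rule decomposition_sums[OF dec t])
  have B: "(\<lambda>k. of_real (dil k) * (orbit_kernel n (s k))) sums orbit_sum n t"
    unfolding orbit_sum_def s_def by (intro summable_sums summable_norm_cancel[OF summable_orbit_sum[OF t]])
  have "(\<lambda>k. (- 1 / (1 - (of_real m)\<^sup>2)) * (of_real (dil k) * ((v * W (s k) ^ n + E (W (s k))) * W' (s k)))
       - v * of_real m ^ n * (of_real (dil k) * (orbit_kernel n (s k))))
      sums ((- 1 / (1 - (of_real m)\<^sup>2)) * \<alpha> t - v * of_real m ^ n * orbit_sum n t)"
    by (intro sums_diff sums_mult A B)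
  moreover have "(- 1 / (1 - (of_real m)\<^sup>2)) * (of_real (dil k) * ((v * W (s k) ^ n + E (W (s k))) * W' (s k)))
       - v * of_real m ^ n * (of_real (dil k) * (orbit_kernel n (s k))) = e k" for k
  proof -
    have g: "(- 1 / y) * (a * ((v * w + E') * (- y / d))) - v * mn * (a * (rn / d)) = a * (E' / d)"
      if "y \<noteq> 0" "w = mn * rn" for y a w E' d mn rn :: complex
    proof -
      have "(- 1 / y) * (a * ((v * w + E') * (- y / d))) = a * ((v * w + E') / d)" using that(1) by simp
      then show ?thesis unfolding that(2) by (simp add: add_divide_distrib algebra_simps)
    qed
    show ?thesis unfolding e_def W'e
      by (rule g[OF m2]) (simp add: Ws power_mult_distrib)
  qed
  ultimately have es: "e sums ((- 1 / (1 - (of_real m)\<^sup>2)) * \<alpha> t - v * of_real m ^ n * orbit_sum n t)" by simp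
  have bs: "(\<lambda>k. \<bar>C\<bar> * (m / r) ^ (n + 1) / (1 - m)\<^sup>2 * dil k) sums (\<bar>C\<bar> * (m / r) ^ (n + 1) / (1 - m)\<^sup>2 * suminf dil)"
    by (intro sums_mult summable_sums summable_dil)
  have "norm ((- 1 / (1 - (of_real m)\<^sup>2)) * \<alpha> t - v * of_real m ^ n * orbit_sum n t) \<le> \<bar>C\<bar> * (m / r) ^ (n + 1) / (1 - m)\<^sup>2 * suminf dil"
  proof (rule norm_sums_le[OF es bs])
    fix k
    have "norm (E (W (s k))) \<le> C * (norm (W (s k)) / r) ^ (n + 1)" using Wm[of k] m_less_1 by (intro Eb) auto
    also have "\<dots> \<le> \<bar>C\<bar> * (norm (W (s k)) / r) ^ (n + 1)" using r by (intro mult_right_mono) auto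
    also have "\<dots> \<le> \<bar>C\<bar> * (m / r) ^ (n + 1)"
      using Wm[of k] r by (intro mult_left_mono power_mono divide_right_mono) auto
    finally have 1: "norm (E (W (s k))) \<le> \<bar>C\<bar> * (m / r) ^ (n + 1)" .
    have 2: "(1 - m)\<^sup>2 \<le> norm ((1 - of_real m * s k)\<^sup>2)"
      unfolding norm_power using norm_one_minus_ge[OF s1] m_less_1 by (intro power_mono) auto
    have "norm (E (W (s k)) / (1 - of_real m * s k)\<^sup>2) \<le> \<bar>C\<bar> * (m / r) ^ (n + 1) / (1 - m)\<^sup>2"
      unfolding norm_divide using 1 2 m_less_1 by (intro frac_le order_trans[OF norm_ge_zero 1]) auto
    then have "dil k * norm (E (W (s k)) / (1 - of_real m * s k)\<^sup>2) \<le> dil k * (\<bar>C\<bar> * (m / r) ^ (n + 1) / (1 - m)\<^sup>2)"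
      using dil_pos[of k] by (intro mult_left_mono) auto
    moreover have "norm (e k) = dil k * norm (E (W (s k)) / (1 - of_real m * s k)\<^sup>2)"
      unfolding e_def norm_mult norm_of_real using dil_pos[of k] by simp
    ultimately show "norm (e k) \<le> \<bar>C\<bar> * (m / r) ^ (n + 1) / (1 - m)\<^sup>2 * dil k" by (metis mult.commute)
  qed
  then have err: "norm ((- 1 / (1 - (of_real m)\<^sup>2)) * \<alpha> t - v * of_real m ^ n * orbit_sum n t) \<le> \<bar>C\<bar> * suminf dil / (1 - m)\<^sup>2 * (m / r) ^ (n + 1)"
    by (simp add: mult_ac)
  have sq: "complex_of_real (sqrt (real n)) * complex_of_real (sqrt (real n)) = of_real (real n)"
    by (simp only: of_real_mult[symmetric]) simp
  have sn: "complex_of_real (sqrt (real n)) \<noteq> 0" "complex_of_real m \<noteq> 0" using n m_pos by auto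
  have "Phi \<alpha> n t - v / of_real (sqrt (real n)) * (of_real (real n) * t * orbit_sum n t)
     = t * of_real (sqrt (real n) / m ^ n) * ((- 1 / (1 - (of_real m)\<^sup>2)) * \<alpha> t - v * of_real m ^ n * orbit_sum n t)"
    unfolding Phi_def sq[symmetric] using sn m2 by (simp add: field_simps)
  then have "norm (Phi \<alpha> n t - v / of_real (sqrt (real n)) * (of_real (real n) * t * orbit_sum n t))
     = norm t * (sqrt (real n) / m ^ n) * norm ((- 1 / (1 - (of_real m)\<^sup>2)) * \<alpha> t - v * of_real m ^ n * orbit_sum n t)"
    using m_pos by (simp only: norm_mult norm_of_real) simp
  also have "\<dots> \<le> 1 * (sqrt (real n) / m ^ n) * (\<bar>C\<bar> * suminf dil / (1 - m)\<^sup>2 * (m / r) ^ (n + 1))"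
    using horodisc_norm(2)[OF t] m_pos by (intro mult_mono err) auto
  also have "\<dots> = \<bar>C\<bar> * suminf dil / (1 - m)\<^sup>2 * (sqrt (real n) * (1 / r) ^ n) * (m / r)"
    using m_pos r by (simp add: power_divide mult_ac)
  also have "\<dots> \<le> \<bar>C\<bar> * suminf dil / (1 - m)\<^sup>2 * (sqrt (real n) * (1 / r) ^ n) * 1"
  proof (intro mult_left_mono)
    show "0 \<le> \<bar>C\<bar> * suminf dil / (1 - m)\<^sup>2 * (sqrt (real n) * (1 / r) ^ n)"
      using r dil_pos by (intro mult_nonneg_nonneg divide_nonneg_nonneg suminf_nonneg summable_dil) (auto intro: less_imp_le)
    show "m / r \<le> 1" using r m_less_1 by simp
  qed
  finally show ?thesis by (simp add: r_def)
qed

lemma uniform_limit_zero_by_bound: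
  fixes f :: "nat \<Rightarrow> 'a \<Rightarrow> complex"
  assumes "\<And>n t. n \<ge> N \<Longrightarrow> t \<in> K \<Longrightarrow> norm (f n t) \<le> b n" "b \<longlonglongrightarrow> 0"
  shows "uniform_limit K f (\<lambda>_. 0) sequentially"
proof (rule uniform_limitI)
  fix e :: real assume "e > 0"
  with assms(2) have "\<forall>\<^sub>F n in sequentially. b n < e" by (rule order_tendstoD)
  with eventually_ge_at_top[of N] show "\<forall>\<^sub>F n in sequentially. \<forall>t\<in>K. dist (f n t) 0 < e"
    by eventually_elim (use assms(1) in \<open>auto intro: le_less_trans\<close>)
qed

theorem Phi_asymptotics:
  assumes dec: "\<And>n::nat. decomposition C n (P n) (\<alpha> n) (E n) (v n) (c n)"
    and K: "compact K" "K \<subseteq> horodisc"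
  shows "uniform_limit K (\<lambda>n t. Phi (\<alpha> n) n t - chi R (of_real (real n) * t)) (\<lambda>_. 0) sequentially"
proof -
  obtain C1 where C1: "C1 \<ge> 0" "\<And>t n. t \<in> K \<Longrightarrow> n \<ge> 1 \<Longrightarrow> norm (of_real (real n) * t * orbit_sum n t - chi R (of_real (real n) * t)) \<le> C1 / sqrt (real n)"
    using orbit_sum_estimate[OF K] by blast
  have "K \<subseteq> {t. Re t > 0}" using K(2) horodisc_Re by auto
  from chi_bounded_on_rays[OF K(1) this]
  obtain B where B: "\<And>t s. t \<in> K \<Longrightarrow> s > 0 \<Longrightarrow> norm (chi R (of_real s * t)) \<le> B" by blast
  define r where "r = R - 1"
  have r: "r > 1" using R_minus_1 by (simp add: r_def)
  define A where "A = \<bar>C\<bar> * suminf dil / (1 - m)\<^sup>2"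
  define u where "u n = v n / of_real (sqrt (real n))" for n
  have u: "u \<longlonglongrightarrow> 1" unfolding u_def by (rule leading_coefficient_limit[OF dec])
  define b where "b n = A * (sqrt (real n) * (1 / r) ^ n) + (norm (u n) * (C1 / sqrt (real n)) + norm (u n - 1) * B)" for n
  show ?thesis
  proof (rule uniform_limit_zero_by_bound[of 1])
    fix n :: nat and t assume n: "n \<ge> 1" and t: "t \<in> K"
    define X where "X = of_real (real n) * t * orbit_sum n t"
    define Y where "Y = chi R (of_real (real n) * t)"
    have 1: "norm (Phi (\<alpha> n) n t - u n * X) \<le> A * (sqrt (real n) * (1 / r) ^ n)"
      unfolding A_def r_def u_def X_def using t K by (intro Phi_estimate[OF dec _ n]) auto
    have 2: "norm (X - Y) \<le> C1 / sqrt (real n)" unfolding X_def Y_def by (rule C1(2)[OF t n])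
    have 3: "norm Y \<le> B" unfolding Y_def using n by (intro B[OF t]) auto
    have "Phi (\<alpha> n) n t - Y = (Phi (\<alpha> n) n t - u n * X) + (u n * (X - Y) + (u n - 1) * Y)" by (simp add: algebra_simps)
    then have "norm (Phi (\<alpha> n) n t - Y) \<le> norm (Phi (\<alpha> n) n t - u n * X) + (norm (u n * (X - Y)) + norm ((u n - 1) * Y))"
      by (metis (no_types, lifting) norm_triangle_ineq order_trans add_left_mono)
    also have "\<dots> \<le> b n" unfolding b_def norm_mult using 1 2 3
      by (intro add_mono mult_left_mono) auto
    finally show "norm (Phi (\<alpha> n) n t - chi R (of_real (real n) * t)) \<le> b n" by (simp add: Y_def)
  next
    have "(\<lambda>n. norm (u n) * (C1 * (1 / sqrt (real n)))) \<longlonglongrightarrow> norm (1::complex) * (C1 * 0)"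
    proof (intro tendsto_intros u)
      have "filterlim (\<lambda>n. sqrt (real n)) at_top sequentially"
        by (rule filterlim_compose[OF sqrt_at_top filterlim_real_sequentially])
      then show "(\<lambda>n. 1 / sqrt (real n)) \<longlonglongrightarrow> 0"
        using tendsto_inverse_0_at_top by (simp add: inverse_eq_divide[symmetric])
    qed
    then have 1: "(\<lambda>n. norm (u n) * (C1 / sqrt (real n))) \<longlonglongrightarrow> 0" by simp
    have "(\<lambda>n. norm (u n - 1) * B) \<longlonglongrightarrow> norm (1 - 1 :: complex) * B" by (intro tendsto_intros u)
    then have 2: "(\<lambda>n. norm (u n - 1) * B) \<longlonglongrightarrow> 0" by simp
    have "(\<lambda>n. real n * (1 / r) ^ n) \<longlonglongrightarrow> 0" using r by (intro powser_times_n_limit_0) auto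
    moreover have "norm (sqrt (real n) * (1 / r) ^ n) \<le> real n * (1 / r) ^ n" for n :: nat
    proof -
      have "sqrt (real n) \<le> real n" by (cases n) (auto intro!: real_le_lsqrt simp: power2_eq_square)
      then show ?thesis using r by (simp add: mult_right_mono abs_mult)
    qed
    ultimately have "(\<lambda>n. sqrt (real n) * (1 / r) ^ n) \<longlonglongrightarrow> 0"
      by (intro Lim_null_comparison[of "\<lambda>n. sqrt (real n) * (1 / r) ^ n" "\<lambda>n. real n * (1 / r) ^ n"]) auto
    from tendsto_mult[OF tendsto_const this, of A] have "(\<lambda>n. A * (sqrt (real n) * (1 / r) ^ n)) \<longlonglongrightarrow> 0" by simp
    from tendsto_add[OF this tendsto_add[OF 1 2]] show "b \<longlonglongrightarrow> 0" unfolding b_def by simp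
  qed
qed

section \<open>The limit functions\<close>

lemma Dom_iff: "t \<in> Dom R \<longleftrightarrow> t \<in> horodisc \<and> flip t \<in> horodisc"
proof -
  have *: "flip t \<in> horodisc \<longleftrightarrow> Re t > R * m\<^sup>2 / 2" if "t \<in> horodisc"
  proof -
    have t0: "t \<noteq> 0" using horodisc_Re[OF that] by auto
    then have nt: "(norm t)\<^sup>2 > 0" by simp
    have "Re (flip t) = m\<^sup>2 * Re t / (norm t)\<^sup>2"
    proof -
      have "flip t = of_real (m\<^sup>2) * cnj t / of_real ((norm t)\<^sup>2)"
        using t0 by (simp add: complex_norm_square field_simps del: of_real_power) simp
      then show ?thesis by (simp add: Re_divide_of_real del: of_real_power)
    qed
    moreover have "(norm (flip t))\<^sup>2 = m ^ 4 / (norm t)\<^sup>2"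
      using m_pos by (simp add: norm_divide norm_power power_divide flip: power_mult)
    ultimately have "flip t \<in> horodisc \<longleftrightarrow> R * (m ^ 4 / (norm t)\<^sup>2) < 2 * (m\<^sup>2 * Re t / (norm t)\<^sup>2)"
      unfolding horodisc_iff by simp
    also have "\<dots> \<longleftrightarrow> m\<^sup>2 * (R * m\<^sup>2) < m\<^sup>2 * (2 * Re t)"
    proof -
      have e: "R * (m ^ 4 / N) = m\<^sup>2 * (R * m\<^sup>2) / N" "2 * (m\<^sup>2 * Re t / N) = m\<^sup>2 * (2 * Re t) / N" for N
        by (simp_all add: power4_eq_xxxx power2_eq_square)
      show ?thesis unfolding e divide_less_cancel using nt by simp
    qed
    also have "\<dots> \<longleftrightarrow> Re t > R * m\<^sup>2 / 2"
      by (subst mult_less_cancel_left_pos) (use m_pos in auto)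
    finally show ?thesis .
  qed
  show ?thesis using * unfolding Dom_def horodisc_def m_def by blast
qed

lemma open_Dom: "open (Dom R)"
  unfolding Dom_def by (intro open_Collect_conj open_Collect_less continuous_intros)

lemma Dom_D:
  assumes "t \<in> Dom R"
  shows "Re t > 0" "Re (flip t) > 0" "norm t < 1" "m\<^sup>2 < norm t" "t \<noteq> 0"
    "of_real m * t \<noteq> 1" "t \<noteq> of_real m ^ 3"
proof -
  have H: "t \<in> horodisc" "flip t \<in> horodisc" using assms Dom_iff by auto
  show "Re t > 0" "Re (flip t) > 0" "norm t < 1" using H horodisc_Re horodisc_norm by auto
  then show t0: "t \<noteq> 0" by auto
  have "norm (flip t) < 1" using H horodisc_norm by auto
  then show *: "m\<^sup>2 < norm t" using t0 by (simp add: norm_divide norm_power)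
  have "norm t < 1 / m"
  proof -
    have "1 < 1 / m" using m_pos m_less_1 by simp
    then show ?thesis using \<open>norm t < 1\<close> by linarith
  qed
  then show "of_real m * t \<noteq> 1" "t \<noteq> of_real m ^ 3" using annulus_regular * by blast+
qed

lemma m_in_Dom: "of_real m \<in> Dom R"
proof -
  have "of_real m \<in> horodisc"
  proof -
    have "R * m\<^sup>2 = m * (m\<^sup>2 + 1)" using m_pos by (subst R_eq) (simp add: field_simps power2_eq_square)
    also have "\<dots> < m * 2" using m_pos m2_less_1 by (intro mult_strict_left_mono) auto
    finally show ?thesis by (simp add: horodisc_iff)
  qed
  moreover have "(complex_of_real m)\<^sup>2 / of_real m = of_real m" using m_pos by (simp add: power2_eq_square)
  ultimately show ?thesis by (simp add: Dom_iff)
qed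

lemma Dom_denominator:
  assumes "t \<in> Dom R" "t \<noteq> of_real m"
  shows "t - flip t \<noteq> 0" "t\<^sup>2 - (of_real m)\<^sup>2 \<noteq> 0"
proof -
  have "t \<noteq> - of_real m" using Dom_D(1)[OF assms(1)] m_pos by auto
  then show *: "t\<^sup>2 - (of_real m)\<^sup>2 \<noteq> 0" using assms(2) by (simp add: power2_eq_iff)
  show "t - flip t \<noteq> 0" using * Dom_D(5)[OF assms(1)] by (simp add: field_simps power2_eq_square)
qed

definition prefactor :: "complex \<Rightarrow> complex" where
  "prefactor t = (1 - of_real m * t)\<^sup>2 * (1 - of_real (m ^ 3) / t)\<^sup>2 / of_real ((1 - m ^ 4) * R)"

lemma m4_ne_1: "complex_of_real m ^ 4 \<noteq> 1"
  using m4_less_1 by (metis less_irrefl of_real_1 of_real_eq_iff of_real_power)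

lemma continuous_prefactor: "continuous_on (Dom R) prefactor"
  unfolding prefactor_def using Dom_D m4_ne_1 R_gt_2 by (intro continuous_intros) auto

lemma holomorphic_prefactor: "prefactor holomorphic_on Dom R"
  unfolding prefactor_def using Dom_D m4_ne_1 R_gt_2 by (intro holomorphic_intros) auto

text \<open>The quotient is singular only at the fixed point \<open>m\<close> of the involution. Away from it the denominator is bounded
  below; near it the maximum principle transfers the bound from a circle to the disc inside.\<close>
lemma quotient_uniform_limit:
  assumes q: "\<And>k. k \<ge> N \<Longrightarrow> q k holomorphic_on Dom R"
    and eq: "\<And>k t. k \<ge> N \<Longrightarrow> t \<in> Dom R \<Longrightarrow> t \<noteq> of_real m \<Longrightarrow>
        q k t = prefactor t * ((E k t - E k (flip t)) / (t - flip t))"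
    and E: "\<And>K. compact K \<Longrightarrow> K \<subseteq> horodisc \<Longrightarrow> uniform_limit K E (\<lambda>_. 0) sequentially"
    and K: "compact K" "K \<subseteq> Dom R"
  shows "uniform_limit K q (\<lambda>_. 0) sequentially"
proof -
  obtain \<rho> where \<rho>: "\<rho> > 0" "cball (of_real m) \<rho> \<subseteq> Dom R"
    using open_Dom m_in_Dom open_contains_cball by blast
  \<comment> \<open>The disc around \<open>m\<close> is replaced by its boundary circle.\<close>
  define K' where "K' = (K \<union> cball (of_real m) \<rho>) - ball (of_real m) \<rho>"
  have K': "compact K'" "K' \<subseteq> Dom R"
    unfolding K'_def using K \<rho> by (auto intro!: compact_diff compact_Un)
  have nm: "t \<noteq> of_real m" if "t \<in> K'" for t using that \<rho>(1) by (auto simp: K'_def)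
  have inv: "continuous_on K' (\<lambda>t. flip t)" using K' Dom_D(5) by (intro continuous_intros) auto
  define K'' where "K'' = K' \<union> (\<lambda>t. flip t) ` K'"
  have K'': "compact K''" "K'' \<subseteq> horodisc"
    unfolding K''_def using K' inv by (auto intro!: compact_Un compact_continuous_image simp: subset_iff Dom_iff)
  define g where "g t = prefactor t / (t - flip t)" for t
  have "continuous_on K' g"
    unfolding g_def using K' Dom_denominator(1) nm Dom_D(5)
    by (intro continuous_intros continuous_on_subset[OF continuous_prefactor]) auto
  then have "bounded (g ` K')" using K'(1) compact_continuous_image compact_imp_bounded by blast
  then obtain B where B: "B > 0" "\<And>t. t \<in> K' \<Longrightarrow> norm (g t) \<le> B"
    unfolding bounded_pos by auto
  show ?thesis
  proof (rule uniform_limitI)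
    fix e :: real assume "e > 0"
    define d where "d = e / (4 * B)"
    have d: "d > 0" using \<open>e > 0\<close> B by (simp add: d_def)
    have "\<forall>\<^sub>F k in sequentially. \<forall>t\<in>K''. dist (E k t) 0 < d"
      using uniform_limitD[OF E[OF K''] d] .
    then show "\<forall>\<^sub>F k in sequentially. \<forall>t\<in>K. dist (q k t) 0 < e"
      using eventually_ge_at_top[of N]
    proof eventually_elim
      case (elim k)
      have b1: "norm (q k t) \<le> e / 2" if t: "t \<in> K'" for t
      proof -
        have "q k t = g t * (E k t - E k (flip t))"
          using eq[OF elim(2) _ nm[OF t]] t K' by (auto simp: g_def)
        moreover have "norm (E k t - E k (flip t)) \<le> 2 * d"
        proof -
          have "norm (E k t) < d" "norm (E k (flip t)) < d" using elim(1) t by (auto simp: K''_def)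
          then show ?thesis using norm_triangle_ineq4[of "E k t" "E k (flip t)"] by linarith
        qed
        ultimately have "norm (q k t) \<le> B * (2 * d)"
          unfolding norm_mult using B t by (auto intro!: mult_mono simp: norm_mult)
        also have "\<dots> = e / 2" using B by (simp add: d_def)
        finally show ?thesis .
      qed
      have b2: "norm (q k t) \<le> e / 2" if t: "t \<in> cball (of_real m) \<rho>" for t
      proof (rule maximum_modulus_frontier[of "q k" "cball (of_real m) \<rho>"])
        have hol: "q k holomorphic_on cball (of_real m) \<rho>" using q[OF elim(2)] \<rho>(2) by (rule holomorphic_on_subset)
        then show "q k holomorphic_on interior (cball (of_real m) \<rho>)" by (rule holomorphic_on_subset) auto
        show "continuous_on (closure (cball (of_real m) \<rho>)) (q k)"
          using holomorphic_on_imp_continuous_on[OF hol] by simp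
        show "norm (q k z) \<le> e / 2" if "z \<in> frontier (cball (of_real m) \<rho>)" for z
          using that \<rho>(1) by (intro b1) (auto simp: K'_def frontier_cball)
      qed (use t in auto)
      show ?case
      proof
        fix t assume "t \<in> K"
        then have "t \<in> K' \<or> t \<in> cball (of_real m) \<rho>" by (auto simp: K'_def)
        then have "norm (q k t) \<le> e / 2" using b1 b2 by blast
        then show "dist (q k t) 0 < e" using \<open>e > 0\<close> by simp
      qed
    qed
  qed
qed

lemma Re_scale: "Re (of_real s * z) = s * Re z"
  by simp

definition phase_scale :: "real \<Rightarrow> real" where "phase_scale q = m powr (4 * q)"

lemma phase_scale_pos: "phase_scale q > 0" using m_pos by (simp add: phase_scale_def)

lemma f_quot_eq:
  "f_quot R q t = prefactor t * ((chi R (of_real (phase_scale q) * t) - chi R (of_real (phase_scale q) * (flip t))) / (t - flip t))"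
proof -
  have "m powr (4 * q + 2) = phase_scale q * m\<^sup>2" using m_pos by (simp add: powr_add phase_scale_def)
  then show ?thesis
    unfolding f_quot_def prefactor_def m_def[symmetric] phase_scale_def[symmetric] by simp
qed

text \<open>The numerator is analytic and vanishes at \<open>t = m\<close>, so its quotient by \<open>t - m\<close> extends analytically; the value of
  \<open>f_lim\<close> at \<open>m\<close> is the value of this extension.\<close>
lemma f_lim_holomorphic: "f_lim R q holomorphic_on Dom R"
  and f_lim_eq: "t \<noteq> of_real m \<Longrightarrow> f_lim R q t = prefactor t * ((chi R (of_real (phase_scale q) * t) - chi R (of_real (phase_scale q) * (flip t))) / (t - flip t))"
proof -
  show "t \<noteq> of_real m \<Longrightarrow> f_lim R q t = prefactor t * ((chi R (of_real (phase_scale q) * t) - chi R (of_real (phase_scale q) * (flip t))) / (t - flip t))"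
    unfolding f_lim_def m_def[symmetric] f_quot_eq by simp
  define N where "N t = chi R (of_real (phase_scale q) * t) - chi R (of_real (phase_scale q) * (flip t))" for t
  have holN: "N holomorphic_on Dom R"
    unfolding N_def
  proof (intro holomorphic_intros)
    show "(\<lambda>t. chi R (of_real (phase_scale q) * t)) holomorphic_on Dom R"
      by (rule holomorphic_on_compose_gen[OF _ chi_holomorphic, unfolded o_def])
        (auto intro!: holomorphic_intros mult_pos_pos simp: Dom_D phase_scale_pos)
    show "(\<lambda>t. chi R (of_real (phase_scale q) * (flip t))) holomorphic_on Dom R"
    proof (rule holomorphic_on_compose_gen[OF _ chi_holomorphic, unfolded o_def])
      show "(\<lambda>t. of_real (phase_scale q) * (flip t)) holomorphic_on Dom R"
        using Dom_D(5) by (intro holomorphic_intros) auto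
      show "(\<lambda>t. of_real (phase_scale q) * (flip t)) ` Dom R \<subseteq> {t. Re t > 0}"
      proof
        fix z assume "z \<in> (\<lambda>t. of_real (phase_scale q) * (flip t)) ` Dom R"
        then obtain t where t: "t \<in> Dom R" "z = of_real (phase_scale q) * (flip t)" by blast
        have "Re z = phase_scale q * Re (flip t)" unfolding t(2) by (rule Re_scale)
        then show "z \<in> {t. Re t > 0}" using Dom_D(2)[OF t(1)] phase_scale_pos by simp
      qed
    qed
  qed
  have Nm: "N (of_real m) = 0" using m_pos by (simp add: N_def power2_eq_square)
  define h where "h t = (if t = of_real m then deriv N (of_real m) else (N t - N (of_real m)) / (t - of_real m))" for t
  have holh: "h holomorphic_on Dom R" unfolding h_def by (rule pole_lemma_open[OF holN open_Dom])
  define G where "G t = prefactor t * (t / (t + of_real m) * h t)" for t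
  have pm: "t + of_real m \<noteq> 0" if "t \<in> Dom R" for t
    using Dom_D(1)[OF that] m_pos by (auto simp: complex_eq_iff)
  have holG: "G holomorphic_on Dom R" unfolding G_def using pm by (intro holomorphic_intros holomorphic_prefactor holh) auto
  have qG: "f_quot R q t = G t" if "t \<in> Dom R" "t \<noteq> of_real m" for t
  proof -
    have t0: "t \<noteq> 0" "t - of_real m \<noteq> 0" using Dom_D[OF that(1)] that(2) by auto
    have "t - flip t = (t - of_real m) * (t + of_real m) / t"
      using t0 by (simp add: field_simps power2_eq_square)
    then have "N t / (t - flip t) = t / (t + of_real m) * (N t / (t - of_real m))"
      using t0 pm[OF that(1)] by (simp add: field_simps)
    then show ?thesis unfolding f_quot_eq G_def h_def N_def[symmetric] using that(2) Nm by simp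
  qed
  have "(G \<longlongrightarrow> G (of_real m)) (at (of_real m))"
    using holomorphic_on_imp_continuous_on[OF holG] open_Dom m_in_Dom
    by (simp add: continuous_on_eq_continuous_at isCont_def)
  then have "(f_quot R q \<longlongrightarrow> G (of_real m)) (at (of_real m))"
  proof (rule Lim_transform_within_open[OF _ open_Dom m_in_Dom])
    show "G t = f_quot R q t" if "t \<in> Dom R" "t \<noteq> of_real m" for t using qG[OF that] by simp
  qed
  then have "Lim (at (of_real m)) (f_quot R q) = G (of_real m)"
    by (intro tendsto_Lim) auto
  then have "f_lim R q t = G t" if "t \<in> Dom R" for t
    unfolding f_lim_def m_def[symmetric] using qG[OF that] by simp
  then show "f_lim R q holomorphic_on Dom R" using holomorphic_transform[OF holG] by metis
qed

lemma f_lim_periodic: "f_lim R (q + of_int j) = f_lim R q"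
proof -
  have s: "phase_scale (q + of_int j) = m powi (4 * j) * phase_scale q"
  proof -
    have "m powr (4 * of_int j) = m powi (4 * j)" using m_pos powr_real_of_int'[of m "4 * j"] by simp
    then show ?thesis using m_pos by (simp add: phase_scale_def distrib_left powr_add)
  qed
  have c: "chi R (of_real (phase_scale (q + of_int j)) * t) = chi R (of_real (phase_scale q) * t)" for t
    unfolding s of_real_mult mult.assoc by (rule chi_periodic)
  have e: "f_quot R (q + of_int j) = f_quot R q"
    unfolding fun_eq_iff f_quot_eq c by simp
  show ?thesis unfolding f_lim_def[abs_def] e ..
qed

text \<open>After the division by \<open>t - m\<^sup>2 / t\<close> has been dealt with, this is uniform continuity of \<open>\<chi>\<close> on compact sets.\<close>
lemma f_lim_continuous:
  assumes q: "qs \<longlonglongrightarrow> q" and K: "compact K" "K \<subseteq> Dom R"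
  shows "uniform_limit K (\<lambda>k. f_lim R (qs k)) (f_lim R q) sequentially"
proof -
  have "uniform_limit K (\<lambda>k t. f_lim R (qs k) t - f_lim R q t) (\<lambda>_. 0) sequentially"
  proof (rule quotient_uniform_limit[where N = 0 and E = "\<lambda>k t. chi R (of_real (phase_scale (qs k)) * t) - chi R (of_real (phase_scale q) * t)"])
    show "(\<lambda>t. f_lim R (qs k) t - f_lim R q t) holomorphic_on Dom R" for k
      by (intro holomorphic_intros f_lim_holomorphic)
    show "f_lim R (qs k) t - f_lim R q t = prefactor t *
        ((chi R (of_real (phase_scale (qs k)) * t) - chi R (of_real (phase_scale q) * t) -
          (chi R (of_real (phase_scale (qs k)) * (flip t)) - chi R (of_real (phase_scale q) * (flip t)))) / (t - flip t))"
      if "t \<noteq> of_real m" for k t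
      unfolding f_lim_eq[OF that] by (simp only: right_diff_distrib[symmetric] diff_divide_distrib[symmetric]) (simp add: algebra_simps)
    fix K :: "complex set" assume K: "compact K" "K \<subseteq> horodisc"
    have scl: "(\<lambda>k. phase_scale (qs k)) \<longlonglongrightarrow> phase_scale q" unfolding phase_scale_def using m_pos by (intro tendsto_intros q) auto
    define I where "I = {phase_scale q / 2 .. 2 * phase_scale q}"
    define T where "T = (\<lambda>(s, t). complex_of_real s * t) ` (I \<times> K)"
    have cT: "compact T" unfolding T_def I_def
      by (intro compact_continuous_image compact_Times K) (auto intro!: continuous_intros simp: case_prod_unfold)
    have "T \<subseteq> {t. Re t > 0}"
    proof
      fix z assume "z \<in> T"
      then obtain s t where "z = of_real s * t" "phase_scale q / 2 \<le> s" "t \<in> K" unfolding T_def I_def by auto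
      then show "z \<in> {t. Re t > 0}" using K(2) horodisc_Re phase_scale_pos[of q] by (auto intro!: mult_pos_pos)
    qed
    then have "uniformly_continuous_on T (chi R)"
      using cT holomorphic_on_imp_continuous_on[OF chi_holomorphic]
      by (intro compact_uniformly_continuous) (auto intro: continuous_on_subset)
    then have uc: "\<And>e. e > 0 \<Longrightarrow> \<exists>d>0. \<forall>x\<in>T. \<forall>x'\<in>T. dist x' x < d \<longrightarrow> dist (chi R x') (chi R x) < e"
      unfolding uniformly_continuous_on_def by blast
    show "uniform_limit K (\<lambda>k t. chi R (of_real (phase_scale (qs k)) * t) - chi R (of_real (phase_scale q) * t)) (\<lambda>_. 0) sequentially"
    proof (rule uniform_limitI)
      fix e :: real assume "e > 0"
      obtain d where d: "d > 0" "\<And>x x'. x \<in> T \<Longrightarrow> x' \<in> T \<Longrightarrow> dist x' x < d \<Longrightarrow> dist (chi R x') (chi R x) < e"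
        using uc[OF \<open>e > 0\<close>] by blast
      have s0: "phase_scale q > 0" by (rule phase_scale_pos)
      have "\<forall>\<^sub>F k in sequentially. dist (phase_scale (qs k)) (phase_scale q) < min d (phase_scale q / 2)"
        using scl by (rule tendstoD) (use d s0 in auto)
      then show "\<forall>\<^sub>F k in sequentially. \<forall>t\<in>K. dist (chi R (of_real (phase_scale (qs k)) * t) - chi R (of_real (phase_scale q) * t)) 0 < e"
      proof eventually_elim
        case (elim k)
        show ?case
        proof
          fix t assume t: "t \<in> K"
          have ab: "\<bar>phase_scale (qs k) - phase_scale q\<bar> < d" "\<bar>phase_scale (qs k) - phase_scale q\<bar> < phase_scale q / 2" using elim by (auto simp: dist_real_def)
          have "phase_scale (qs k) \<in> I" "phase_scale q \<in> I" using ab(2) s0 unfolding I_def abs_less_iff by auto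
          then have T: "of_real (phase_scale (qs k)) * t \<in> T" "of_real (phase_scale q) * t \<in> T" using t by (force simp: T_def)+
          have "dist (of_real (phase_scale (qs k)) * t) (of_real (phase_scale q) * t) = \<bar>phase_scale (qs k) - phase_scale q\<bar> * norm t"
            unfolding dist_norm left_diff_distrib[symmetric] of_real_diff[symmetric] norm_mult norm_of_real ..
          also have "\<dots> \<le> \<bar>phase_scale (qs k) - phase_scale q\<bar> * 1" using horodisc_norm(2)[of t] K(2) t by (intro mult_left_mono) auto
          finally have "dist (of_real (phase_scale (qs k)) * t) (of_real (phase_scale q) * t) < d" using ab(1) by simp
          then show "dist (chi R (of_real (phase_scale (qs k)) * t) - chi R (of_real (phase_scale q) * t)) 0 < e"
            using d(2)[OF T(2,1)] by (simp add: dist_norm)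
        qed
      qed
    qed
  qed (use K in auto)
  then show ?thesis unfolding uniform_limit_iff dist_norm by simp
qed

lemma phase_scale_log: "n > 0 \<Longrightarrow> phase_scale (log (mu R ^ 4) (real n)) = real n"
proof -
  assume n: "n > 0"
  have "ln m \<noteq> 0" using m_pos m_less_1 by simp
  have "m powr (4 * log (m ^ 4) (real n)) = exp (4 * (ln (real n) / ln (m ^ 4)) * ln m)"
    using m_pos by (simp add: powr_def log_def)
  also have "ln (m ^ 4) = 4 * ln m" using m_pos by (simp add: ln_realpow)
  also have "4 * (ln (real n) / (4 * ln m)) * ln m = ln (real n)" using \<open>ln m \<noteq> 0\<close> by simp
  finally show ?thesis using n by (simp add: phase_scale_def m_def)
qed

lemma scaled_PP_holomorphic: "scaled_PP R p n holomorphic_on Dom R"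
proof -
  have "Psi holomorphic_on Dom R"
  proof (rule holomorphic_onI)
    fix t assume "t \<in> Dom R"
    then have "(Psi has_field_derivative Psi' t) (at t)" by (intro has_field_derivative_Psi Dom_D)
    then show "Psi field_differentiable at t within Dom R"
      by (meson field_differentiable_at_within field_differentiable_def)
  qed
  then have "(\<lambda>t. of_real (sqrt (real n) / mu R ^ n) * poly (p n) (Psi t)) holomorphic_on Dom R"
    by (intro holomorphic_intros)
  then show ?thesis unfolding scaled_PP_def[abs_def] PP_def Psi_def .
qed

text \<open>Divide the symmetric representation of the pull-back by \<open>\<Psi>'\<close>; the prefactor is the explicit quotient
  \<open>-(1 - m\<^sup>2) (t - m\<^sup>2 / t) / (t \<Psi>'(t))\<close>.\<close>
lemma scaled_PP_eq:
  assumes dec: "decomposition C n (p n) \<alpha> E v c" and t: "t \<in> Dom R" "t \<noteq> of_real m"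
  shows "scaled_PP R p n t = prefactor t * ((Phi \<alpha> n t - Phi \<alpha> n (flip t)) / (t - flip t))"
proof -
  note D = Dom_D[OF t(1)]
  have rel: "poly (p n) (Psi t) * Psi' t = \<alpha> t - (of_real m / t)\<^sup>2 * \<alpha> (flip t)"
    using dec D(5-7) unfolding decomposition_def by blast
  have nz: "complex_of_real m \<noteq> 0" "1 - of_real m * t \<noteq> 0" "t - of_real m ^ 3 \<noteq> 0" "1 - (complex_of_real m)\<^sup>2 \<noteq> 0"
    "complex_of_real R \<noteq> 0" "t \<noteq> 0" "t\<^sup>2 - (of_real m)\<^sup>2 \<noteq> 0"
    using m_pos D R_gt_2 one_minus_m2_nz Dom_denominator[OF t] by auto
  have m4: "1 - complex_of_real m ^ 4 \<noteq> 0" using m4_ne_1 by simp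
  have Psi0: "Psi' t \<noteq> 0"
    unfolding Psi'_def using nz m4 by (auto simp: power2_eq_square)
  define S where "S = complex_of_real (sqrt (real n) / m ^ n)"
  have P: "Phi \<alpha> n t - Phi \<alpha> n (flip t) = - (t / (1 - (of_real m)\<^sup>2)) * (S * (\<alpha> t - (of_real m / t)\<^sup>2 * \<alpha> (flip t)))"
  proof -
    have g: "- (t * (S / y) * a) - - ((M\<^sup>2 / t) * (S / y) * b) = - (t / y) * (S * (a - (M / t)\<^sup>2 * b))"
      if "y \<noteq> 0" for y a b M :: complex
      using that nz(6) by (simp add: field_simps power2_eq_square)
    have S: "complex_of_real (sqrt (real n) / m ^ n / (1 - m\<^sup>2)) = S / (1 - (of_real m)\<^sup>2)" by (simp add: S_def)
    show ?thesis unfolding Phi_def S by (rule g[OF nz(4)])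
  qed
  have "scaled_PP R p n t = S * (poly (p n) (Psi t) * Psi' t) / Psi' t"
    unfolding scaled_PP_def PP_def Psi_def[symmetric] S_def m_def[symmetric] using Psi0 by simp
  also have "\<dots> = (Phi \<alpha> n t - Phi \<alpha> n (flip t)) * (- (1 - (of_real m)\<^sup>2) / (t * Psi' t))"
  proof -
    have g: "S * X / P' = (- (t / y) * (S * X)) * (- y / (t * P'))" if "y \<noteq> 0" "P' \<noteq> 0" for X y P' :: complex
      using that nz(6) by (simp add: field_simps)
    show ?thesis unfolding rel P by (rule g[OF nz(4) Psi0])
  qed
  also have "- (1 - (of_real m)\<^sup>2) / (t * Psi' t) = prefactor t / (t - flip t)"
  proof -
    define M where "M = complex_of_real m"
    define a where "a = 1 - M * t"
    define b where "b = t - M ^ 3"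
    define d where "d = t\<^sup>2 - M\<^sup>2"
    have M4: "1 - M ^ 4 = (1 - M\<^sup>2) * (1 + M\<^sup>2)" by (simp add: algebra_simps power4_eq_xxxx power2_eq_square)
    have nn: "M \<noteq> 0" "a \<noteq> 0" "b \<noteq> 0" "d \<noteq> 0" "1 - M\<^sup>2 \<noteq> 0" "1 + M\<^sup>2 \<noteq> 0"
      using nz m4 M4[unfolded M_def] unfolding M_def a_def b_def d_def by auto
    have R: "complex_of_real R = (1 + M\<^sup>2) / M"
    proof -
      have "complex_of_real R = M + 1 / M" unfolding M_def by (subst R_eq) simp
      then show ?thesis using nn(1) by (simp add: field_simps power2_eq_square)
    qed
    have sq: "(M * t - 1)\<^sup>2 = a\<^sup>2" by (simp add: a_def power2_commute)
    have Pe: "Psi' t = - ((1 - M ^ 4)\<^sup>2 * d) / (M * a\<^sup>2 * b\<^sup>2)"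
      unfolding Psi'_def M_def[symmetric] d_def[symmetric] b_def[symmetric] sq ..
    have pe: "prefactor t = a\<^sup>2 * (b / t)\<^sup>2 / ((1 - M ^ 4) * ((1 + M\<^sup>2) / M))"
    proof -
      have "1 - complex_of_real (m ^ 3) / t = b / t" using nz(6) by (simp add: b_def M_def field_simps)
      then show ?thesis unfolding prefactor_def R[symmetric] by (simp add: a_def M_def)
    qed
    have de: "t - M\<^sup>2 / t = d / t" using nz(6) by (simp add: d_def field_simps power2_eq_square)
    have "- y / (t * (- ((y * z)\<^sup>2 * d) / (M * a\<^sup>2 * b\<^sup>2))) = a\<^sup>2 * (b / t)\<^sup>2 / ((y * z) * (z / M)) / (d / t)"
      if "y \<noteq> 0" "z \<noteq> 0" for y z
      using that nn(1-4) nz(6) by (simp add: field_simps power2_eq_square)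
    then show ?thesis
      unfolding M_def[symmetric] Pe pe de M4 using nn(5,6) by blast
  qed
  finally show ?thesis by simp
qed

theorem scaled_PP_asymptotics:
  assumes orth: "orthonormal_polys R p" and K: "compact K" "K \<subseteq> Dom R"
  shows "uniform_limit K (\<lambda>n t. scaled_PP R p n t - f_lim R (log (mu R ^ 4) (real n)) t) (\<lambda>_. 0) sequentially"
proof -
  obtain C where "\<forall>n. \<exists>\<alpha> E v c. decomposition C n (p n) \<alpha> E v c"
    using orthonormal_decomposition[OF orth] by blast
  then obtain \<alpha> E v c where dec: "\<And>n. decomposition C n (p n) (\<alpha> n) (E n) (v n) (c n)" by metis
  show ?thesis
  proof (rule quotient_uniform_limit[where N = 1 and E = "\<lambda>n t. Phi (\<alpha> n) n t - chi R (of_real (real n) * t)"])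
    show "(\<lambda>t. scaled_PP R p n t - f_lim R (log (mu R ^ 4) (real n)) t) holomorphic_on Dom R" for n
      by (intro holomorphic_intros scaled_PP_holomorphic f_lim_holomorphic)
    show "scaled_PP R p n t - f_lim R (log (mu R ^ 4) (real n)) t = prefactor t *
       ((Phi (\<alpha> n) n t - chi R (of_real (real n) * t) - (Phi (\<alpha> n) n (flip t) - chi R (of_real (real n) * (flip t)))) /
        (t - flip t))" if "n \<ge> 1" "t \<in> Dom R" "t \<noteq> of_real m" for n t
      unfolding scaled_PP_eq[OF dec that(2,3)] f_lim_eq[OF that(3)] using that(1)
      by (simp only: phase_scale_log right_diff_distrib[symmetric] diff_divide_distrib[symmetric]) (simp add: phase_scale_log algebra_simps)
  qed (use K Phi_asymptotics[OF dec] in auto)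
qed

end

section \<open>Different phases give different limits\<close>

lemma integral_exp_imaginary:
  fixes l :: real
  assumes "l \<noteq> 0" "0 \<le> Y"
  shows "norm (integral {0..Y} (\<lambda>\<eta>. exp (\<i> * of_real (l * \<eta>)))) \<le> 2 / \<bar>l\<bar>"
proof -
  have "((\<lambda>\<eta>. exp (\<i> * of_real (l * \<eta>))) has_integral
     (exp (\<i> * of_real (l * Y)) / (\<i> * of_real l) - exp (\<i> * of_real (l * 0)) / (\<i> * of_real l))) {0..Y}"
  proof (rule fundamental_theorem_of_calculus[OF assms(2)])
    fix x assume "x \<in> {0..Y}"
    have "((\<lambda>z. exp (\<i> * (of_real l * z)) / (\<i> * of_real l)) has_field_derivative exp (\<i> * (of_real l * of_real x))) (at (of_real x))"
    proof -
      have "((\<lambda>z. \<i> * (of_real l * z)) has_field_derivative \<i> * of_real l) (at (of_real x))"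
        by (auto intro!: derivative_eq_intros)
      from DERIV_cdivide[OF DERIV_chain2[OF DERIV_exp this], of "\<i> * of_real l"]
      show ?thesis using assms(1) by simp
    qed
    then have "((\<lambda>\<eta>. exp (\<i> * (of_real l * of_real \<eta>)) / (\<i> * of_real l)) has_vector_derivative exp (\<i> * (of_real l * of_real x))) (at x within {0..Y})"
      by (rule has_vector_derivative_real_field)
    then show "((\<lambda>\<eta>. exp (\<i> * of_real (l * \<eta>)) / (\<i> * of_real l)) has_vector_derivative exp (\<i> * of_real (l * x))) (at x within {0..Y})"
      by simp
  qed
  then have "integral {0..Y} (\<lambda>\<eta>. exp (\<i> * of_real (l * \<eta>))) = (exp (\<i> * of_real (l * Y)) - 1) / (\<i> * of_real l)"
    by (simp add: integral_unique diff_divide_distrib)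
  moreover have "norm (exp (\<i> * of_real (l * Y)) - 1) \<le> 2"
    using norm_triangle_ineq4[of "exp (\<i> * of_real (l * Y))" 1] norm_exp_i_times[of "l * Y"] by (simp del: of_real_mult)
  ultimately show ?thesis using assms(1) by (simp add: norm_divide norm_mult divide_right_mono)
qed

text \<open>The bound on the integral does not grow with the length of the interval: nonzero frequencies average out.\<close>
lemma integral_exp_series:
  fixes c :: "nat \<Rightarrow> complex" and l :: "nat \<Rightarrow> real"
  assumes c: "summable (\<lambda>k. norm (c k))" and g: "g > 0" "\<And>k. g \<le> \<bar>l k\<bar>" and Y: "0 \<le> Y"
  shows "(\<lambda>\<eta>. \<Sum>k. c k * exp (\<i> * of_real (l k * \<eta>))) integrable_on {0..Y}"
    and "norm (integral {0..Y} (\<lambda>\<eta>. \<Sum>k. c k * exp (\<i> * of_real (l k * \<eta>)))) \<le> 2 / g * (\<Sum>k. norm (c k))"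
proof -
  define F where "F n \<eta> = (\<Sum>k<n. c k * exp (\<i> * of_real (l k * \<eta>)))" for n \<eta>
  define G where "G \<eta> = (\<Sum>k. c k * exp (\<i> * of_real (l k * \<eta>)))" for \<eta>
  have "uniform_limit {0..Y} F G sequentially"
    unfolding F_def G_def
    by (rule Weierstrass_m_test[OF _ c]) (simp add: norm_mult norm_exp_i_times del: of_real_mult)
  moreover have ci: "continuous_on {0..Y} (F n)" for n unfolding F_def by (intro continuous_intros)
  ultimately obtain I J where IJ: "\<And>n. (F n has_integral I n) {0..Y}" "(G has_integral J) {0..Y}" "I \<longlonglongrightarrow> J"
    by (rule uniform_limit_integral) auto
  show "(\<lambda>\<eta>. \<Sum>k. c k * exp (\<i> * of_real (l k * \<eta>))) integrable_on {0..Y}"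
    using IJ(2) unfolding G_def by blast
  have l0: "l k \<noteq> 0" for k using g(1) g(2)[of k] by auto
  have "norm (I n) \<le> 2 / g * (\<Sum>k. norm (c k))" for n
  proof -
    have "I n = integral {0..Y} (F n)" using integral_unique[OF IJ(1)[of n]] by simp
    also have "\<dots> = (\<Sum>k<n. c k * integral {0..Y} (\<lambda>\<eta>. exp (\<i> * of_real (l k * \<eta>))))"
      unfolding F_def
      by (subst integral_sum) (auto intro!: integrable_continuous_interval continuous_intros)
    also have "norm \<dots> \<le> (\<Sum>k<n. norm (c k) * (2 / g))"
    proof (rule sum_norm_le)
      fix k
      have "norm (integral {0..Y} (\<lambda>\<eta>. exp (\<i> * of_real (l k * \<eta>)))) \<le> 2 / \<bar>l k\<bar>"
        by (rule integral_exp_imaginary[OF l0 Y])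
      also have "\<dots> \<le> 2 / g" using g(1) g(2)[of k] by (intro divide_left_mono) auto
      finally show "norm (c k * integral {0..Y} (\<lambda>\<eta>. exp (\<i> * of_real (l k * \<eta>)))) \<le> norm (c k) * (2 / g)"
        unfolding norm_mult by (intro mult_left_mono) auto
    qed
    also have "\<dots> = 2 / g * (\<Sum>k<n. norm (c k))" by (simp add: sum_distrib_left sum_distrib_right mult.commute)
    also have "\<dots> \<le> 2 / g * (\<Sum>k. norm (c k))"
      using g(1) by (intro mult_left_mono sum_le_suminf c) auto
    finally show ?thesis .
  qed
  then have "norm J \<le> 2 / g * (\<Sum>k. norm (c k))"
    using IJ(3) by (intro Lim_norm_ubound[of sequentially I J]) auto
  then show "norm (integral {0..Y} (\<lambda>\<eta>. \<Sum>k. c k * exp (\<i> * of_real (l k * \<eta>)))) \<le> 2 / g * (\<Sum>k. norm (c k))"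
    using IJ(2) unfolding G_def by (simp add: integral_unique)
qed

context joukowski_disc
begin

text \<open>This is \<open>\<chi>(t) / t\<close>, a Dirichlet series with positive frequencies \<open>\<kappa> m^(4k)\<close> and therefore almost periodic on vertical
  lines.\<close>
definition chi_quot :: "complex \<Rightarrow> complex" where "chi_quot t = chi_pos t + chi_neg t"

lemma chi_eq_chi_quot: "Re t > 0 \<Longrightarrow> chi R t = t * chi_quot t"
  by (simp add: chi_eq chi_quot_def)

lemma chi_quot_holomorphic: "chi_quot holomorphic_on {t. Re t > 0}"
proof -
  have "(\<lambda>t. chi R t / t) holomorphic_on {t. Re t > 0}"
    by (intro holomorphic_intros chi_holomorphic) auto
  then show ?thesis by (rule holomorphic_transform) (auto simp: chi_eq_chi_quot)
qed

lemma norm_chi_quot_le: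
  assumes "\<delta> > 0" "Re t \<ge> \<delta>"
  shows "norm (chi_quot t) \<le> suminf dil + 2 / (\<kappa> * \<delta>)\<^sup>2 * (\<Sum>k. dil (Suc k))"
proof -
  have s: "summable (\<lambda>k. dil (Suc k))" using summable_dil summable_Suc_iff by blast
  have "norm (chi_pos t) \<le> suminf dil"
    unfolding chi_pos_def using assms
    by (intro norm_suminf_le summable_dil norm_chi_term_pos) auto
  moreover have "norm (chi_neg t) \<le> (\<Sum>k. 2 / (\<kappa> * \<delta>)\<^sup>2 * dil (Suc k))"
    unfolding chi_neg_def using assms
    by (intro norm_suminf_le summable_mult s norm_chi_term_neg) auto
  moreover have "(\<Sum>k. 2 / (\<kappa> * \<delta>)\<^sup>2 * dil (Suc k)) = 2 / (\<kappa> * \<delta>)\<^sup>2 * (\<Sum>k. dil (Suc k))"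
    by (rule suminf_mult[OF s])
  ultimately show ?thesis unfolding chi_quot_def by (intro order_trans[OF norm_triangle_ineq]) simp
qed

text \<open>A term of the Dirichlet series on the line \<open>Re t = 1\<close>, shifted upwards by \<open>N\<close>, tested against the frequency \<open>\<kappa> a\<close>.\<close>
definition modulated :: "real \<Rightarrow> real \<Rightarrow> real \<Rightarrow> real \<Rightarrow> complex" where
  "modulated a z N \<eta> = chi_term z (1 + \<i> * of_real (\<eta> + N)) * exp (\<i> * of_real (\<kappa> * a * \<eta>))"

lemma modulated_eq: "modulated a z N \<eta> = (of_real (z * exp (- \<kappa> * z)) * exp (- \<i> * of_real (\<kappa> * z * N))) * exp (\<i> * of_real (\<kappa> * (a - z) * \<eta>))"
proof -
  have "- of_real (\<kappa> * z) * (1 + \<i> * of_real (\<eta> + N)) + \<i> * of_real (\<kappa> * a * \<eta>)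
     = of_real (- \<kappa> * z) + - \<i> * of_real (\<kappa> * z * N) + \<i> * of_real (\<kappa> * (a - z) * \<eta>)"
    by (simp add: algebra_simps)
  then have "exp (- of_real (\<kappa> * z) * (1 + \<i> * of_real (\<eta> + N))) * exp (\<i> * of_real (\<kappa> * a * \<eta>))
     = of_real (exp (- \<kappa> * z)) * exp (- \<i> * of_real (\<kappa> * z * N)) * exp (\<i> * of_real (\<kappa> * (a - z) * \<eta>))"
    unfolding exp_add[symmetric] exp_of_real[symmetric] by simp
  then show ?thesis unfolding modulated_def chi_term_def by (simp add: mult.assoc)
qed

lemma norm_modulated_coeff: "z > 0 \<Longrightarrow> norm (of_real (z * exp (- \<kappa> * z)) * exp (- \<i> * of_real (\<kappa> * z * N)) :: complex) = z * exp (- \<kappa> * z)"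
  using norm_exp_i_times[of "- (\<kappa> * z * N)"] by (simp add: norm_mult)

text \<open>The series of \<open>z \<chi>(z t) / (z t)\<close> without its term of frequency \<open>\<kappa> z\<close>.\<close>
definition chi_quot_tail :: "real \<Rightarrow> complex \<Rightarrow> complex" where
  "chi_quot_tail z t = (\<Sum>k. chi_term (z * dil (Suc k)) t) + (\<Sum>k. chi_term (z / dil (Suc k)) t)"

lemma chi_quot_split:
  assumes "z > 0" "Re t > 0"
  shows "of_real z * chi_quot (of_real z * t) = chi_term z t + chi_quot_tail z t"
proof -
  have R: "Re (of_real z * t) > 0" using assms by simp
  have p: "summable (\<lambda>k. chi_term (dil k) (of_real z * t))"
    using R by (intro summable_norm_cancel[OF summable_chi_pos]) simp
  have n: "summable (\<lambda>k. chi_term (1 / dil (Suc k)) (of_real z * t))"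
    using R by (intro summable_norm_cancel[OF summable_chi_neg])
  have "of_real z * chi_pos (of_real z * t) = (\<Sum>k. chi_term (z * dil k) t)"
    unfolding chi_pos_def suminf_mult[OF p, symmetric] chi_term_scale ..
  also have "\<dots> = chi_term z t + (\<Sum>k. chi_term (z * dil (Suc k)) t)"
  proof -
    have "summable (\<lambda>k. chi_term (z * dil k) t)"
      using summable_mult[OF p, of "of_real z"] unfolding chi_term_scale .
    from suminf_split_head[OF this] show ?thesis by (simp add: dil_def)
  qed
  finally have 1: "of_real z * chi_pos (of_real z * t) = chi_term z t + (\<Sum>k. chi_term (z * dil (Suc k)) t)" .
  have 2: "of_real z * chi_neg (of_real z * t) = (\<Sum>k. chi_term (z / dil (Suc k)) t)"
    unfolding chi_neg_def suminf_mult[OF n, symmetric] chi_term_scale by simp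
  show ?thesis unfolding chi_quot_def chi_quot_tail_def distrib_left 1 2 by simp
qed

lemma modulated_series_average_bound:
  assumes z: "\<And>k. z k > 0" and s: "summable (\<lambda>k. z k * exp (- \<kappa> * z k))" and g: "g > 0" "\<And>k. g \<le> \<bar>a - z k\<bar>"
  shows "\<exists>C\<ge>0. \<forall>N Y. 0 \<le> Y \<longrightarrow> (\<lambda>\<eta>. \<Sum>k. modulated a (z k) N \<eta>) integrable_on {0..Y} \<and>
     norm (integral {0..Y} (\<lambda>\<eta>. \<Sum>k. modulated a (z k) N \<eta>)) \<le> C"
proof (intro exI[of _ "2 / (\<kappa> * g) * (\<Sum>k. z k * exp (- \<kappa> * z k))"] conjI allI impI)
  show "0 \<le> 2 / (\<kappa> * g) * (\<Sum>k. z k * exp (- \<kappa> * z k))"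
    using \<kappa>_pos g z by (intro mult_nonneg_nonneg suminf_nonneg s) (auto intro: less_imp_le)
  fix N Y :: real assume Y: "0 \<le> Y"
  define c where "c k = (of_real (z k * exp (- \<kappa> * z k)) * exp (- \<i> * of_real (\<kappa> * z k * N)) :: complex)" for k
  have nc: "norm (c k) = z k * exp (- \<kappa> * z k)" for k unfolding c_def by (rule norm_modulated_coeff[OF z])
  have o: "modulated a (z k) N \<eta> = c k * exp (\<i> * of_real (\<kappa> * (a - z k) * \<eta>))" for k \<eta>
    unfolding modulated_eq c_def ..
  have g': "\<kappa> * g > 0" "\<kappa> * g \<le> \<bar>\<kappa> * (a - z k)\<bar>" for k
    using \<kappa>_pos g(1) g(2)[of k] by (auto simp: abs_mult)
  have sumc: "summable (\<lambda>k. norm (c k))" unfolding nc by (rule s)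
  show "(\<lambda>\<eta>. \<Sum>k. modulated a (z k) N \<eta>) integrable_on {0..Y}"
    unfolding o by (rule integral_exp_series(1)[OF sumc g' Y])
  show "norm (integral {0..Y} (\<lambda>\<eta>. \<Sum>k. modulated a (z k) N \<eta>)) \<le> 2 / (\<kappa> * g) * (\<Sum>k. z k * exp (- \<kappa> * z k))"
    unfolding o using integral_exp_series(2)[OF sumc g' Y] unfolding nc .
qed

text \<open>If \<open>z\<close> is within a factor \<open>m^4\<close> of \<open>a\<close>, all frequencies \<open>z m^(4k)\<close> with \<open>k \<noteq> 0\<close> keep a positive distance from \<open>a\<close>.\<close>
lemma chi_quot_tail_average_bound:
  assumes a: "a > 0" and z: "m ^ 4 * a < z" "z < a / m ^ 4"
  shows "\<exists>C\<ge>0. \<forall>N Y. 0 \<le> Y \<longrightarrow> 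
     (\<lambda>\<eta>. chi_quot_tail z (1 + \<i> * of_real (\<eta> + N)) * exp (\<i> * of_real (\<kappa> * a * \<eta>))) integrable_on {0..Y} \<and>
     norm (integral {0..Y} (\<lambda>\<eta>. chi_quot_tail z (1 + \<i> * of_real (\<eta> + N)) * exp (\<i> * of_real (\<kappa> * a * \<eta>)))) \<le> C"
proof -
  have m4: "m ^ 4 > 0" using m_pos by simp
  have z0: "z > 0" using z(1) a m4 by (meson less_trans mult_pos_pos)
  define \<theta> where "\<theta> = max (m ^ 4 * z / a) (m ^ 4 * a / z)"
  have th: "0 < \<theta>" "\<theta> < 1" "m ^ 4 * z \<le> \<theta> * a" "m ^ 4 * a \<le> \<theta> * z"
  proof -
    have "m ^ 4 * z / a < 1" "m ^ 4 * a / z < 1" using a z z0 m4 by (auto simp: field_simps)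
    then show "\<theta> < 1" by (simp add: \<theta>_def)
    have "0 < m ^ 4 * z / a" using a z0 m4 by simp
    then show "0 < \<theta>" by (simp add: \<theta>_def less_max_iff_disj)
    have "m ^ 4 * z / a \<le> \<theta>" "m ^ 4 * a / z \<le> \<theta>" by (simp_all add: \<theta>_def)
    then show "m ^ 4 * z \<le> \<theta> * a" "m ^ 4 * a \<le> \<theta> * z" using a z0 by (simp_all add: pos_divide_le_eq)
  qed
  define g where "g = a * (1 - \<theta>)"
  have g: "g > 0" using a th by (simp add: g_def)
  have x: "dil (Suc k) \<le> m ^ 4" "dil (Suc k) > 0" for k
    using dil_le_1[of k] dil_pos[of "Suc k"] m4 by (auto simp: dil_Suc mult_left_le)
  have b1: "z * dil (Suc k) \<le> \<theta> * a" for k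
  proof -
    have "z * dil (Suc k) \<le> z * m ^ 4" using z0 x(1)[of k] by (intro mult_left_mono) auto
    then show ?thesis using th(3) by (simp only: mult.commute[of z])
  qed
  have b2: "a \<le> \<theta> * (z / dil (Suc k))" for k
  proof -
    have "a * dil (Suc k) \<le> a * m ^ 4" using a x(1)[of k] by (intro mult_left_mono) auto
    also have "\<dots> \<le> \<theta> * z" using th(4) by (simp add: mult.commute)
    finally show ?thesis using x(2)[of k] by (simp add: pos_le_divide_eq)
  qed
  have g1: "g \<le> \<bar>a - z * dil (Suc k)\<bar>" for k
    using b1[of k] by (simp add: g_def algebra_simps)
  have g2: "g \<le> \<bar>a - z / dil (Suc k)\<bar>" for k
  proof -
    define w where "w = z / dil (Suc k)"
    have "a \<le> \<theta> * w" using b2[of k] by (simp add: w_def)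
    then have "a * (1 - \<theta>) \<le> \<theta> * w * (1 - \<theta>)" using th by (intro mult_right_mono) auto
    also have "\<dots> \<le> w * (1 - \<theta>)" 
    proof (intro mult_right_mono mult_left_le_one_le)
      show "0 \<le> w" using z0 x(2)[of k] by (simp add: w_def)
    qed (use th in auto)
    also have "\<dots> = w - \<theta> * w" by (simp add: algebra_simps)
    also have "\<dots> \<le> w - a" using \<open>a \<le> \<theta> * w\<close> by simp
    finally show ?thesis unfolding g_def w_def[symmetric] by simp
  qed
  have Rz: "Re (of_real z :: complex) > 0" using z0 by simp
  have n1: "z * dil k * exp (- \<kappa> * (z * dil k)) = z * norm (chi_term (dil k) (of_real z))" for k
    using dil_pos[of k] by (simp add: norm_chi_term mult_ac)
  have n2: "z / dil k * exp (- \<kappa> * (z / dil k)) = z * norm (chi_term (1 / dil k) (of_real z))" for k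
    using dil_pos[of k] by (simp add: norm_chi_term mult_ac)
  have "summable (\<lambda>k. norm (chi_term (dil (Suc k)) (of_real z)))"
    by (subst summable_Suc_iff, rule summable_chi_pos) (use Rz in simp)
  then have s1: "summable (\<lambda>k. z * dil (Suc k) * exp (- \<kappa> * (z * dil (Suc k))))"
    unfolding n1 by (rule summable_mult)
  have s2: "summable (\<lambda>k. z / dil (Suc k) * exp (- \<kappa> * (z / dil (Suc k))))"
    unfolding n2 by (rule summable_mult[OF summable_chi_neg[OF Rz]])
  obtain C1 where C1: "C1 \<ge> 0" "\<And>N Y. 0 \<le> Y \<Longrightarrow> (\<lambda>\<eta>. \<Sum>k. modulated a (z * dil (Suc k)) N \<eta>) integrable_on {0..Y}"
    "\<And>N Y. 0 \<le> Y \<Longrightarrow> norm (integral {0..Y} (\<lambda>\<eta>. \<Sum>k. modulated a (z * dil (Suc k)) N \<eta>)) \<le> C1"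
    using modulated_series_average_bound[OF _ s1 g g1] z0 x(2) by (metis mult_pos_pos)
  obtain C2 where C2: "C2 \<ge> 0" "\<And>N Y. 0 \<le> Y \<Longrightarrow> (\<lambda>\<eta>. \<Sum>k. modulated a (z / dil (Suc k)) N \<eta>) integrable_on {0..Y}"
    "\<And>N Y. 0 \<le> Y \<Longrightarrow> norm (integral {0..Y} (\<lambda>\<eta>. \<Sum>k. modulated a (z / dil (Suc k)) N \<eta>)) \<le> C2"
    using modulated_series_average_bound[OF _ s2 g g2] z0 x(2) by (metis divide_pos_pos)
  have eq: "chi_quot_tail z (1 + \<i> * of_real (\<eta> + N)) * exp (\<i> * of_real (\<kappa> * a * \<eta>)) =
     (\<Sum>k. modulated a (z * dil (Suc k)) N \<eta>) + (\<Sum>k. modulated a (z / dil (Suc k)) N \<eta>)" for \<eta> N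
  proof -
    define t where "t = 1 + \<i> * complex_of_real (\<eta> + N)"
    have R: "Re (of_real z * t) > 0" using z0 by (simp add: t_def)
    have "summable (\<lambda>k. chi_term (dil (Suc k)) (of_real z * t))"
      by (subst summable_Suc_iff, rule summable_norm_cancel[OF summable_chi_pos]) (use R in simp)
    from summable_mult[OF this, of "of_real z"] have sm1: "summable (\<lambda>k. chi_term (z * dil (Suc k)) t)"
      unfolding chi_term_scale .
    from summable_mult[OF summable_norm_cancel[OF summable_chi_neg[OF R]], of "of_real z"]
    have sm2: "summable (\<lambda>k. chi_term (z / dil (Suc k)) t)" unfolding chi_term_scale by simp
    show ?thesis unfolding modulated_def t_def[symmetric] chi_quot_tail_def distrib_right
      by (simp only: suminf_mult2[OF sm1] suminf_mult2[OF sm2])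
  qed
  show ?thesis
  proof (intro exI[of _ "C1 + C2"] conjI allI impI)
    fix N Y :: real assume Y: "0 \<le> Y"
    show "(\<lambda>\<eta>. chi_quot_tail z (1 + \<i> * of_real (\<eta> + N)) * exp (\<i> * of_real (\<kappa> * a * \<eta>))) integrable_on {0..Y}"
      unfolding eq by (intro integrable_add C1(2) C2(2) Y)
    show "norm (integral {0..Y} (\<lambda>\<eta>. chi_quot_tail z (1 + \<i> * of_real (\<eta> + N)) * exp (\<i> * of_real (\<kappa> * a * \<eta>)))) \<le> C1 + C2"
      unfolding eq integral_add[OF C1(2)[OF Y] C2(2)[OF Y]]
      by (intro order_trans[OF norm_triangle_ineq] add_mono C1(3) C2(3) Y)
  qed (use C1 C2 in simp)
qed

text \<open>Only a frequency equal to \<open>a\<close> contributes an amount proportional to the length \<open>Y\<close>; everything else is bounded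
  uniformly in \<open>Y\<close> and in the shift \<open>N\<close>.\<close>
lemma chi_quot_average:
  assumes a: "a > 0" and z: "m ^ 4 * a < z" "z < a / m ^ 4"
  shows "\<exists>C\<ge>0. \<forall>N Y. 0 \<le> Y \<longrightarrow> 
     (\<lambda>\<eta>. of_real z * chi_quot (of_real z * (1 + \<i> * of_real (\<eta> + N))) * exp (\<i> * of_real (\<kappa> * a * \<eta>))) integrable_on {0..Y} \<and>
     norm (integral {0..Y} (\<lambda>\<eta>. of_real z * chi_quot (of_real z * (1 + \<i> * of_real (\<eta> + N))) * exp (\<i> * of_real (\<kappa> * a * \<eta>)))
       - (if z = a then of_real (Y * a * exp (- \<kappa> * a)) * exp (- \<i> * of_real (\<kappa> * a * N)) else 0)) \<le> C"
proof -
  have z0: "z > 0" using z(1) a m_pos by (meson less_trans mult_pos_pos zero_less_power)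
  obtain C where C: "C \<ge> 0" "\<And>N Y. 0 \<le> Y \<Longrightarrow> 
     (\<lambda>\<eta>. chi_quot_tail z (1 + \<i> * of_real (\<eta> + N)) * exp (\<i> * of_real (\<kappa> * a * \<eta>))) integrable_on {0..Y}"
     "\<And>N Y. 0 \<le> Y \<Longrightarrow> norm (integral {0..Y} (\<lambda>\<eta>. chi_quot_tail z (1 + \<i> * of_real (\<eta> + N)) * exp (\<i> * of_real (\<kappa> * a * \<eta>)))) \<le> C"
    using chi_quot_tail_average_bound[OF a z] by blast
  define D where "D = (if z = a then 0 else z * exp (- \<kappa> * z) * (2 / \<bar>\<kappa> * (a - z)\<bar>))"
  have D: "D \<ge> 0" using z0 by (simp add: D_def)
  have eq: "of_real z * chi_quot (of_real z * (1 + \<i> * of_real (\<eta> + N))) * exp (\<i> * of_real (\<kappa> * a * \<eta>))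
      = modulated a z N \<eta> + chi_quot_tail z (1 + \<i> * of_real (\<eta> + N)) * exp (\<i> * of_real (\<kappa> * a * \<eta>))" for \<eta> N
    using chi_quot_split[OF z0, of "1 + \<i> * of_real (\<eta> + N)"] by (simp add: modulated_def distrib_right)
  have oi: "(modulated a z N) integrable_on {0..Y}" for N Y
    unfolding modulated_eq[abs_def] by (intro integrable_continuous_interval continuous_intros)
  have ob: "norm (integral {0..Y} (modulated a z N) - (if z = a then of_real (Y * a * exp (- \<kappa> * a)) * exp (- \<i> * of_real (\<kappa> * a * N)) else 0)) \<le> D"
    if Y: "0 \<le> Y" for N Y
  proof (cases "z = a")
    case True
    then show ?thesis unfolding modulated_eq[abs_def] using Y by (simp add: D_def scaleR_conv_of_real mult_ac)
  next
    case False
    define k where "k = (of_real (z * exp (- \<kappa> * z)) * exp (- \<i> * of_real (\<kappa> * z * N)) :: complex)"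
    have "integral {0..Y} (modulated a z N) = k * integral {0..Y} (\<lambda>\<eta>. exp (\<i> * of_real (\<kappa> * (a - z) * \<eta>)))"
      unfolding modulated_eq[abs_def] k_def by (rule integral_mult_right)
    also have "norm \<dots> \<le> (z * exp (- \<kappa> * z)) * (2 / \<bar>\<kappa> * (a - z)\<bar>)"
      unfolding norm_mult[of k] unfolding k_def norm_modulated_coeff[OF z0]
      using False \<kappa>_pos z0 Y by (intro mult_left_mono integral_exp_imaginary) auto
    finally show ?thesis using False by (simp add: D_def)
  qed
  show ?thesis
  proof (intro exI[of _ "D + C"] conjI allI impI)
    fix N Y :: real assume Y: "0 \<le> Y"
    show "(\<lambda>\<eta>. of_real z * chi_quot (of_real z * (1 + \<i> * of_real (\<eta> + N))) * exp (\<i> * of_real (\<kappa> * a * \<eta>))) integrable_on {0..Y}"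
      unfolding eq by (intro integrable_add oi C(2) Y)
    have i: "integral {0..Y} (\<lambda>\<eta>. modulated a z N \<eta> + chi_quot_tail z (1 + \<i> * of_real (\<eta> + N)) * exp (\<i> * of_real (\<kappa> * a * \<eta>)))
       = integral {0..Y} (modulated a z N) + integral {0..Y} (\<lambda>\<eta>. chi_quot_tail z (1 + \<i> * of_real (\<eta> + N)) * exp (\<i> * of_real (\<kappa> * a * \<eta>)))"
      by (rule integral_add[OF oi C(2)[OF Y]])
    have "norm (x + y - w) \<le> D + C" if "norm (x - w) \<le> D" "norm y \<le> C" for x y w :: complex
    proof -
      have "norm ((x - w) + y) \<le> D + C" using norm_triangle_ineq[of "x - w" y] that by linarith
      moreover have "x + y - w = (x - w) + y" by simp
      ultimately show ?thesis by (simp only:)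
    qed
    then show "norm (integral {0..Y} (\<lambda>\<eta>. of_real z * chi_quot (of_real z * (1 + \<i> * of_real (\<eta> + N))) * exp (\<i> * of_real (\<kappa> * a * \<eta>)))
       - (if z = a then of_real (Y * a * exp (- \<kappa> * a)) * exp (- \<i> * of_real (\<kappa> * a * N)) else 0)) \<le> D + C"
      unfolding eq i using ob[OF Y] C(3)[OF Y] by blast
  qed (use C D in simp)
qed

text \<open>Cauchy's inequality on discs of radius \<open>\<delta> / 2\<close>.\<close>
lemma holomorphic_bounded_half_plane_lipschitz:
  assumes hol: "A holomorphic_on {t. Re t > 0}" and B: "\<And>t. Re t \<ge> \<delta> / 2 \<Longrightarrow> norm (A t) \<le> B"
    and \<delta>: "\<delta> > 0" and s: "Re s \<ge> \<delta>" "Re s' \<ge> \<delta>"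
  shows "norm (A s - A s') \<le> B / (\<delta> / 2) * norm (s - s')"
proof (rule field_differentiable_bound[where S = "{t. Re t \<ge> \<delta>}" and f' = "deriv A"])
  show "convex {t. Re t \<ge> \<delta>}" by (rule convex_halfspace_Re_ge)
  have op: "open {t. Re t > 0}" by (intro open_Collect_less continuous_intros)
  show "(A has_field_derivative deriv A z) (at z within {t. Re t \<ge> \<delta>})" if "z \<in> {t. Re t \<ge> \<delta>}" for z
    using holomorphic_derivI[OF hol op, of z] that \<delta> by (auto intro: DERIV_subset has_field_derivative_at_within)
  show "norm (deriv A z) \<le> B / (\<delta> / 2)" if "z \<in> {t. Re t \<ge> \<delta>}" for z
  proof -
    have sub: "Re x \<ge> \<delta> / 2" if "x \<in> cball z (\<delta> / 2)" for x
      using that abs_Re_le_cmod[of "z - x"] \<open>z \<in> {t. Re t \<ge> \<delta>}\<close> by (auto simp: dist_norm)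
    have sub': "cball z (\<delta> / 2) \<subseteq> {t. Re t > 0}" using sub \<delta> by force
    have "norm ((deriv ^^ 1) A z) \<le> fact 1 * B / (\<delta> / 2) ^ 1"
    proof (rule Cauchy_inequality)
      show "A holomorphic_on ball z (\<delta> / 2)"
        by (rule holomorphic_on_subset[OF hol order_trans[OF ball_subset_cball sub']])
      show "continuous_on (cball z (\<delta> / 2)) A"
        by (rule continuous_on_subset[OF holomorphic_on_imp_continuous_on[OF hol] sub'])
      show "norm (A x) \<le> B" if "norm (z - x) = \<delta> / 2" for x
        using that by (intro B sub) (auto simp: dist_norm)
    qed (use \<delta> in auto)
    then show ?thesis by simp
  qed
qed (use s in auto)

text \<open>For \<open>t = \<tau> + i M\<close> with \<open>\<tau>\<close> bounded, \<open>kk M\<^sup>2 / t\<close> is \<open>w = kk (\<tau> - i M)\<close> up to \<open>O(1 / M)\<close>. So an equation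
  \<open>t A(t) = s A(s)\<close> becomes \<open>A(t) + kk A(w) = O(1 / M)\<close> after division by \<open>i M\<close>.\<close>
lemma symmetry_error_bound:
  assumes hol: "A holomorphic_on {t. Re t > 0}" and bd: "\<And>\<delta>. \<delta> > 0 \<Longrightarrow> \<exists>B. \<forall>t. Re t \<ge> \<delta> \<longrightarrow> norm (A t) \<le> B"
    and kk: "kk > 0" and Y: "Y \<ge> 0"
  shows "\<exists>K. \<forall>M \<ge> max 1 Y. \<forall>\<eta>\<in>{0..Y}. \<forall>t s. t = 1 + \<i> * of_real (\<eta> + M) \<longrightarrow> s = of_real (kk * M\<^sup>2) / t \<longrightarrow>
     t * A t = s * A s \<longrightarrow> norm (A t + of_real kk * A (of_real kk * (1 + \<i> * of_real (\<eta> - M)))) \<le> K / M"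
proof -
  define \<delta> where "\<delta> = min 1 (kk / 5)"
  have \<delta>: "\<delta> > 0" "\<delta> \<le> 1" "\<delta> \<le> kk / 5" using kk by (auto simp: \<delta>_def)
  obtain B0 where B0: "\<And>t. Re t \<ge> \<delta> / 2 \<Longrightarrow> norm (A t) \<le> B0" using bd[of "\<delta> / 2"] \<delta> by auto
  define B where "B = max B0 0"
  have B: "B \<ge> 0" "\<And>t. Re t \<ge> \<delta> / 2 \<Longrightarrow> norm (A t) \<le> B" using B0 by (force simp: B_def)+
  define L where "L = B / (\<delta> / 2)"
  have L: "L \<ge> 0" using B \<delta> by (simp add: L_def)
  have lip: "norm (A x - A x') \<le> L * norm (x - x')" if "Re x \<ge> \<delta>" "Re x' \<ge> \<delta>" for x x'
    unfolding L_def by (rule holomorphic_bounded_half_plane_lipschitz[OF hol B(2) \<delta>(1) that])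
  define T where "T = 1 + Y"
  have T: "T \<ge> 1" using Y by (simp add: T_def)
  define K where "K = kk * T\<^sup>2 * B + kk * (2 * T) * (L * (kk * T\<^sup>2)) + T * B + kk * T * B"
  have "norm (A t + of_real kk * A (of_real kk * (1 + \<i> * of_real (\<eta> - M)))) \<le> K / M"
    if M: "M \<ge> max 1 Y" and \<eta>: "\<eta> \<in> {0..Y}" and t: "t = 1 + \<i> * of_real (\<eta> + M)" and s: "s = of_real (kk * M\<^sup>2) / t"
      and E: "t * A t = s * A s" for M \<eta> t s
  proof -
    define \<tau> where "\<tau> = 1 + \<i> * complex_of_real \<eta>"
    define w where "w = of_real kk * (1 + \<i> * complex_of_real (\<eta> - M))"
    have M1: "M \<ge> 1" "M \<ge> Y" "M > 0" using M by auto
    have tt: "t = \<tau> + \<i> * of_real M" by (simp add: t \<tau>_def algebra_simps)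
    have ww: "w = of_real kk * (\<tau> - \<i> * of_real M)" by (simp add: w_def \<tau>_def algebra_simps)
    have Ret: "Re t = 1" "Im t = \<eta> + M" by (simp_all add: t)
    then have t0: "t \<noteq> 0" by auto
    have n\<tau>: "norm \<tau> \<le> T"
      using norm_triangle_ineq[of 1 "\<i> * complex_of_real \<eta>"] \<eta> by (simp add: \<tau>_def T_def norm_mult)
    have nt: "norm t \<ge> M" using abs_Im_le_cmod[of t] Ret \<eta> M1 by simp
    have nt2: "(norm t)\<^sup>2 \<le> 5 * M\<^sup>2"
    proof -
      have "(norm t)\<^sup>2 = 1 + (\<eta> + M)\<^sup>2" unfolding cmod_power2 Ret by simp
      moreover have "(\<eta> + M)\<^sup>2 \<le> (2 * M)\<^sup>2" using \<eta> M1 by (intro power_mono) auto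
      moreover have "1 \<le> M\<^sup>2" using M1 by simp
      ultimately show ?thesis by (simp add: power_mult_distrib)
    qed
    have Res: "Re s \<ge> \<delta>"
    proof -
      have "s = of_real (kk * M\<^sup>2) * cnj t / of_real ((norm t)\<^sup>2)"
        unfolding s complex_norm_square using t0 by (simp add: field_simps)
      then have "Re s = kk * M\<^sup>2 / (norm t)\<^sup>2" using Ret by (simp del: of_real_power of_real_mult)
      moreover have "kk / 5 \<le> kk * M\<^sup>2 / (norm t)\<^sup>2"
        using nt2 t0 kk by (simp add: pos_le_divide_eq mult_left_mono)
      ultimately show ?thesis using \<delta>(3) by linarith
    qed
    have Rew: "Re w \<ge> \<delta>" using \<delta>(3) kk by (simp add: w_def)
    have sw: "s - w = - of_real kk * \<tau>\<^sup>2 / t"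
    proof -
      have "s - w = (of_real (kk * M\<^sup>2) - w * t) / t" unfolding s using t0 by (simp add: diff_divide_distrib)
      also have "of_real (kk * M\<^sup>2) - w * t = - of_real kk * \<tau>\<^sup>2"
        unfolding ww tt by (simp add: algebra_simps power2_eq_square)
      finally show ?thesis .
    qed
    have nsw: "norm (s - w) \<le> kk * T\<^sup>2 / M"
    proof -
      have "norm (s - w) = kk * (norm \<tau>)\<^sup>2 / norm t" unfolding sw using kk by (simp add: norm_mult norm_divide norm_power)
      also have "\<dots> \<le> kk * T\<^sup>2 / M" using n\<tau> nt kk M1 by (intro frac_le mult_left_mono power_mono) auto
      finally show ?thesis .
    qed
    have nw: "norm w \<le> kk * (2 * T) * M"
    proof -
      have "norm (\<tau> - \<i> * of_real M) \<le> T + M"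
        using norm_triangle_ineq4[of \<tau> "\<i> * of_real M"] n\<tau> M1 by (simp add: norm_mult)
      also have "T + M \<le> 2 * T * M"
      proof -
        have "T * 1 \<le> T * M" "1 * M \<le> T * M" using T M1 by (intro mult_mono; simp)+
        then show ?thesis by simp
      qed
      finally show ?thesis unfolding ww norm_mult using kk by (simp add: mult_left_mono)
    qed
    have nA: "norm (A t) \<le> B" "norm (A s) \<le> B" "norm (A w) \<le> B"
      using Ret Res Rew \<delta> by (auto intro!: B(2))
    have nd: "norm (A s - A w) \<le> L * (kk * T\<^sup>2 / M)"
      using lip[OF Res Rew] mult_left_mono[OF nsw L] by linarith
    have iM: "\<i> * of_real M = t - \<tau>" "\<i> * of_real M * of_real kk = of_real kk * \<tau> - w"
      by (simp_all add: tt ww algebra_simps)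
    have "\<i> * of_real M * (A t + of_real kk * A w) = (t - \<tau>) * A t + (of_real kk * \<tau> - w) * A w"
      unfolding iM[symmetric] by (simp add: algebra_simps)
    also have "\<dots> = t * A t - \<tau> * A t + (of_real kk * \<tau> - w) * A w" by (simp add: algebra_simps)
    also have "\<dots> = (s - w) * A s + w * (A s - A w) - \<tau> * A t + of_real kk * \<tau> * A w"
      unfolding E by (simp add: algebra_simps)
    finally have fin: "\<i> * of_real M * (A t + of_real kk * A w) = (s - w) * A s + w * (A s - A w) - \<tau> * A t + of_real kk * \<tau> * A w" .
    have "M * norm (A t + of_real kk * A w) = norm (\<i> * of_real M * (A t + of_real kk * A w))"
      using M1 by (simp add: norm_mult)
    also have "\<dots> = norm ((s - w) * A s + w * (A s - A w) - \<tau> * A t + of_real kk * \<tau> * A w)" unfolding fin ..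
    also have "\<dots> \<le> norm ((s - w) * A s) + norm (w * (A s - A w)) + norm (\<tau> * A t) + norm (of_real kk * \<tau> * A w)"
      by (intro order_trans[OF norm_triangle_ineq] order_trans[OF norm_triangle_ineq4] add_mono order_refl)
    also have "\<dots> \<le> kk * T\<^sup>2 * B + kk * (2 * T) * (L * (kk * T\<^sup>2)) + T * B + kk * T * B"
    proof (intro add_mono)
      have "norm (s - w) \<le> kk * T\<^sup>2"
      proof -
        have "kk * T\<^sup>2 / M \<le> kk * T\<^sup>2 / 1" using kk M1 by (intro divide_left_mono) auto
        then show ?thesis using nsw by simp
      qed
      then show "norm ((s - w) * A s) \<le> kk * T\<^sup>2 * B" unfolding norm_mult using nA kk by (intro mult_mono) auto
      have "norm w * norm (A s - A w) \<le> (kk * (2 * T) * M) * (L * (kk * T\<^sup>2 / M))"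
        using nw nd kk T M1 by (intro mult_mono) auto
      then show "norm (w * (A s - A w)) \<le> kk * (2 * T) * (L * (kk * T\<^sup>2))" unfolding norm_mult using M1 by simp
      show "norm (\<tau> * A t) \<le> T * B" unfolding norm_mult using n\<tau> nA T by (intro mult_mono) auto
      show "norm (of_real kk * \<tau> * A w) \<le> kk * T * B"
        unfolding norm_mult using n\<tau> nA T kk by (intro mult_mono) auto
    qed
    finally have "M * norm (A t + of_real kk * A w) \<le> K" by (simp add: K_def)
    then show ?thesis unfolding w_def[symmetric] using M1 by (simp add: pos_le_divide_eq mult.commute)
  qed
  then show ?thesis by blast
qed

text \<open>By periodicity the symmetry also holds with \<open>m\<^sup>2 / t\<close> replaced by \<open>kk M\<^sup>2 / t\<close>, whenever \<open>kk M\<^sup>2\<close> is \<open>m\<^sup>2\<close> times a power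
  of \<open>m^8\<close>. Given \<open>kk\<close>, such \<open>M\<close> are arbitrarily large. So a combination of four almost periodic functions with base
  frequencies \<open>a\<close>, \<open>b\<close>, \<open>kk a\<close>, \<open>kk b\<close> is \<open>O(1 / M)\<close> on an interval of any fixed length \<open>Y\<close>. Its average against
  the frequency \<open>a\<close> is bounded away from \<open>0\<close>, as no other frequency equals \<open>a\<close>.\<close>
lemma no_inversion_symmetry:
  assumes b: "0 < b" "b < a" "m ^ 4 * a < b"
    and E: "\<And>t. Re t > 0 \<Longrightarrow> chi R (of_real a * t) - chi R (of_real b * t)
       = chi R (of_real a * (flip t)) - chi R (of_real b * (flip t))"
  shows False
proof -
  have a: "a > 0" using b by simp
  have m4: "0 < m ^ 4" "m ^ 4 < 1" using m_pos m4_less_1 by auto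
  \<comment> \<open>The geometric mean keeps \<open>kk a\<close> and \<open>kk b\<close> strictly between consecutive members of the sequences \<open>a m^(4k)\<close> and \<open>b m^(4k)\<close>.\<close>
  define kk where "kk = sqrt (a / b)"
  have kk1: "kk > 1" using b by (simp add: kk_def)
  then have kk0: "kk > 0" by simp
  have kk2: "kk * kk = a / b" using a b by (simp add: kk_def)
  have kb: "a = kk * kk * b" using kk2 b by (simp add: field_simps)
  define A where "A t = of_real a * chi_quot (of_real a * t) - of_real b * chi_quot (of_real b * t)" for t
  have scale: "(\<lambda>t. chi_quot (of_real z * t)) holomorphic_on {t. Re t > 0}" if "z > 0" for z
    by (rule holomorphic_on_compose_gen[OF _ chi_quot_holomorphic, unfolded o_def])
      (use that in \<open>auto intro!: holomorphic_intros mult_pos_pos\<close>)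
  have holA: "A holomorphic_on {t. Re t > 0}"
    unfolding A_def by (intro holomorphic_intros scale a b(1))
  have bdA: "\<exists>B. \<forall>t. Re t \<ge> \<delta> \<longrightarrow> norm (A t) \<le> B" if \<delta>: "\<delta> > 0" for \<delta>
  proof -
    define c where "c z = suminf dil + 2 / (\<kappa> * (z * \<delta>))\<^sup>2 * (\<Sum>k. dil (Suc k))" for z
    have "norm (A t) \<le> a * c a + b * c b" if t: "Re t \<ge> \<delta>" for t
    proof -
      have "norm (chi_quot (of_real z * t)) \<le> c z" if "z > 0" for z
        unfolding c_def using that t \<delta> by (intro norm_chi_quot_le) (auto simp: mult_left_mono)
      then have "a * norm (chi_quot (of_real a * t)) \<le> a * c a" "b * norm (chi_quot (of_real b * t)) \<le> b * c b"
        using a b by (auto intro!: mult_left_mono)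
      moreover have "norm (A t) \<le> a * norm (chi_quot (of_real a * t)) + b * norm (chi_quot (of_real b * t))"
        unfolding A_def using a b by (intro order_trans[OF norm_triangle_ineq4]) (simp add: norm_mult)
      ultimately show ?thesis by linarith
    qed
    then show ?thesis by blast
  qed
  have EA: "chi R (of_real a * t) - chi R (of_real b * t) = t * A t" if "Re t > 0" for t
    using that a b by (simp add: chi_eq_chi_quot A_def algebra_simps)
  define y where "y = m / sqrt kk"
  have y: "y > 0" "y * y * kk = m * m"
    using m_pos kk0 by (simp_all add: y_def field_simps)
  have sym: "t * A t = s * A s" if t: "Re t > 0" and s: "s = of_real (kk * (y / dil j)\<^sup>2) / t" and Rs: "Re s > 0" for t s j
  proof -
    have per: "chi R (of_real z * (of_real (1 / (dil j * dil j)) * x)) = chi R (of_real z * x)" for z x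
    proof -
      have "1 / (dil j * dil j) = m powi (4 * (- 2 * int j))"
      proof -
        have "4 * (- 2 * int j) = - int (4 * j + 4 * j)" by simp
        then have "m powi (4 * (- 2 * int j)) = inverse (m ^ (4 * j + 4 * j))"
          by (simp only: power_int_minus power_int_of_nat)
        then show ?thesis unfolding dil_def power_mult[symmetric] power_add[symmetric] by (simp add: inverse_eq_divide)
      qed
      then have "chi R (of_real (1 / (dil j * dil j)) * (of_real z * x)) = chi R (of_real z * x)"
        using chi_periodic by metis
      then show ?thesis by (simp only: mult.left_commute)
    qed
    have "kk * (y / dil j)\<^sup>2 = m\<^sup>2 * (1 / (dil j * dil j))"
      using y(2) dil_pos[of j] by (simp add: power2_eq_square field_simps)
    then have s': "s = of_real (1 / (dil j * dil j)) * (flip t)" unfolding s by simp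
    have "t * A t = chi R (of_real a * (flip t)) - chi R (of_real b * (flip t))"
      using EA[OF t] E[OF t] by simp
    also have "\<dots> = chi R (of_real a * s) - chi R (of_real b * s)" unfolding s' per ..
    also have "\<dots> = s * A s" by (rule EA[OF Rs])
    finally show ?thesis .
  qed
  have z1: "m ^ 4 * a < a" "a < a / m ^ 4"
    using a m4 by (simp_all add: pos_less_divide_eq)
  have z2: "b < a / m ^ 4" using z1(2) b by linarith
  have kkb: "kk * b < a" "b < kk * b" "a < kk * a"
  proof -
    have "1 * (kk * b) < kk * (kk * b)" using kk1 b by (intro mult_strict_right_mono) auto
    then show "kk * b < a" using kb by (simp add: mult.assoc)
  qed (use kk1 a b in auto)
  have z3: "m ^ 4 * a < kk * a" "kk * a < a / m ^ 4"
  proof -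
    show "m ^ 4 * a < kk * a" using z1(1) kkb(3) by linarith
    have "kk < kk * kk" using kk1 by simp
    also have "\<dots> < 1 / m ^ 4" unfolding kk2 using b m4 by (simp add: field_simps)
    finally have "kk * a < 1 / m ^ 4 * a" using a by (intro mult_strict_right_mono) auto
    then show "kk * a < a / m ^ 4" by simp
  qed
  have z4: "m ^ 4 * a < kk * b" "kk * b < a / m ^ 4" using b(3) kkb z1 by linarith+
  define I where "I z N Y = integral {0..Y} (\<lambda>\<eta>. of_real z * chi_quot (of_real z * (1 + \<i> * of_real (\<eta> + N))) * exp (\<i> * of_real (\<kappa> * a * \<eta>)))" for z N Y
  define J where "J z N \<eta> = of_real z * chi_quot (of_real z * (1 + \<i> * of_real (\<eta> + N))) * exp (\<i> * of_real (\<kappa> * a * \<eta>))" for z N \<eta>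
  define D where "D N Y = (of_real (Y * a * exp (- \<kappa> * a)) * exp (- \<i> * of_real (\<kappa> * a * N)) :: complex)" for N Y
  have avg: "\<exists>C\<ge>0. \<forall>N Y. 0 \<le> Y \<longrightarrow> J z N integrable_on {0..Y} \<and> norm (integral {0..Y} (J z N) - (if z = a then D N Y else 0)) \<le> C"
    if "m ^ 4 * a < z" "z < a / m ^ 4" for z
    using chi_quot_average[OF a that] unfolding J_def[abs_def] D_def .
  obtain C1 where C1: "\<And>N Y. 0 \<le> Y \<Longrightarrow> J a N integrable_on {0..Y}" "\<And>N Y. 0 \<le> Y \<Longrightarrow> norm (integral {0..Y} (J a N) - D N Y) \<le> C1"
    using avg[OF z1, unfolded if_P[OF refl]] by blast
  obtain C2 where C2: "\<And>N Y. 0 \<le> Y \<Longrightarrow> J b N integrable_on {0..Y}" "\<And>N Y. 0 \<le> Y \<Longrightarrow> norm (integral {0..Y} (J b N)) \<le> C2"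
    using avg[OF b(3) z2, unfolded if_not_P[OF less_imp_neq[OF b(2)]] diff_0_right] by blast
  have ne: "kk * a \<noteq> a" "kk * b \<noteq> a" using kkb by linarith+
  obtain C3 where C3: "C3 \<ge> 0" "\<And>N Y. 0 \<le> Y \<Longrightarrow> J (kk * a) N integrable_on {0..Y}" "\<And>N Y. 0 \<le> Y \<Longrightarrow> norm (integral {0..Y} (J (kk * a) N)) \<le> C3"
    using avg[OF z3, unfolded if_not_P[OF ne(1)] diff_0_right] by blast
  obtain C4 where C4: "C4 \<ge> 0" "\<And>N Y. 0 \<le> Y \<Longrightarrow> J (kk * b) N integrable_on {0..Y}" "\<And>N Y. 0 \<le> Y \<Longrightarrow> norm (integral {0..Y} (J (kk * b) N)) \<le> C4"
    using avg[OF z4, unfolded if_not_P[OF ne(2)] diff_0_right] by blast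
  have C0: "C1 \<ge> 0" "C2 \<ge> 0"
    using order_trans[OF norm_ge_zero C1(2)[of 0 0]] order_trans[OF norm_ge_zero C2(2)[of 0 0]] by simp_all
  define C where "C = C1 + C2 + C3 + C4"
  have C: "C \<ge> 0" using C0 C3 C4 by (simp add: C_def)
  define e where "e = a * exp (- \<kappa> * a)"
  have e: "e > 0" using a by (simp add: e_def)
  \<comment> \<open>The coefficient of the frequency \<open>a\<close> has modulus \<open>e\<close>; the length \<open>Y\<close> makes its contribution exceed all bounded errors.\<close>
  define Y where "Y = (C + 2) / e"
  have Y: "Y > 0" using C e by (simp add: Y_def)
  obtain K where K: "\<And>M \<eta> t s. M \<ge> max 1 Y \<Longrightarrow> \<eta> \<in> {0..Y} \<Longrightarrow> t = 1 + \<i> * of_real (\<eta> + M) \<Longrightarrow> s = of_real (kk * M\<^sup>2) / t \<Longrightarrow>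
     t * A t = s * A s \<Longrightarrow> norm (A t + of_real kk * A (of_real kk * (1 + \<i> * of_real (\<eta> - M)))) \<le> K / M"
    using symmetry_error_bound[OF holA bdA kk0 less_imp_le[OF Y]] by blast
  \<comment> \<open>The shift \<open>M\<close> has to exceed \<open>Y K\<close> for the error \<open>K / M\<close>, integrated over \<open>{0..Y}\<close>, to be at most \<open>1\<close>.\<close>
  define X where "X = max (max 1 Y) (Y * K)"
  have X: "X \<ge> 1" "X \<ge> Y" "X \<ge> Y * K" by (auto simp: X_def)
  have "\<forall>\<^sub>F j in sequentially. dil j < y / X"
    using summable_LIMSEQ_zero[OF summable_dil] by (rule order_tendstoD) (use y X in simp)
  then obtain j where j: "dil j < y / X" by (auto simp: eventually_sequentially)
  define M where "M = y / dil j"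
  have M: "M \<ge> X" using j dil_pos[of j] X by (simp add: M_def field_simps)
  have M0: "M > 0" using M X by simp
  define f where "f \<eta> = (A (1 + \<i> * of_real (\<eta> + M)) + of_real kk * A (of_real kk * (1 + \<i> * of_real (\<eta> - M)))) * exp (\<i> * of_real (\<kappa> * a * \<eta>))" for \<eta>
  have fJ: "f \<eta> = (J a M \<eta> - J b M \<eta>) + (J (kk * a) (- M) \<eta> - J (kk * b) (- M) \<eta>)" for \<eta>
    unfolding f_def J_def A_def by (simp add: algebra_simps)
  have fint: "f integrable_on {0..Y}" 
    unfolding fJ[abs_def] using Y by (intro integrable_add integrable_diff C1 C2 C3 C4) auto
  have fI: "integral {0..Y} f = (integral {0..Y} (J a M) - integral {0..Y} (J b M)) + (integral {0..Y} (J (kk * a) (- M)) - integral {0..Y} (J (kk * b) (- M)))"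
    unfolding fJ[abs_def] using less_imp_le[OF Y]
    by (simp only: integral_add integral_diff integrable_diff C1 C2 C3 C4)
  have fbd: "norm (f \<eta>) \<le> K / M" if \<eta>: "\<eta> \<in> {0..Y}" for \<eta>
  proof -
    define t where "t = 1 + \<i> * complex_of_real (\<eta> + M)"
    define s where "s = of_real (kk * M\<^sup>2) / t"
    have Rt: "Re t = 1" by (simp add: t_def)
    then have t0: "t \<noteq> 0" by auto
    have "s = of_real (kk * M\<^sup>2) * cnj t / of_real ((norm t)\<^sup>2)"
      unfolding s_def complex_norm_square using t0 by (simp add: field_simps)
    then have "Re s = kk * M\<^sup>2 / (norm t)\<^sup>2" using Rt by (simp del: of_real_power of_real_mult)
    then have "Re s > 0" using kk0 M0 t0 by simp
    then have "t * A t = s * A s" using Rt by (intro sym[of t s j]) (auto simp: s_def M_def)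
    from K[OF _ \<eta> t_def s_def this] M X
    have "norm (A t + of_real kk * A (of_real kk * (1 + \<i> * of_real (\<eta> - M)))) \<le> K / M" by simp
    then show ?thesis unfolding f_def t_def[symmetric] norm_mult using norm_exp_i_times[of "\<kappa> * a * \<eta>"] by (simp del: of_real_mult)
  qed
  have "norm (integral {0..Y} f) \<le> K / M * Y"
  proof -
    have K0: "0 \<le> K / M" using order_trans[OF norm_ge_zero fbd[of 0]] Y by simp
    have "(f has_integral integral {0..Y} f) (cbox 0 Y)" using fint by (simp add: integrable_integral cbox_interval)
    from has_integral_bound[OF K0 this] fbd Y show ?thesis by (simp add: cbox_interval)
  qed
  also have "\<dots> \<le> 1" using M X(3) M0 by (simp add: field_simps)
  finally have 1: "norm (integral {0..Y} f) \<le> 1" .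
  have tri: "norm d \<le> norm F + (c1 + c2 + c3 + c4)"
    if "F = (x1 - x2) + (x3 - x4)" "norm (x1 - d) \<le> c1" "norm x2 \<le> c2" "norm x3 \<le> c3" "norm x4 \<le> c4"
    for F d x1 x2 x3 x4 :: complex and c1 c2 c3 c4
  proof -
    have "norm (F + (- (x1 - d) + (x2 + (- x3 + x4)))) \<le> norm F + (c1 + (c2 + (c3 + c4)))"
      using that by (intro order_trans[OF norm_triangle_ineq] add_mono order_refl) (simp_all add: norm_minus_commute)
    moreover have "F + (- (x1 - d) + (x2 + (- x3 + x4))) = d" unfolding that(1) by simp
    ultimately show ?thesis by (simp only: add.assoc)
  qed
  have "norm (D M Y) \<le> norm (integral {0..Y} f) + C"
    unfolding C_def by (rule tri[OF fI]) (use Y C1 C2 C3 C4 in auto)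
  also have "norm (D M Y) = Y * e"
    unfolding D_def e_def using Y a norm_exp_i_times[of "- (\<kappa> * a * M)"] by (simp add: norm_mult)
  also have "Y * e = C + 2" using e by (simp add: Y_def)
  finally show False using 1 by simp
qed

text \<open>Equality on \<open>Dom\<close> removes the prefactor and continues analytically to the right half-plane. The scales \<open>m^(4q)\<close> and
  \<open>m^(4p)\<close> differ by a factor strictly between \<open>m^4\<close> and \<open>1\<close>.\<close>
theorem f_lim_distinct:
  assumes "0 \<le> q" "q < p" "p < 1"
  shows "\<exists>t\<in>Dom R. f_lim R q t \<noteq> f_lim R p t"
proof (rule ccontr)
  assume "\<not> (\<exists>t\<in>Dom R. f_lim R q t \<noteq> f_lim R p t)"
  then have eq: "f_lim R q t = f_lim R p t" if "t \<in> Dom R" for t using that by blast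
  define a b where "a = phase_scale q" and "b = phase_scale p"
  have ab: "0 < a" "0 < b" by (simp_all add: a_def b_def phase_scale_pos)
  have "b < a" unfolding a_def b_def phase_scale_def using assms m_pos m_less_1 by (intro powr_less_mono') auto
  moreover have "m ^ 4 * a < b"
  proof -
    have "m ^ 4 * a = m powr (4 + 4 * q)"
      unfolding a_def phase_scale_def using m_pos by (simp add: powr_add)
    also have "\<dots> < b" unfolding b_def phase_scale_def using assms m_pos m_less_1 by (intro powr_less_mono') auto
    finally show ?thesis .
  qed
  moreover have "chi R (of_real a * t) - chi R (of_real b * t)
       = chi R (of_real a * (flip t)) - chi R (of_real b * (flip t))" if "Re t > 0" for t
  proof (rule analytic_continuation_open[of "Dom R" "{t. Re t > 0}"
        "\<lambda>t. chi R (of_real a * t) - chi R (of_real b * t)"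
        "\<lambda>t. chi R (of_real a * (flip t)) - chi R (of_real b * (flip t))"])
    show "open (Dom R)" by (rule open_Dom)
    show "open {t. Re t > 0}" by (intro open_Collect_less continuous_intros)
    show "Dom R \<noteq> {}" using m_in_Dom by auto
    show "connected {t. Re t > 0}" by (intro convex_connected convex_halfspace_Re_gt)
    show "Dom R \<subseteq> {t. Re t > 0}" using Dom_D by auto
    have h: "(\<lambda>t. chi R (of_real z * t)) holomorphic_on {t. Re t > 0}" if "z > 0" for z
      by (rule holomorphic_on_compose_gen[OF _ chi_holomorphic, unfolded o_def])
        (use that in \<open>auto intro!: holomorphic_intros mult_pos_pos\<close>)
    show "(\<lambda>t. chi R (of_real a * t) - chi R (of_real b * t)) holomorphic_on {t. Re t > 0}"
      by (intro holomorphic_intros h ab)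
    have inv: "(\<lambda>t. flip t) holomorphic_on {t. Re t > 0}" by (intro holomorphic_intros) auto
    have Ri: "Re (flip t) > 0" if "Re t > 0" for t
    proof -
      have "flip t = of_real (m\<^sup>2) * inverse t" by (simp add: divide_inverse)
      moreover have "Re (inverse t) > 0" using that by (simp add: sum_power2_gt_zero_iff)
      ultimately show ?thesis using m_pos Re_scale[of "m\<^sup>2" "inverse t"] by (simp only: mult_pos_pos zero_less_power)
    qed
    have h': "(\<lambda>t. chi R (of_real z * (flip t))) holomorphic_on {t. Re t > 0}" if "z > 0" for z
      by (rule holomorphic_on_compose_gen[OF inv h[OF that], unfolded o_def]) (use Ri in auto)
    show "(\<lambda>t. chi R (of_real a * (flip t)) - chi R (of_real b * (flip t))) holomorphic_on {t. Re t > 0}"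
      by (intro holomorphic_intros h' ab)
    show "t \<in> {t. Re t > 0}" using that by simp
    fix z assume z: "z \<in> Dom R"
    show "chi R (of_real a * z) - chi R (of_real b * z)
       = chi R (of_real a * (flip z)) - chi R (of_real b * (flip z))"
    proof (cases "z = of_real m")
      case True
      then show ?thesis using m_pos by (simp add: power2_eq_square)
    next
      case False
      have prefactor_nz: "prefactor z \<noteq> 0"
      proof -
        have "1 - of_real m * z \<noteq> 0" "1 - of_real (m ^ 3) / z \<noteq> 0" using Dom_D(5-7)[OF z] by (auto simp: field_simps)
        then show ?thesis unfolding prefactor_def using R_gt_2 m4_ne_1 by (simp add: power_eq_0_iff)
      qed
      have "prefactor z * ((chi R (of_real a * z) - chi R (of_real a * (flip z))) / (z - flip z))
        = prefactor z * ((chi R (of_real b * z) - chi R (of_real b * (flip z))) / (z - flip z))"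
        using eq[OF z] unfolding f_lim_eq[OF False] a_def b_def .
      then have "chi R (of_real a * z) - chi R (of_real a * (flip z))
        = chi R (of_real b * z) - chi R (of_real b * (flip z))"
        using prefactor_nz Dom_denominator(1)[OF z False] by (metis divide_cancel_right mult_cancel_left)
      then show ?thesis by (simp add: algebra_simps)
    qed
  qed
  ultimately show False using no_inversion_symmetry[OF ab(2)] by blast
qed

end

section \<open>Convergent subsequences\<close>

lemma normal_limit_unique:
  assumes "normal_limit U F g" "normal_limit U F h" "t \<in> U"
  shows "g t = h t"
proof -
  have "compact {t} \<and> {t} \<subseteq> U" using assms(3) by simp
  then have u: "uniform_limit {t} F g sequentially" "uniform_limit {t} F h sequentially"
    using assms(1,2) unfolding normal_limit_def by blast+
  have "(\<lambda>k. F k t) \<longlonglongrightarrow> g t" "(\<lambda>k. F k t) \<longlonglongrightarrow> h t"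
    by (rule tendsto_uniform_limitI[OF u(1)], simp) (rule tendsto_uniform_limitI[OF u(2)], simp)
  then show ?thesis by (rule LIMSEQ_unique)
qed

lemma uniform_limit_subseq:
  assumes "uniform_limit K F g sequentially" "strict_mono (r :: nat \<Rightarrow> nat)"
  shows "uniform_limit K (\<lambda>k. F (r k)) g sequentially"
  using assms unfolding uniform_limit_iff by (auto intro: eventually_subseq)

lemma normal_limit_subseq:
  assumes "normal_limit U F g" "strict_mono r"
  shows "normal_limit U (\<lambda>k. F (r k)) g"
  using assms unfolding normal_limit_def by (auto intro: uniform_limit_subseq)

lemma normal_limit_cong:
  assumes "normal_limit U F g" "\<And>t. t \<in> U \<Longrightarrow> h t = g t"
  shows "normal_limit U F h"
  unfolding normal_limit_def
proof (intro allI impI)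
  fix K assume K: "compact K \<and> K \<subseteq> U"
  then have "uniform_limit K F g sequentially" using assms(1) unfolding normal_limit_def by blast
  moreover have "h t = g t" if "t \<in> K" for t using assms(2) K that by blast
  ultimately show "uniform_limit K F h sequentially" unfolding uniform_limit_iff by auto
qed

lemma unimodular_phase:
  assumes "norm l = 1"
  obtains q where "q \<in> {0..<1}" "l = exp (2 * of_real pi * \<i> * of_real q)"
proof -
  obtain t where t: "0 \<le> t" "t < 2 * pi" "l = Complex (cos t) (sin t)"
    using complex_unimodular_polar[OF assms] by blast
  have "l = cis t" using t(3) by (simp add: complex_eq_iff)
  then have "l = exp (\<i> * of_real t)" by (simp add: cis_conv_exp)
  then have "l = exp (2 * of_real pi * \<i> * of_real (t / (2 * pi)))" by (simp add: mult.commute)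
  then show ?thesis using that[of "t / (2 * pi)"] t by auto
qed

lemma exp_2pi_of_int: "exp (2 * of_int j * of_real pi * \<i>) = 1"
  using exp_integer_2pi[of "of_int j"] by simp

text \<open>The logarithm is continuous at \<open>1\<close>.\<close>
lemma phase_tendsto_1_imp:
  fixes x :: "nat \<Rightarrow> real"
  assumes "(\<lambda>k. exp (2 * of_real pi * \<i> * of_real (x k))) \<longlonglongrightarrow> 1"
  shows "(\<lambda>k. x k - of_int \<lceil>x k - 1 / 2\<rceil>) \<longlonglongrightarrow> 0"
proof -
  \<comment> \<open>Rounding by this ceiling puts \<open>e\<close> into the half-open interval on which \<open>Ln\<close> inverts \<open>exp\<close>.\<close>
  define e where "e k = x k - of_int \<lceil>x k - 1 / 2\<rceil>" for k
  have e: "- (1 / 2) < e k" "e k \<le> 1 / 2" for k unfolding e_def by linarith+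
  have "exp (2 * of_real pi * \<i> * of_real (x k)) = exp (2 * of_real pi * \<i> * of_real (e k))" for k
  proof -
    have "2 * of_real pi * \<i> * of_real (x k) = 2 * of_real pi * \<i> * of_real (e k) + 2 * of_int \<lceil>x k - 1 / 2\<rceil> * of_real pi * \<i>"
      by (simp add: e_def algebra_simps)
    then show ?thesis by (simp only: exp_add exp_2pi_of_int mult_1_right)
  qed
  then have "(\<lambda>k. exp (2 * of_real pi * \<i> * of_real (e k))) \<longlonglongrightarrow> 1" using assms by simp
  then have "(\<lambda>k. Ln (exp (2 * of_real pi * \<i> * of_real (e k)))) \<longlonglongrightarrow> Ln 1"
    by (intro tendsto_Ln) auto
  moreover have "Ln (exp (2 * of_real pi * \<i> * of_real (e k))) = 2 * of_real pi * \<i> * of_real (e k)" for k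
  proof (rule Ln_exp)
    have "2 * pi * (- (1 / 2)) < 2 * pi * e k" by (rule mult_strict_left_mono[OF e(1)]) simp
    moreover have "2 * pi * e k \<le> 2 * pi * (1 / 2)" by (rule mult_left_mono[OF e(2)]) simp
    moreover have "Im (2 * of_real pi * \<i> * of_real (e k)) = 2 * pi * e k" by simp
    ultimately show "- pi < Im (2 * of_real pi * \<i> * of_real (e k))" "Im (2 * of_real pi * \<i> * of_real (e k)) \<le> pi"
      by linarith+
  qed
  ultimately have "(\<lambda>k. 2 * of_real pi * \<i> * of_real (e k)) \<longlonglongrightarrow> 0" by simp
  then have "(\<lambda>k. Im (2 * of_real pi * \<i> * of_real (e k))) \<longlonglongrightarrow> Im 0" by (rule tendsto_Im)
  then have "(\<lambda>k. 2 * pi * e k) \<longlonglongrightarrow> 0" by simp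
  from tendsto_mult[OF tendsto_const[of "1 / (2 * pi)"] this] show ?thesis by (simp add: e_def)
qed

context joukowski_disc
begin

abbreviation log_index :: "nat \<Rightarrow> real" where "log_index n \<equiv> log (mu R ^ 4) (real n)"

lemma normal_limit_of_phase:
  assumes orth: "orthonormal_polys R p" and n: "strict_mono n" and ph: "log_phase_tendsto R n q"
  shows "normal_limit (Dom R) (\<lambda>k. scaled_PP R p (n k)) (f_lim R q)"
  unfolding normal_limit_def
proof (intro allI impI)
  fix K assume "compact K \<and> K \<subseteq> Dom R"
  then have K: "compact K" "K \<subseteq> Dom R" by auto
  define e where "e k = (log_index (n k) - q) - of_int \<lceil>(log_index (n k) - q) - 1 / 2\<rceil>" for k
  have "e \<longlonglongrightarrow> 0" unfolding e_def
    by (rule phase_tendsto_1_imp) (use ph in \<open>simp add: log_phase_tendsto_def\<close>)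
  from tendsto_add[OF tendsto_const[of q] this] have "(\<lambda>k. q + e k) \<longlonglongrightarrow> q" by simp
  then have 1: "uniform_limit K (\<lambda>k. f_lim R (q + e k)) (f_lim R q) sequentially"
    by (rule f_lim_continuous[OF _ K])
  have "log_index (n k) = (q + e k) + of_int \<lceil>(log_index (n k) - q) - 1 / 2\<rceil>" for k by (simp add: e_def)
  then have fe: "f_lim R (log_index (n k)) = f_lim R (q + e k)" for k by (metis f_lim_periodic)
  have 2: "uniform_limit K (\<lambda>k t. scaled_PP R p (n k) t - f_lim R (log_index (n k)) t) (\<lambda>_. 0) sequentially"
    by (rule uniform_limit_subseq[OF scaled_PP_asymptotics[OF orth K] n])
  have "uniform_limit K (\<lambda>k t. (scaled_PP R p (n k) t - f_lim R (log_index (n k)) t) + f_lim R (q + e k) t) (\<lambda>t. 0 + f_lim R q t) sequentially"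
    by (rule uniform_limit_add[OF 2 1])
  then show "uniform_limit K (\<lambda>k. scaled_PP R p (n k)) (f_lim R q) sequentially"
    by (simp add: fe)
qed

text \<open>The phases lie on a compact circle. Every limit phase of a subsequence determines the limit function, and distinct
  phases have distinct functions; so there is only one limit phase.\<close>
lemma phase_of_normal_limit:
  assumes orth: "orthonormal_polys R p" and n: "strict_mono n"
    and lim: "normal_limit (Dom R) (\<lambda>k. scaled_PP R p (n k)) g"
  shows "\<exists>q\<in>{0..<1}. log_phase_tendsto R n q"
proof -
  define c where "c k = exp (2 * of_real pi * \<i> * of_real (log_index (n k)))" for k
  have nc: "norm (c k) = 1" for k
    unfolding c_def by (simp add: norm_exp_eq_Re)
  have phase: "log_phase_tendsto R (n \<circ> r) q" if "(c \<circ> r) \<longlonglongrightarrow> exp (2 * of_real pi * \<i> * of_real q)" for r q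
  proof -
    define l where "l = exp (2 * of_real pi * \<i> * complex_of_real q)"
    have "l \<noteq> 0" by (simp add: l_def)
    have "(\<lambda>k. (c \<circ> r) k / l) \<longlonglongrightarrow> l / l"
      by (rule tendsto_divide[OF that[folded l_def] tendsto_const \<open>l \<noteq> 0\<close>])
    moreover have "(c \<circ> r) k / l = exp (2 * of_real pi * \<i> * of_real (log_index ((n \<circ> r) k) - q))" for k
      unfolding c_def l_def o_def exp_diff[symmetric] by (simp add: algebra_simps)
    ultimately show ?thesis unfolding log_phase_tendsto_def using \<open>l \<noteq> 0\<close> by simp
  qed
  have sub: "\<exists>r' q. strict_mono r' \<and> q \<in> {0..<1} \<and> (c \<circ> (r \<circ> r')) \<longlonglongrightarrow> exp (2 * of_real pi * \<i> * of_real q) \<and> (\<forall>t\<in>Dom R. f_lim R q t = g t)"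
    if r: "strict_mono r" for r :: "nat \<Rightarrow> nat"
  proof -
    have "compact (sphere (0::complex) 1)" by simp
    moreover have "\<forall>k. (c \<circ> r) k \<in> sphere 0 1" using nc by simp
    ultimately obtain l r' where l: "l \<in> sphere 0 1" "strict_mono r'" "((c \<circ> r) \<circ> r') \<longlonglongrightarrow> l"
      unfolding compact_def by blast
    obtain q where q: "q \<in> {0..<1}" "l = exp (2 * of_real pi * \<i> * of_real q)"
      using unimodular_phase[of l] l(1) by auto
    have cl: "(c \<circ> (r \<circ> r')) \<longlonglongrightarrow> exp (2 * of_real pi * \<i> * of_real q)" using l(3) q(2) by (simp add: o_assoc)
    have sm: "strict_mono (r \<circ> r')" using r l(2) by (rule strict_mono_o)
    have "normal_limit (Dom R) (\<lambda>k. scaled_PP R p ((n \<circ> (r \<circ> r')) k)) (f_lim R q)"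
      by (rule normal_limit_of_phase[OF orth strict_mono_o[OF n sm] phase[OF cl]])
    moreover have "normal_limit (Dom R) (\<lambda>k. scaled_PP R p ((n \<circ> (r \<circ> r')) k)) g"
      using normal_limit_subseq[OF lim sm] by (simp add: o_def)
    ultimately have "\<forall>t\<in>Dom R. f_lim R q t = g t" using normal_limit_unique by blast
    then show ?thesis using l(2) q(1) cl by blast
  qed
  obtain r q where q: "q \<in> {0..<1}" "\<forall>t\<in>Dom R. f_lim R q t = g t"
    using sub[OF strict_mono_id] by blast
  define l where "l = exp (2 * of_real pi * \<i> * complex_of_real q)"
  have "c \<longlonglongrightarrow> l"
  proof (rule ccontr)
    assume "\<not> c \<longlonglongrightarrow> l"
    then obtain e where e: "e > 0" "\<not> (\<forall>\<^sub>F k in sequentially. dist (c k) l < e)"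
      unfolding tendsto_iff by blast
    obtain s :: "nat \<Rightarrow> nat" where s: "strict_mono s" "\<And>k. \<not> dist (c (s k)) l < e"
      using not_eventually_sequentiallyD[OF e(2)] by blast
    obtain r' q' where q': "strict_mono r'" "q' \<in> {0..<1}" "(c \<circ> (s \<circ> r')) \<longlonglongrightarrow> exp (2 * of_real pi * \<i> * of_real q')"
        "\<forall>t\<in>Dom R. f_lim R q' t = g t"
      using sub[OF s(1)] by blast
    have "q = q'"
    proof (rule ccontr)
      assume "q \<noteq> q'"
      then consider "q < q'" | "q' < q" by linarith
      then have "\<exists>t\<in>Dom R. f_lim R q t \<noteq> f_lim R q' t"
      proof cases
        case 1
        then show ?thesis using q(1) q'(2) by (intro f_lim_distinct) auto
      next
        case 2
        have "\<exists>t\<in>Dom R. f_lim R q' t \<noteq> f_lim R q t" using 2 q(1) q'(2) by (intro f_lim_distinct) auto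
        then show ?thesis by metis
      qed
      then show False using q(2) q'(4) by metis
    qed
    then have "(c \<circ> (s \<circ> r')) \<longlonglongrightarrow> l" using q'(3) by (simp add: l_def)
    then have "\<forall>\<^sub>F k in sequentially. dist ((c \<circ> (s \<circ> r')) k) l < e" using e(1) by (rule tendstoD)
    then obtain k where "dist ((c \<circ> (s \<circ> r')) k) l < e" by (auto simp: eventually_sequentially)
    then show False using s(2)[of "r' k"] by simp
  qed
  then have "log_phase_tendsto R (n \<circ> id) q" by (intro phase) (simp add: l_def)
  then show ?thesis using q(1) by auto
qed

text \<open>The integers next to \<open>m^(4(q - k))\<close>; rounding is negligible because these numbers tend to infinity. The initial shift
  \<open>k0\<close> makes consecutive ones differ by at least \<open>1\<close>.\<close>
lemma phase_sequence:
  obtains n :: "nat \<Rightarrow> nat" and k0 :: nat and \<delta> :: "nat \<Rightarrow> real"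
  where "strict_mono n" "\<And>k. n k \<ge> 1" "\<delta> \<longlonglongrightarrow> 0" "\<And>k. log_index (n k) = q - real (k + k0) + \<delta> k"
proof -
  define M where "M = m ^ 4"
  have M: "0 < M" "M < 1" using m_pos m4_less_1 by (auto simp: M_def)
  have lnM: "ln M < 0" using M by simp
  have top: "filterlim (\<lambda>k::nat. M powr (q - real k)) at_top sequentially"
  proof -
    have "M powr (q - real k) = M powr q * (1 / M) ^ k" for k
      using M by (simp add: powr_diff powr_realpow power_divide)
    moreover have "filterlim (\<lambda>k. M powr q * (1 / M) ^ k) at_top sequentially"
    proof (rule filterlim_tendsto_pos_mult_at_top[OF tendsto_const])
      show "filterlim (\<lambda>k. (1 / M) ^ k) at_top sequentially"
      proof -
        have "filterlim (\<lambda>k. norm ((1 / M) ^ k)) at_top sequentially"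
          using M by (intro filterlim_at_infinity_imp_norm_at_top filterlim_realpow_sequentially_gt1) simp
        then show ?thesis using M by (simp add: norm_power)
      qed
    qed (use M in auto)
    ultimately show ?thesis by simp
  qed
  then have "\<forall>\<^sub>F k in sequentially. M powr (q - real k) \<ge> max 1 (1 / (1 / M - 1))"
    unfolding filterlim_at_top by blast
  then obtain k0 where k0: "\<And>k. k \<ge> k0 \<Longrightarrow> M powr (q - real k) \<ge> max 1 (1 / (1 / M - 1))"
    by (auto simp: eventually_sequentially)
  define s where "s k = M powr (q - real (k + k0))" for k
  have s1: "s k \<ge> 1" for k using k0[of "k + k0"] by (simp add: s_def)
  have sS: "s (Suc k) \<ge> s k + 1" for k
  proof -
    have e: "s (Suc k) = s k * (1 / M)"
    proof -
      have "q - real (Suc k + k0) = (q - real (k + k0)) - 1" by simp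
      then show ?thesis unfolding s_def using M by (simp only: powr_diff powr_one) simp
    qed
    have "1 / (1 / M - 1) \<le> s k" using k0[of "k + k0"] by (simp add: s_def)
    moreover have "1 / M - 1 > 0" using M by simp
    ultimately have "1 \<le> s k * (1 / M - 1)" by (simp add: pos_divide_le_eq)
    then show ?thesis unfolding e by (simp add: algebra_simps)
  qed
  have stop: "filterlim s at_top sequentially"
    unfolding s_def using filterlim_compose[OF top filterlim_add_const_nat_at_top] by simp
  define n where "n k = nat \<lceil>s k\<rceil>" for k
  have rn: "real (n k) = of_int \<lceil>s k\<rceil>" for k using s1[of k] by (simp add: n_def)
  have nb: "s k \<le> real (n k)" "real (n k) \<le> s k + 1" for k unfolding rn by linarith+
  have n1: "n k \<ge> 1" for k using nb(1)[of k] s1[of k] by linarith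
  have "n k < n (Suc k)" for k
  proof -
    have "real (n k) < s k + 1" unfolding rn by linarith
    also have "\<dots> \<le> real (n (Suc k))" using sS[of k] nb(1)[of "Suc k"] by linarith
    finally show ?thesis by simp
  qed
  then have sm: "strict_mono n" by (simp add: strict_mono_Suc_iff)
  define \<delta> where "\<delta> k = log M (real (n k) / s k)" for k
  have r1: "(\<lambda>k. real (n k) / s k) \<longlonglongrightarrow> 1"
  proof (rule tendsto_sandwich[of "\<lambda>_. 1" _ _ "\<lambda>k. 1 + 1 / s k"])
    have s0: "s k > 0" for k using s1[of k] by linarith
    show "\<forall>\<^sub>F k in sequentially. 1 \<le> real (n k) / s k" using nb(1) s0 by (simp add: pos_le_divide_eq)
    show "\<forall>\<^sub>F k in sequentially. real (n k) / s k \<le> 1 + 1 / s k"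
    proof (intro always_eventually allI)
      fix k
      have "real (n k) / s k \<le> (s k + 1) / s k" using s0[of k] nb(2)[of k] by (intro divide_right_mono) auto
      then show "real (n k) / s k \<le> 1 + 1 / s k" using s0[of k] by (simp add: add_divide_distrib)
    qed
    have "(\<lambda>k. 1 / s k) \<longlonglongrightarrow> 0" using tendsto_inverse_0_at_top[OF stop] by (simp add: inverse_eq_divide)
    from tendsto_add[OF tendsto_const this] show "(\<lambda>k. 1 + 1 / s k) \<longlonglongrightarrow> 1" by simp
  qed simp
  have "(\<lambda>k. ln (real (n k) / s k) / ln M) \<longlonglongrightarrow> ln 1 / ln M"
    using lnM by (intro tendsto_divide tendsto_ln r1 tendsto_const) auto
  then have d0: "\<delta> \<longlonglongrightarrow> 0" unfolding \<delta>_def log_def by simp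
  have Ln: "log_index (n k) = q - real (k + k0) + \<delta> k" for k
  proof -
    have s0: "s k > 0" using s1[of k] by linarith
    have "ln (s k) = (q - real (k + k0)) * ln M" using M by (simp add: s_def ln_powr)
    moreover have "ln (real (n k) / s k) = ln (real (n k)) - ln (s k)" using s0 n1[of k] by (simp add: ln_div)
    ultimately show ?thesis unfolding \<delta>_def log_def m_def[symmetric] M_def[symmetric]
      using lnM by (simp add: field_simps)
  qed
  show ?thesis by (rule that[OF sm n1 d0 Ln])
qed

lemma phase_attained: "\<exists>n. strict_mono n \<and> log_phase_tendsto R n q"
proof -
  obtain n :: "nat \<Rightarrow> nat" and k0 \<delta> where n: "strict_mono n" "\<delta> \<longlonglongrightarrow> 0" "\<And>k. log_index (n k) = q - real (k + k0) + \<delta> k"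
    using phase_sequence[of q] by metis
  have "exp (2 * of_real pi * \<i> * of_real (log_index (n k) - q)) = exp (2 * of_real pi * \<i> * of_real (\<delta> k))" for k
  proof -
    have "2 * of_real pi * \<i> * of_real (log_index (n k) - q) = 2 * of_real pi * \<i> * of_real (\<delta> k) + 2 * of_int (- int (k + k0)) * of_real pi * \<i>"
      unfolding n(3) by (simp add: algebra_simps)
    then show ?thesis by (simp only: exp_add exp_2pi_of_int mult_1_right)
  qed
  moreover have "(\<lambda>k. exp (2 * of_real pi * \<i> * of_real (\<delta> k))) \<longlonglongrightarrow> exp (2 * of_real pi * \<i> * of_real 0)"
    by (intro tendsto_intros n(2))
  ultimately have "log_phase_tendsto R n q" unfolding log_phase_tendsto_def by simp
  then show ?thesis using n(1) by blast
qed

lemma frac_log_dense: "{0..<1} \<subseteq> closure {frac (log_index n) | n :: nat. n \<ge> 1}"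
proof
  fix q :: real assume q: "q \<in> {0..<1}"
  let ?S = "{frac (log_index n) | n :: nat. n \<ge> 1}"
  show "q \<in> closure ?S"
  proof (cases "q = 0")
    case True
    have "frac (log_index 1) \<in> ?S" by blast
    moreover have "frac (log_index 1) = 0" by simp
    ultimately have "0 \<in> ?S" by metis
    then show ?thesis unfolding True by (rule subsetD[OF closure_subset])
  next
    case False
    then have q: "0 < q" "q < 1" using q by auto
    obtain n :: "nat \<Rightarrow> nat" and k0 \<delta> where n: "\<And>k. n k \<ge> 1" "\<delta> \<longlonglongrightarrow> 0" "\<And>k. log_index (n k) = q - real (k + k0) + \<delta> k"
      using phase_sequence[of q] by metis
    have lim: "(\<lambda>k. q + \<delta> k) \<longlonglongrightarrow> q" using tendsto_add[OF tendsto_const n(2), of q] by simp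
    have "\<forall>\<^sub>F k in sequentially. 0 < q + \<delta> k \<and> q + \<delta> k < 1"
      using order_tendstoD[OF lim] q by (auto intro: eventually_conj)
    then have "\<forall>\<^sub>F k in sequentially. q + \<delta> k = frac (log_index (n k))"
    proof eventually_elim
      case (elim k)
      have "frac (log_index (n k)) = frac ((q + \<delta> k) + of_int (- int (k + k0)))" unfolding n(3) by (simp add: algebra_simps)
      also have "\<dots> = frac (q + \<delta> k)" by (rule frac_add_of_int_right)
      also have "\<dots> = q + \<delta> k" using elim by (simp add: frac_eq)
      finally show ?case by simp
    qed
    with lim have "(\<lambda>k. frac (log_index (n k))) \<longlonglongrightarrow> q" by (rule Lim_transform_eventually)
    moreover have "frac (log_index (n k)) \<in> ?S" for k using n(1) by blast
    ultimately show ?thesis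
      unfolding closure_sequential by (intro exI[of _ "\<lambda>k. frac (log_index (n k))"] conjI allI)
  qed
qed

lemma normal_limit_points:
  assumes orth: "orthonormal_polys R p"
  shows "normal_limit_point (Dom R) (scaled_PP R p) g \<longleftrightarrow> (\<exists>q\<in>{0..<1}. \<forall>t\<in>Dom R. g t = f_lim R q t)"
proof
  assume "normal_limit_point (Dom R) (scaled_PP R p) g"
  then obtain n where n: "strict_mono n" "normal_limit (Dom R) (\<lambda>k. scaled_PP R p (n k)) g"
    unfolding normal_limit_point_def by blast
  obtain q where q: "q \<in> {0..<1}" "log_phase_tendsto R n q" using phase_of_normal_limit[OF orth n] by blast
  then show "\<exists>q\<in>{0..<1}. \<forall>t\<in>Dom R. g t = f_lim R q t"
    using normal_limit_unique[OF n(2) normal_limit_of_phase[OF orth n(1) q(2)]] by blast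
next
  assume "\<exists>q\<in>{0..<1}. \<forall>t\<in>Dom R. g t = f_lim R q t"
  then obtain q where q: "\<And>t. t \<in> Dom R \<Longrightarrow> g t = f_lim R q t" by blast
  obtain n where n: "strict_mono n" "log_phase_tendsto R n q" using phase_attained by blast
  have "normal_limit (Dom R) (\<lambda>k. scaled_PP R p (n k)) g"
    by (rule normal_limit_cong[OF normal_limit_of_phase[OF orth n] q])
  then show "normal_limit_point (Dom R) (scaled_PP R p) g"
    unfolding normal_limit_point_def using n(1) by blast
qed

end

theorem theorem1p2:
  fixes R :: real and p :: "nat \<Rightarrow> complex poly"
  assumes "R > 2" and "orthonormal_polys R p"
  shows
    "(\<forall>n :: nat \<Rightarrow> nat. strict_mono n \<longrightarrow>
        (converges_normally (Dom R) (\<lambda>k. scaled_PP R p (n k)) \<longleftrightarrow>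
           (\<exists>q\<in>{0..<1}. log_phase_tendsto R n q)) \<and>
        (\<forall>q\<in>{0..<1}. log_phase_tendsto R n q \<longrightarrow>
           normal_limit (Dom R) (\<lambda>k. scaled_PP R p (n k)) (f_lim R q))) \<and>
     (\<forall>q p'. 0 \<le> q \<and> q < p' \<and> p' < 1 \<longrightarrow> (\<exists>t\<in>Dom R. f_lim R q t \<noteq> f_lim R p' t)) \<and>
     {0..<1} \<subseteq> closure {frac (log (mu R ^ 4) (real n)) | n :: nat. n \<ge> 1} \<and>
     (\<forall>g. normal_limit_point (Dom R) (scaled_PP R p) g \<longleftrightarrow>
        (\<exists>q\<in>{0..<1}. \<forall>t\<in>Dom R. g t = f_lim R q t))"
proof -
  interpret joukowski_disc R by unfold_locales (rule assms)
  note orth = assms(2)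
  have iff: "converges_normally (Dom R) (\<lambda>k. scaled_PP R p (n k)) \<longleftrightarrow> (\<exists>q\<in>{0..<1}. log_phase_tendsto R n q)"
    if "strict_mono n" for n
    unfolding converges_normally_def
    using phase_of_normal_limit[OF orth that] normal_limit_of_phase[OF orth that] by blast
  show ?thesis
  proof (intro conjI allI impI ballI)
    show "converges_normally (Dom R) (\<lambda>k. scaled_PP R p (n k)) \<longleftrightarrow> (\<exists>q\<in>{0..<1}. log_phase_tendsto R n q)"
      if "strict_mono n" for n
      by (rule iff[OF that])
    show "normal_limit (Dom R) (\<lambda>k. scaled_PP R p (n k)) (f_lim R q)"
      if "strict_mono n" "log_phase_tendsto R n q" for n q
      by (rule normal_limit_of_phase[OF orth that])
    show "\<exists>t\<in>Dom R. f_lim R q t \<noteq> f_lim R p' t" if "0 \<le> q \<and> q < p' \<and> p' < 1" for q p'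
      using f_lim_distinct[of q p'] that by blast
    show "{0..<1} \<subseteq> closure {frac (log (mu R ^ 4) (real n)) | n :: nat. n \<ge> 1}"
      by (rule frac_log_dense)
    show "normal_limit_point (Dom R) (scaled_PP R p) g \<longleftrightarrow> (\<exists>q\<in>{0..<1}. \<forall>t\<in>Dom R. g t = f_lim R q t)" for g
      by (rule normal_limit_points[OF orth])
  qed
qed

end
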